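(* Let $\alpha>-1$. Then a function $u$ in $\mathbb{H}$ belongs to the class $\mathcal{V}_\alpha$ if and only if it is $\alpha$-harmonic in $\mathbb{H}$, has temperate growth at infinity, and vanishes on the real line in the sense that $u(z)\to 0$ as $\mathbb{H}\ni z\to x$ for every $x\in\mathbb{R}$.
   Context: $\mathbb{H}=\{z\in\mathbb{C}:\operatorname{Im} z>0\}$ is the open upper half-plane. Functions are complex-valued. $\partial_z$ and $\bar\partial_z$ are the usual complex partial derivatives, $\partial_z=\frac12(\partial_x-i\partial_y)$, $\bar\partial_z=\frac12(\partial_x+i\partial_y)$ for $z=x+iy$. For $\alpha>-1$, a function $u\in C^2(\mathbb{H})$ is called $\alpha$-harmonic in $\mathbb{H}$ if $\partial_z\big((\operatorname{Im} z)^{-\alpha}\,\bar\partial_z u(z)\big)=0$ for all $z\in\mathbb{H}$. A function $u$ in $\mathbb{H}$ is of temperate growth at infinity if there are positive constants $C,R,N$ such that $|u(z)|\leq C\,(|z|^2/\operatorname{Im} z)^N$ for all $z\in\mathbb{H}$ with $|z|>R$. Pochhammer symbols: $(a)_0=1$ and $(a)_k=\prod_{j=0}^{k-1}(a+j)$ for $k\geq1$. For $k\in\mathbb{N}=\{0,1,2,\dots\}$ set $$p_{k,\alpha}(z)=\sum_{j=0}^k\frac{(\alpha+1)_j}{j!}\,z^{k-j}\bar z^{\,j}.$$ $\mathcal{V}_\alpha$ is the set of all functions on $\mathbb{H}$ of the form $u(z)=\sum_{k=0}^n c_k(\operatorname{Im} z)^{\alpha+1}p_{k,\alpha}(z)$,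 $z\in\mathbb{H}$, for some $n\in\mathbb{N}$ and $c_0,\dots,c_n\in\mathbb{C}$. *)

theory Defs
  imports "HOL-Analysis.Analysis"
begin

text \<open>
  A function on the upper half-plane is represented by a total function on the complex numbers;
  every notion below depends only on its values on the open set \<open>upper_half_plane\<close>.
\<close>

definition upper_half_plane :: "complex set" where
  "upper_half_plane = {z. Im z > 0}"

definition partial_x :: "(complex \<Rightarrow> complex) \<Rightarrow> complex \<Rightarrow> complex" where
  "partial_x f z = vector_derivative (\<lambda>t::real. f (z + of_real t)) (at 0)"

definition partial_y :: "(complex \<Rightarrow> complex) \<Rightarrow> complex \<Rightarrow> complex" where
  "partial_y f z = vector_derivative (\<lambda>t::real. f (z + \<i> * of_real t)) (at 0)"

definition wirtinger :: "(complex \<Rightarrow> complex) \<Rightarrow> complex \<Rightarrow> complex" where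
  "wirtinger f z = (partial_x f z - \<i> * partial_y f z) / 2"

definition wirtinger_bar :: "(complex \<Rightarrow> complex) \<Rightarrow> complex \<Rightarrow> complex" where
  "wirtinger_bar f z = (partial_x f z + \<i> * partial_y f z) / 2"

text \<open>
  The class \<open>C\<^sup>k\<close> in the real sense on an open set \<open>S\<close>. Here \<open>differentiable_on\<close> is real
  (Frechet) differentiability; the continuity of the derivative is that of the two partial
  derivatives.
\<close>

primrec Ck_on :: "nat \<Rightarrow> complex set \<Rightarrow> (complex \<Rightarrow> complex) \<Rightarrow> bool" where
  "Ck_on 0 S f \<longleftrightarrow> continuous_on S f"
| "Ck_on (Suc k) S f \<longleftrightarrow>
     f differentiable_on S \<and> Ck_on k S (partial_x f) \<and> Ck_on k S (partial_y f)"

definition alpha_harmonic :: "real \<Rightarrow> (complex \<Rightarrow> complex) \<Rightarrow> bool" where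
  "alpha_harmonic \<alpha> u \<longleftrightarrow>
     Ck_on 2 upper_half_plane u \<and>
     (\<forall>z\<in>upper_half_plane.
        wirtinger (\<lambda>w. of_real (Im w powr (- \<alpha>)) * wirtinger_bar u w) z = 0)"

definition temperate_growth_at_infinity :: "(complex \<Rightarrow> complex) \<Rightarrow> bool" where
  "temperate_growth_at_infinity u \<longleftrightarrow>
     (\<exists>C R N :: real. C > 0 \<and> R > 0 \<and> N > 0 \<and>
        (\<forall>z\<in>upper_half_plane. cmod z > R \<longrightarrow>
           cmod (u z) \<le> C * ((cmod z)\<^sup>2 / Im z) powr N))"

definition p_poly :: "nat \<Rightarrow> real \<Rightarrow> complex \<Rightarrow> complex" where
  "p_poly k \<alpha> z =
     (\<Sum>j\<le>k. of_real (pochhammer (\<alpha> + 1) j / fact j) * z ^ (k - j) * cnj z ^ j)"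

definition V_class :: "real \<Rightarrow> (complex \<Rightarrow> complex) set" where
  "V_class \<alpha> = {u. \<exists>(n::nat) (c :: nat \<Rightarrow> complex). \<forall>z\<in>upper_half_plane.
     u z = (\<Sum>k\<le>n. c k * of_real (Im z powr (\<alpha> + 1)) * p_poly k \<alpha> z)}"

end

theory Submission
  imports Defs "HOL-Complex_Analysis.Complex_Analysis"
begin

text \<open>
  Write \<open>H\<close> for the upper half-plane. For an \<open>\<alpha>\<close>-harmonic \<open>u\<close> the antiholomorphic derivative of \<open>u\<close> is
  \<open>y\<^sup>\<alpha> f(cnj z)\<close> with \<open>f\<close> holomorphic on the lower half-plane, and the antiholomorphic derivative of
  \<open>y\<^sup>\<alpha>\<^sup>+\<^sup>1 p\<^sub>k\<close> is a nonzero multiple of \<open>y\<^sup>\<alpha> cnj z\<^sup>k\<close>. So it suffices to show that \<open>f\<close> is a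
  polynomial: subtracting an element of \<open>V_class\<close> from \<open>u\<close> then leaves a holomorphic function on \<open>H\<close> that
  vanishes on the real line, which is zero by reflection.

  By the Cayley transform, \<open>u\<close> becomes (up to a factor) a function \<open>U\<close> on the unit disc with antiholomorphic
  derivative \<open>(1 - |w|\<^sup>2)\<^sup>\<alpha> F(cnj w)\<close>, and \<open>U(w) = h(w) + cnj w \<integral>\<^sub>0\<^sup>1 (1 - t|w|\<^sup>2)\<^sup>\<alpha> F(t cnj w) dt\<close> with \<open>h\<close>
  holomorphic. Taking the mean of \<open>w U(w)\<close> over a circle bounds \<open>F(0)\<close>, hence \<open>y\<^sup>\<alpha>\<^sup>+\<^sup>1 f(cnj z)\<close>, by nearby
  values of \<open>u\<close>; so this quantity grows temperately and vanishes on the real line. Consequently, with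
  \<open>l(\<omega>) = \<omega> \<integral>\<^sub>0\<^sup>1 (1 - t)\<^sup>\<alpha> F(t\<omega>) dt\<close>, the sum \<open>h(w) + l(cnj w)\<close> tends to \<open>0\<close> at every boundary point other than
  \<open>1\<close> (the image of \<open>\<infinity>\<close>): a Moebius substitution in \<open>t\<close> makes dominated convergence applicable to the
  difference of the two integrals. Back in the half-planes, \<open>h\<close> and \<open>-l\<close> are holomorphic functions above and below
  the real line without a jump across it and with temperate growth, so \<open>l\<close> is a polynomial there; and
  \<open>F\<close> is recovered from \<open>l\<close> by comparing power series.
\<close>

section \<open>Wirtinger calculus\<close>

text \<open>The obstacle is that nothing is known about derivatives of u near the real line, and
  that the limit 0 is given only at each single real point. Neither the holomorphic part nor the
  antiholomorphic part of u need have boundary values of its own; only their combination does. They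
  are therefore handled as a pair and glued across the line, with temperate growth controlling
  infinity. The disc enters because its centre gives a mean value property and a primitive along
  radii. The factor carried by U is (1 - w)^\<alpha>: the Moebius change of variable produces |1 -
  w|^(-2\<alpha>), and this factor removes exactly the half of it that is not a function of cnj w,
  so that F stays holomorphic. The potential carries the weight (1 - t |w|^2)^\<alpha> and l the
  weight (1 - t)^\<alpha>. These agree at |w| = 1, but F may blow up there almost like (1 -
  |w|)^(-\<alpha>-1), so continuity of the weights alone does not make the difference small; the
  decay of (1 - |w|^2)^(\<alpha>+1) F is what closes the gap. Polynomials in z come back as
  polynomials in \<omega> / (1 - \<omega>), because that quotient is affine in the half-plane
  coordinate.\<close>

lemma has_derivative_imp_partials:
  assumes "(f has_derivative D) (at z)"
  shows "partial_x f z = D 1" "partial_y f z = D \<i>"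
proof -
  have "((\<lambda>t::real. f (z + of_real t)) has_derivative (\<lambda>t. D (of_real t))) (at 0)"
    by (rule has_derivative_compose[of "\<lambda>t::real. z + of_real t" "of_real" 0 UNIV f D, simplified])
       (use assms in \<open>auto intro!: derivative_eq_intros simp: fun_eq_iff\<close>)
  moreover have "linear D"
    using assms has_derivative_linear by blast
  hence "(\<lambda>t. D (of_real t)) = (\<lambda>t. t *\<^sub>R D 1)"
    by (metis linear_cmul mult.right_neutral scaleR_conv_of_real)
  ultimately have "((\<lambda>t::real. f (z + of_real t)) has_vector_derivative D 1) (at 0)"
    by (simp add: has_vector_derivative_def)
  thus "partial_x f z = D 1"
    by (simp add: partial_x_def vector_derivative_at)
  have "((\<lambda>t::real. f (z + \<i> * of_real t)) has_derivative (\<lambda>t. D (\<i> * of_real t))) (at 0)"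
    by (rule has_derivative_compose[of "\<lambda>t::real. z + \<i> * of_real t" "\<lambda>t. \<i> * of_real t" 0 UNIV f D, simplified])
       (use assms in \<open>auto intro!: derivative_eq_intros simp: fun_eq_iff\<close>)
  moreover have "(\<lambda>t. D (\<i> * of_real t)) = (\<lambda>t. t *\<^sub>R D \<i>)"
    using \<open>linear D\<close> by (metis linear_cmul mult.commute scaleR_conv_of_real)
  ultimately have "((\<lambda>t::real. f (z + \<i> * of_real t)) has_vector_derivative D \<i>) (at 0)"
    by (simp add: has_vector_derivative_def)
  thus "partial_y f z = D \<i>"
    by (simp add: partial_y_def vector_derivative_at)
qed

text \<open>Replaces limits along the axes: once a Frechet derivative has the shape p h + q cnj h,
  both Wirtinger derivatives can be read off. Derivatives below are stated in this shape for that
  reason.\<close>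

lemma wirtinger_eqI:
  assumes "(f has_derivative (\<lambda>h. p * h + q * cnj h)) (at z)"
  shows "wirtinger f z = p" "wirtinger_bar f z = q"
  unfolding wirtinger_def wirtinger_bar_def has_derivative_imp_partials[OF assms]
  by (simp_all add: algebra_simps)

lemma has_derivative_wirtinger:
  assumes "f differentiable (at z)"
  shows "(f has_derivative (\<lambda>h. wirtinger f z * h + wirtinger_bar f z * cnj h)) (at z)"
proof -
  obtain D where D: "(f has_derivative D) (at z)"
    using assms by (auto simp: differentiable_def)
  have lin: "linear D"
    using D has_derivative_linear by blast
  have "D h = wirtinger f z * h + wirtinger_bar f z * cnj h" for h
  proof -
    have "D h = D (Re h *\<^sub>R 1 + Im h *\<^sub>R \<i>)"
      by (rule arg_cong[of _ _ D]) (simp add: complex_eq_iff)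
    also have "\<dots> = of_real (Re h) * D 1 + of_real (Im h) * D \<i>"
      by (simp only: linear_add[OF lin] linear_cmul[OF lin]) (simp add: scaleR_conv_of_real)
    also have "\<dots> = wirtinger f z * h + wirtinger_bar f z * cnj h"
      using has_derivative_imp_partials[OF D]
      by (subst (2 3) complex_eq)
         (simp add: wirtinger_def wirtinger_bar_def field_simps)
    finally show ?thesis .
  qed
  hence "D = (\<lambda>h. wirtinger f z * h + wirtinger_bar f z * cnj h)" ..
  thus ?thesis
    using D by simp
qed

text \<open>Slices through z stay in S for small parameters, so the partials see only the germ of
  the function. This is what makes total functions harmless although they carry meaning only on the
  half-plane.\<close>

lemma partials_cong_open:
  assumes "open S" "z \<in> S" "\<And>w. w \<in> S \<Longrightarrow> f w = g w"
  shows "partial_x f z = partial_x g z" "partial_y f z = partial_y g z"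
proof -
  have ev: "eventually (\<lambda>w. f w = g w) (nhds z)"
    using assms eventually_nhds by blast
  have "filterlim (\<lambda>t::real. z + of_real t) (nhds z) (nhds 0)"
    "filterlim (\<lambda>t::real. z + \<i> * of_real t) (nhds z) (nhds 0)"
    by (auto intro!: tendsto_eq_intros filterlim_ident)
  from this[THEN filterlim_iff[THEN iffD1, rule_format, OF _ ev]]
  have 1: "\<forall>\<^sub>F t in nhds 0. f (z + of_real (t::real)) = g (z + of_real t)"
    and 2: "\<forall>\<^sub>F t in nhds 0. f (z + \<i> * of_real (t::real)) = g (z + \<i> * of_real t)"
    by auto
  show "partial_x f z = partial_x g z"
    unfolding partial_x_def
    by (rule vector_derivative_cong_eq) (use 1 in auto)
  show "partial_y f z = partial_y g z"
    unfolding partial_y_def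
    by (rule vector_derivative_cong_eq) (use 2 in auto)
qed

section \<open>Closure properties of the real C^k classes on open sets\<close>

lemma Ck_on_cong:
  assumes "open S" "\<And>z. z \<in> S \<Longrightarrow> f z = g z"
  shows "Ck_on k S f \<longleftrightarrow> Ck_on k S g"
  using assms(2)
proof (induction k arbitrary: f g)
  case 0
  thus ?case by (simp cong: continuous_on_cong)
next
  case (Suc k)
  have "f differentiable_on S \<longleftrightarrow> g differentiable_on S"
    unfolding differentiable_on_def
  proof (intro ball_cong refl iffI)
    fix x assume x: "x \<in> S"
    show "g differentiable at x within S" if "f differentiable at x within S"
      by (rule differentiable_transform_within[OF that zero_less_one x]) (simp add: Suc.prems)
    show "f differentiable at x within S" if "g differentiable at x within S"
      by (rule differentiable_transform_within[OF that zero_less_one x]) (simp add: Suc.prems)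
  qed
  moreover have "Ck_on k S (partial_x f) = Ck_on k S (partial_x g)"
    by (rule Suc.IH) (use partials_cong_open[OF assms(1)] Suc.prems in blast)
  moreover have "Ck_on k S (partial_y f) = Ck_on k S (partial_y g)"
    by (rule Suc.IH) (use partials_cong_open[OF assms(1)] Suc.prems in blast)
  ultimately show ?case by simp
qed

lemma Ck_on_Suc_imp: "Ck_on (Suc k) S f \<Longrightarrow> Ck_on k S f"
proof (induction k arbitrary: f)
  case 0
  thus ?case by (simp add: differentiable_imp_continuous_on)
next
  case (Suc k)
  note C = Suc.prems[THEN Ck_on.simps(2)[THEN iffD1]]
  show ?case
    by (rule Ck_on.simps(2)[THEN iffD2], intro conjI Suc.IH)
       (rule C[THEN conjunct1] C[THEN conjunct2, THEN conjunct1] C[THEN conjunct2, THEN conjunct2])+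
qed

text \<open>\<open>Ck_on\<close> recurses through the partials as chosen by
  \<open>vector_derivative\<close>. This rule and its converse below trade them for the values at 1
  and \<i> of an explicit derivative, so that sums and products reduce to the standard derivative
  rules.\<close>

lemma Ck_on_SucI:
  assumes "open S" "\<And>z. z \<in> S \<Longrightarrow> (f has_derivative D z) (at z)"
    "Ck_on k S (\<lambda>z. D z 1)" "Ck_on k S (\<lambda>z. D z \<i>)"
  shows "Ck_on (Suc k) S f"
proof -
  have "f differentiable_on S"
    using assms(2) by (auto simp: differentiable_on_def differentiable_def intro: has_derivative_at_withinI)
  moreover have "Ck_on k S (partial_x f) = Ck_on k S (\<lambda>z. D z 1)" "Ck_on k S (partial_y f) = Ck_on k S (\<lambda>z. D z \<i>)"
    using has_derivative_imp_partials[OF assms(2)] by (auto intro!: Ck_on_cong assms(1))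
  ultimately show ?thesis using assms by simp
qed

lemma Ck_on_SucD:
  assumes "open S" "Ck_on (Suc k) S f"
  obtains D where "\<And>z. z \<in> S \<Longrightarrow> (f has_derivative D z) (at z)"
    "Ck_on k S (\<lambda>z. D z 1)" "Ck_on k S (\<lambda>z. D z \<i>)"
proof -
  have "\<forall>z\<in>S. \<exists>D. (f has_derivative D) (at z)"
    using assms by (auto simp: differentiable_on_def differentiable_def at_within_open[OF _ assms(1)])
  then obtain D where D: "\<And>z. z \<in> S \<Longrightarrow> (f has_derivative D z) (at z)"
    by metis
  show thesis
  proof
    show "\<And>z. z \<in> S \<Longrightarrow> (f has_derivative D z) (at z)" by (fact D)
    have "Ck_on k S (partial_x f) = Ck_on k S (\<lambda>z. D z 1)" "Ck_on k S (partial_y f) = Ck_on k S (\<lambda>z. D z \<i>)"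
      using has_derivative_imp_partials[OF D] by (auto intro!: Ck_on_cong assms(1))
    thus "Ck_on k S (\<lambda>z. D z 1)" "Ck_on k S (\<lambda>z. D z \<i>)"
      using assms(2) by auto
  qed
qed

lemma Ck_on_add:
  assumes "open S" "Ck_on k S f" "Ck_on k S g"
  shows "Ck_on k S (\<lambda>z. f z + g z)"
  using assms(2,3)
proof (induction k arbitrary: f g)
  case 0
  thus ?case by (simp add: continuous_on_add)
next
  case (Suc k)
  obtain D where D: "\<And>z. z \<in> S \<Longrightarrow> (f has_derivative D z) (at z)"
    "Ck_on k S (\<lambda>z. D z 1)" "Ck_on k S (\<lambda>z. D z \<i>)"
    using Ck_on_SucD[OF assms(1) Suc.prems(1)] by blast
  obtain E where E: "\<And>z. z \<in> S \<Longrightarrow> (g has_derivative E z) (at z)"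
    "Ck_on k S (\<lambda>z. E z 1)" "Ck_on k S (\<lambda>z. E z \<i>)"
    using Ck_on_SucD[OF assms(1) Suc.prems(2)] by blast
  show ?case
    by (rule Ck_on_SucI[OF assms(1) has_derivative_add[OF D(1) E(1)]]) (use D E in \<open>auto intro: Suc.IH\<close>)
qed

lemma Ck_on_mult:
  assumes "open S" "Ck_on k S f" "Ck_on k S g"
  shows "Ck_on k S (\<lambda>z. f z * g z)"
  using assms(2,3)
proof (induction k arbitrary: f g)
  case 0
  thus ?case by (simp add: continuous_on_mult)
next
  case (Suc k)
  obtain D where D: "\<And>z. z \<in> S \<Longrightarrow> (f has_derivative D z) (at z)"
    "Ck_on k S (\<lambda>z. D z 1)" "Ck_on k S (\<lambda>z. D z \<i>)"
    using Ck_on_SucD[OF assms(1) Suc.prems(1)] by blast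
  obtain E where E: "\<And>z. z \<in> S \<Longrightarrow> (g has_derivative E z) (at z)"
    "Ck_on k S (\<lambda>z. E z 1)" "Ck_on k S (\<lambda>z. E z \<i>)"
    using Ck_on_SucD[OF assms(1) Suc.prems(2)] by blast
  note C = Suc.prems[THEN Ck_on_Suc_imp]
  show ?case
    by (rule Ck_on_SucI[OF assms(1) has_derivative_mult[OF D(1) E(1)]])
       (use D E C in \<open>auto intro!: Suc.IH Ck_on_add assms(1)\<close>)
qed

lemma Ck_on_const: "open S \<Longrightarrow> Ck_on k S (\<lambda>z. c)"
  by (induction k arbitrary: c) (auto intro!: Ck_on_SucI[where D="\<lambda>z h. 0"] simp del: Ck_on.simps(2))

lemma Ck_on_ident: "open S \<Longrightarrow> Ck_on k S (\<lambda>z. z)"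
  by (cases k)
     (auto intro!: Ck_on_SucI[where D="\<lambda>z h. h"] Ck_on_const derivative_eq_intros simp del: Ck_on.simps(2))

lemma Ck_on_cnj: "open S \<Longrightarrow> Ck_on k S cnj"
  by (cases k)
     (auto intro!: Ck_on_SucI[where D="\<lambda>z h. cnj h"] Ck_on_const continuous_intros 
        bounded_linear_imp_has_derivative bounded_linear_cnj simp del: Ck_on.simps(2))

lemma Ck_on_power: "open S \<Longrightarrow> Ck_on k S f \<Longrightarrow> Ck_on k S (\<lambda>z. f z ^ n)"
  by (induction n) (auto intro!: Ck_on_mult Ck_on_const)

lemma Ck_on_sum:
  "open S \<Longrightarrow> (\<And>i. i \<in> I \<Longrightarrow> Ck_on k S (f i)) \<Longrightarrow> Ck_on k S (\<lambda>z. \<Sum>i\<in>I. f i z)"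
  by (induction I rule: infinite_finite_induct) (auto intro!: Ck_on_add Ck_on_const)

lemma open_upper_half_plane: "open upper_half_plane"
  unfolding upper_half_plane_def by (rule open_halfspace_Im_gt)

lemma has_derivative_Im_powr:
  assumes "Im z > 0"
  shows "((\<lambda>w. complex_of_real (Im w powr \<beta>)) has_derivative
           (\<lambda>h. of_real (\<beta> * Im z powr (\<beta> - 1)) * of_real (Im h))) (at z)"
proof -
  have "((\<lambda>y. y powr \<beta>) has_real_derivative \<beta> * Im z powr (\<beta> - 1)) (at (Im z))"
    using assms by (auto intro!: derivative_eq_intros simp: powr_diff)
  hence "((\<lambda>y. y powr \<beta>) has_derivative (\<lambda>h. \<beta> * Im z powr (\<beta> - 1) * h)) (at (Im z))"
    by (simp add: has_field_derivative_def)
  from has_derivative_compose[OF bounded_linear_imp_has_derivative[OF bounded_linear_Im] this]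
  have "((\<lambda>w. Im w powr \<beta>) has_derivative (\<lambda>h. \<beta> * Im z powr (\<beta> - 1) * Im h)) (at z)" .
  from has_derivative_compose[OF this bounded_linear_imp_has_derivative[OF bounded_linear_of_real]]
  show ?thesis by simp
qed

text \<open>Differentiation passes from the exponent \<beta> to \<beta> - 1, hence the
  generalisation of \<beta> in the induction.\<close>

lemma Ck_on_Im_powr:
  "Ck_on k upper_half_plane (\<lambda>z. of_real (Im z powr \<beta>))"
proof (induction k arbitrary: \<beta>)
  case 0
  have "continuous_on upper_half_plane (\<lambda>z. complex_of_real (Im z powr \<beta>))"
    by (intro continuous_intros) (auto simp: upper_half_plane_def)
  thus ?case by simp
next
  case (Suc k)
  show ?case
    by (rule Ck_on_SucI[OF open_upper_half_plane has_derivative_Im_powr])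
       (use Suc in \<open>auto simp: upper_half_plane_def[symmetric] intro!: Ck_on_mult Ck_on_const open_upper_half_plane\<close>,
        auto simp: upper_half_plane_def)
qed

section \<open>The functions of the class V\<close>

text \<open>The constant of proportionality between the antiholomorphic derivative of y^(\<alpha>+1)
  p_k and y^\<alpha> cnj z^k, where y = Im z.\<close>

definition V_coeff :: "real \<Rightarrow> nat \<Rightarrow> complex" where
  "V_coeff \<alpha> k = \<i> / 2 * of_real (real (Suc k) * (pochhammer (\<alpha> + 1) (Suc k) / fact (Suc k)))"

lemma V_coeff_nonzero: "\<alpha> > -1 \<Longrightarrow> V_coeff \<alpha> k \<noteq> 0"
  using pochhammer_pos[of "\<alpha> + 1" "Suc k"] by (simp add: V_coeff_def)

lemma p_poly_Suc:
  "p_poly (Suc k) \<alpha> z = z * p_poly k \<alpha> z + of_real (pochhammer (\<alpha> + 1) (Suc k) / fact (Suc k)) * cnj z ^ Suc k"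
proof -
  have "(\<Sum>j\<le>k. of_real (pochhammer (\<alpha> + 1) j / fact j) * z ^ (Suc k - j) * cnj z ^ j) = z * p_poly k \<alpha> z"
    unfolding p_poly_def sum_distrib_left
    by (intro sum.cong) (auto simp: Suc_diff_le)
  thus ?thesis by (simp add: p_poly_def)
qed

text \<open>With y = (z - cnj z) / (2\<i>), the left side of the identity times (\<i>/2) y^\<alpha>
  is the antiholomorphic derivative of y^(\<alpha>+1) p_k. In the induction step the recurrence for
  p_(k+1) makes the mixed terms z cnj z^k cancel, so only a pure power of cnj z survives.\<close>

lemma p_poly_has_derivative:
  "\<exists>P Q. (p_poly k \<alpha> has_derivative (\<lambda>h. P * h + Q * cnj h)) (at z) \<and>
     of_real (\<alpha> + 1) * p_poly k \<alpha> z - (z - cnj z) * Q =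
     of_real (real (Suc k) * (pochhammer (\<alpha> + 1) (Suc k) / fact (Suc k))) * cnj z ^ k"
proof (induction k)
  case 0
  have "p_poly 0 \<alpha> = (\<lambda>z. 1)" by (auto simp: p_poly_def)
  thus ?case by (intro exI[of _ 0]) simp
next
  case (Suc k)
  define a where "a = complex_of_real (pochhammer (\<alpha> + 1) (Suc k) / fact (Suc k))"
  obtain P Q where PQ: "(p_poly k \<alpha> has_derivative (\<lambda>h. P * h + Q * cnj h)) (at z)"
    and eq: "of_real (\<alpha> + 1) * p_poly k \<alpha> z - (z - cnj z) * Q = of_nat (Suc k) * a * cnj z ^ k"
    using Suc by (auto simp: a_def simp del: pochhammer_Suc fact_Suc)
  have cnj: "(cnj has_derivative cnj) (at z)"
    by (simp add: bounded_linear_imp_has_derivative bounded_linear_cnj)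
  have 1: "p_poly (Suc k) \<alpha> = (\<lambda>z. z * p_poly k \<alpha> z + a * cnj z ^ Suc k)"
    by (rule ext, subst p_poly_Suc, simp only: a_def)
  have 2: "(p_poly (Suc k) \<alpha> has_derivative
      (\<lambda>h. (p_poly k \<alpha> z + z * P) * h + (z * Q + a * of_nat (Suc k) * cnj z ^ k) * cnj h)) (at z)"
    unfolding 1
    by (rule derivative_eq_intros PQ cnj refl)+ (auto simp: algebra_simps)
  \<comment> \<open>For a_k = (\<alpha>+1)_k / k! this is (k+2) a_(k+2) = (\<alpha>+1+k+1) a_(k+1);
    the right side is the coefficient left over after the cancellation.\<close>
  have 3: "of_nat (Suc (Suc k)) * complex_of_real (pochhammer (\<alpha> + 1) (Suc (Suc k)) / fact (Suc (Suc k)))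
      = of_real (\<alpha> + 1 + real (Suc k)) * a"
  proof -
    have "pochhammer (\<alpha> + 1) (Suc (Suc k)) = (\<alpha> + 1 + real (Suc k)) * pochhammer (\<alpha> + 1) (Suc k)"
      by (rule pochhammer_rec')
    moreover have "fact (Suc (Suc k)) = real (Suc (Suc k)) * fact (Suc k)"
      by (rule fact_Suc)
    ultimately have "real (Suc (Suc k)) * (pochhammer (\<alpha> + 1) (Suc (Suc k)) / fact (Suc (Suc k)))
       = (\<alpha> + 1 + real (Suc k)) * (pochhammer (\<alpha> + 1) (Suc k) / fact (Suc k))"
      by (simp only:) (simp del: of_nat_Suc pochhammer_Suc fact_Suc)
    from arg_cong[OF this, of complex_of_real] show ?thesis
      by (simp only: a_def of_real_mult of_real_of_nat_eq)
  qed
  have "of_real (\<alpha> + 1) * p_poly (Suc k) \<alpha> z - (z - cnj z) * (z * Q + a * of_nat (Suc k) * cnj z ^ k)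
     = z * (of_real (\<alpha> + 1) * p_poly k \<alpha> z - (z - cnj z) * Q) + of_real (\<alpha> + 1) * a * cnj z ^ Suc k
       - (z - cnj z) * (a * of_nat (Suc k) * cnj z ^ k)"
    by (simp add: 1 algebra_simps)
  also have "\<dots> = of_real (\<alpha> + 1 + real (Suc k)) * a * cnj z ^ Suc k"
    unfolding eq by (simp add: algebra_simps)
  finally have 4: "of_real (\<alpha> + 1) * p_poly (Suc k) \<alpha> z - (z - cnj z) * (z * Q + a * of_nat (Suc k) * cnj z ^ k)
     = of_nat (Suc (Suc k)) * complex_of_real (pochhammer (\<alpha> + 1) (Suc (Suc k)) / fact (Suc (Suc k))) * cnj z ^ Suc k"
    by (simp only: 3)
  show ?case
    by (intro exI conjI, rule 2) (simp only: 4 of_real_mult of_real_of_nat_eq)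
qed

lemma V_basis_has_derivative:
  assumes "Im z > 0"
  shows "\<exists>P. ((\<lambda>z. of_real (Im z powr (\<alpha> + 1)) * p_poly k \<alpha> z) has_derivative
    (\<lambda>h. P * h + V_coeff \<alpha> k * of_real (Im z powr \<alpha>) * cnj z ^ k * cnj h)) (at z)"
proof -
  obtain P Q where PQ: "(p_poly k \<alpha> has_derivative (\<lambda>h. P * h + Q * cnj h)) (at z)"
    and eq: "of_real (\<alpha> + 1) * p_poly k \<alpha> z - (z - cnj z) * Q =
     of_real (real (Suc k) * (pochhammer (\<alpha> + 1) (Suc k) / fact (Suc k))) * cnj z ^ k"
    using p_poly_has_derivative by blast
  define y where "y = complex_of_real (Im z powr \<alpha>)"
  have im: "complex_of_real (Im h) = (h - cnj h) / (2 * \<i>)" for h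
    by (simp add: complex_eq_iff)
  have y1: "complex_of_real (Im z powr (\<alpha> + 1)) = y * ((z - cnj z) / (2 * \<i>))"
    unfolding im[symmetric] using assms by (simp add: y_def powr_add)
  have "((\<lambda>z. of_real (Im z powr (\<alpha> + 1)) * p_poly k \<alpha> z) has_derivative
     (\<lambda>h. of_real (Im z powr (\<alpha> + 1)) * (P * h + Q * cnj h) +
          of_real ((\<alpha> + 1) * Im z powr (\<alpha> + 1 - 1)) * of_real (Im h) * p_poly k \<alpha> z)) (at z)"
    by (rule has_derivative_mult[OF has_derivative_Im_powr PQ, OF assms])
  also have "(\<lambda>h. of_real (Im z powr (\<alpha> + 1)) * (P * h + Q * cnj h) +
          of_real ((\<alpha> + 1) * Im z powr (\<alpha> + 1 - 1)) * of_real (Im h) * p_poly k \<alpha> z) =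
     (\<lambda>h. (of_real (Im z powr (\<alpha> + 1)) * P + of_real (\<alpha> + 1) * y * p_poly k \<alpha> z / (2 * \<i>)) * h +
       \<i> / 2 * y * (of_real (\<alpha> + 1) * p_poly k \<alpha> z - (z - cnj z) * Q) * cnj h)"
    unfolding y1 im by (rule ext) (simp add: y_def field_simps)
  finally show ?thesis
    unfolding eq by (intro exI) (simp add: y_def V_coeff_def mult_ac del: pochhammer_Suc fact_Suc)
qed

lemma V_sum_has_derivative:
  assumes "Im z > 0"
  shows "\<exists>P. ((\<lambda>z. \<Sum>k\<le>n. c k * of_real (Im z powr (\<alpha> + 1)) * p_poly k \<alpha> z) has_derivative
    (\<lambda>h. P * h + of_real (Im z powr \<alpha>) * (\<Sum>k\<le>n. c k * V_coeff \<alpha> k * cnj z ^ k) * cnj h)) (at z)"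
proof -
  obtain P where P: "\<And>k. ((\<lambda>z. of_real (Im z powr (\<alpha> + 1)) * p_poly k \<alpha> z) has_derivative
    (\<lambda>h. P k * h + V_coeff \<alpha> k * of_real (Im z powr \<alpha>) * cnj z ^ k * cnj h)) (at z)"
    using V_basis_has_derivative[OF assms] by metis
  have "((\<lambda>z. \<Sum>k\<le>n. c k * (of_real (Im z powr (\<alpha> + 1)) * p_poly k \<alpha> z)) has_derivative
    (\<lambda>h. \<Sum>k\<le>n. c k * (P k * h + V_coeff \<alpha> k * of_real (Im z powr \<alpha>) * cnj z ^ k * cnj h))) (at z)"
    by (intro has_derivative_sum has_derivative_mult_right P)
  also have "(\<lambda>h. \<Sum>k\<le>n. c k * (P k * h + V_coeff \<alpha> k * of_real (Im z powr \<alpha>) * cnj z ^ k * cnj h)) =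
    (\<lambda>h. (\<Sum>k\<le>n. c k * P k) * h + of_real (Im z powr \<alpha>) * (\<Sum>k\<le>n. c k * V_coeff \<alpha> k * cnj z ^ k) * cnj h)"
    by (simp add: sum.distrib sum_distrib_left sum_distrib_right algebra_simps fun_eq_iff)
  finally show ?thesis by (auto simp: mult_ac)
qed

text \<open>Dividing the antiholomorphic derivative by y^\<alpha> leaves a polynomial in cnj z,
  which the holomorphic derivative annihilates.\<close>

lemma V_class_alpha_harmonic:
  assumes u: "\<And>z. z \<in> upper_half_plane \<Longrightarrow> u z = (\<Sum>k\<le>n. c k * of_real (Im z powr (\<alpha> + 1)) * p_poly k \<alpha> z)"
  shows "alpha_harmonic \<alpha> u"
proof -
  let ?v = "\<lambda>z. \<Sum>k\<le>n. c k * of_real (Im z powr (\<alpha> + 1)) * p_poly k \<alpha> z"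
  note op = open_upper_half_plane
  have "Ck_on 2 upper_half_plane ?v"
    unfolding p_poly_def
    by (intro Ck_on_sum Ck_on_mult Ck_on_const Ck_on_Im_powr Ck_on_power Ck_on_ident Ck_on_cnj op)
  hence C2: "Ck_on 2 upper_half_plane u"
    using Ck_on_cong[OF op, of u ?v] u by blast
  have bar: "wirtinger_bar u z = of_real (Im z powr \<alpha>) * (\<Sum>k\<le>n. c k * V_coeff \<alpha> k * cnj z ^ k)"
    if z: "z \<in> upper_half_plane" for z
  proof -
    have "Im z > 0" using z by (simp add: upper_half_plane_def)
    from V_sum_has_derivative[OF this] obtain P where
      "(?v has_derivative (\<lambda>h. P * h + of_real (Im z powr \<alpha>) * (\<Sum>k\<le>n. c k * V_coeff \<alpha> k * cnj z ^ k) * cnj h)) (at z)"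
      by blast
    from wirtinger_eqI(2)[OF has_derivative_transform_within_open[OF this op z]] u show ?thesis
      by simp
  qed
  have "wirtinger (\<lambda>w. of_real (Im w powr (- \<alpha>)) * wirtinger_bar u w) z = 0"
    if z: "z \<in> upper_half_plane" for z
  proof -
    have *: "(\<Sum>k\<le>n. c k * V_coeff \<alpha> k * cnj w ^ k) = of_real (Im w powr (- \<alpha>)) * wirtinger_bar u w"
      if w: "w \<in> upper_half_plane" for w
    proof -
      have "Im w > 0" using w by (simp add: upper_half_plane_def)
      hence "complex_of_real (Im w powr (- \<alpha>)) * of_real (Im w powr \<alpha>) = 1"
        by (simp flip: of_real_mult powr_add)
      thus ?thesis using bar[OF w] by (simp flip: mult.assoc)
    qed
    have cnj: "(cnj has_derivative cnj) (at z)"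
      by (simp add: bounded_linear_imp_has_derivative bounded_linear_cnj)
    have "((\<lambda>w. \<Sum>k\<le>n. c k * V_coeff \<alpha> k * cnj w ^ k) has_derivative
        (\<lambda>h. \<Sum>k\<le>n. c k * V_coeff \<alpha> k * (of_nat k * cnj h * cnj z ^ (k - 1)))) (at z)"
      by (intro has_derivative_sum has_derivative_mult_right has_derivative_power cnj)
    also have "(\<lambda>h. \<Sum>k\<le>n. c k * V_coeff \<alpha> k * (of_nat k * cnj h * cnj z ^ (k - 1))) =
        (\<lambda>h. 0 * h + (\<Sum>k\<le>n. c k * V_coeff \<alpha> k * (of_nat k * cnj z ^ (k - 1))) * cnj h)"
      by (simp add: fun_eq_iff sum_distrib_left mult_ac)
    finally show ?thesis
      by (intro wirtinger_eqI(1)) (erule has_derivative_transform_within_open[OF _ op z *])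
  qed
  with C2 show ?thesis by (auto simp: alpha_harmonic_def)
qed

lemma norm_p_poly_le:
  assumes "\<alpha> > -1"
  shows "norm (p_poly k \<alpha> z) \<le> (\<Sum>j\<le>k. pochhammer (\<alpha> + 1) j / fact j) * norm z ^ k"
proof -
  have "norm (p_poly k \<alpha> z) \<le> (\<Sum>j\<le>k. norm (of_real (pochhammer (\<alpha> + 1) j / fact j) * z ^ (k - j) * cnj z ^ j))"
    unfolding p_poly_def by (rule norm_sum)
  also have "\<dots> = (\<Sum>j\<le>k. pochhammer (\<alpha> + 1) j / fact j * norm z ^ k)"
  proof (intro sum.cong refl)
    fix j assume "j \<in> {..k}"
    hence "norm z ^ k = norm z ^ (k - j) * norm z ^ j"
      by (simp flip: power_add)
    thus "norm (complex_of_real (pochhammer (\<alpha> + 1) j / fact j) * z ^ (k - j) * cnj z ^ j) =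
       pochhammer (\<alpha> + 1) j / fact j * norm z ^ k"
      using assms pochhammer_nonneg[of "\<alpha> + 1" j] by (simp add: norm_mult norm_power norm_divide)
  qed
  finally show ?thesis by (simp add: sum_distrib_right)
qed

lemma V_class_temperate_growth:
  assumes \<alpha>: "\<alpha> > -1"
    and u: "\<And>z. z \<in> upper_half_plane \<Longrightarrow> u z = (\<Sum>k\<le>n. c k * of_real (Im z powr (\<alpha> + 1)) * p_poly k \<alpha> z)"
  shows "temperate_growth_at_infinity u"
proof -
  define A where "A k = (\<Sum>j\<le>k. pochhammer (\<alpha> + 1) j / fact j)" for k
  have A: "A k \<ge> 0" for k
    unfolding A_def using \<alpha> by (intro sum_nonneg divide_nonneg_nonneg pochhammer_nonneg) auto
  define C where "C = (\<Sum>k\<le>n. norm (c k) * A k) + 1"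
  define N where "N = \<alpha> + 1 + real n"
  have C: "C > 0" unfolding C_def by (intro add_nonneg_pos sum_nonneg) (auto simp: A)
  have "norm (u z) \<le> C * ((norm z)\<^sup>2 / Im z) powr (N + 1)"
    if z: "z \<in> upper_half_plane" and R: "norm z > 1" for z
  proof -
    have y: "Im z > 0" "Im z \<le> norm z" using z abs_Im_le_cmod[of z] by (auto simp: upper_half_plane_def)
    have "norm (u z) \<le> (\<Sum>k\<le>n. norm (c k * of_real (Im z powr (\<alpha> + 1)) * p_poly k \<alpha> z))"
      unfolding u[OF z] by (rule norm_sum)
    also have "\<dots> \<le> (\<Sum>k\<le>n. norm (c k) * A k * norm z powr N)"
    proof (intro sum_mono)
      fix k assume k: "k \<in> {..n}"
      \<comment> \<open>Everything is pushed to one power of |z|: Im z \<le> |z| may be raised to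
        \<alpha> + 1 > 0, and the degree k may be raised to n because |z| > 1.\<close>
      have "Im z powr (\<alpha> + 1) * norm (p_poly k \<alpha> z) \<le> norm z powr (\<alpha> + 1) * (A k * norm z ^ n)"
        using norm_p_poly_le[OF \<alpha>, of k z] y \<alpha> R k
        by (intro mult_mono powr_mono2 order.trans[OF norm_p_poly_le[OF \<alpha>], folded A_def] mult_left_mono A power_increasing mult_nonneg_nonneg)
           (auto simp: A)
      also have "\<dots> = A k * norm z powr N"
      proof -
        have "norm z ^ n = norm z powr real n"
          by (rule powr_realpow[symmetric]) (use R in linarith)
        thus ?thesis by (simp add: N_def powr_add)
      qed
      finally have "Im z powr (\<alpha> + 1) * norm (p_poly k \<alpha> z) \<le> A k * norm z powr N" .
      from mult_left_mono[OF this, of "norm (c k)"]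
      show "norm (c k * of_real (Im z powr (\<alpha> + 1)) * p_poly k \<alpha> z) \<le> norm (c k) * A k * norm z powr N"
        by (simp add: norm_mult mult_ac)
    qed
    also have "\<dots> \<le> C * norm z powr N"
      unfolding sum_distrib_right[symmetric] by (intro mult_right_mono) (auto simp: C_def)
    also have "\<dots> \<le> C * ((norm z)\<^sup>2 / Im z) powr N"
    proof (intro mult_left_mono powr_mono2)
      have "Im z * norm z \<le> norm z * norm z" using y by (intro mult_right_mono) auto
      thus "norm z \<le> (norm z)\<^sup>2 / Im z" using y by (simp add: field_simps power2_eq_square)
    qed (use \<alpha> C in \<open>auto simp: N_def\<close>)
    also have "\<dots> \<le> C * ((norm z)\<^sup>2 / Im z) powr (N + 1)"
    proof (intro mult_left_mono powr_mono)
      have "Im z * 1 \<le> norm z * norm z" using y R by (intro mult_mono) auto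
      thus "1 \<le> (norm z)\<^sup>2 / Im z" using y by (simp add: field_simps power2_eq_square)
    qed (use C in auto)
    finally show ?thesis .
  qed
  thus ?thesis
    unfolding temperate_growth_at_infinity_def using C \<alpha>
    by (intro exI[of _ C] exI[of _ 1] exI[of _ "N + 1"]) (auto simp: N_def)
qed

lemma V_class_boundary:
  assumes \<alpha>: "\<alpha> > -1"
    and u: "\<And>z. z \<in> upper_half_plane \<Longrightarrow> u z = (\<Sum>k\<le>n. c k * of_real (Im z powr (\<alpha> + 1)) * p_poly k \<alpha> z)"
  shows "(u \<longlongrightarrow> 0) (at (complex_of_real x) within upper_half_plane)"
proof -
  let ?v = "\<lambda>z. \<Sum>k\<le>n. c k * of_real (Im z powr (\<alpha> + 1)) * p_poly k \<alpha> z"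
  have "((\<lambda>z. Im z powr (\<alpha> + 1)) \<longlongrightarrow> 0) (at (complex_of_real x) within upper_half_plane)"
  proof (rule tendsto_zero_powrI)
    show "(Im \<longlongrightarrow> 0) (at (complex_of_real x) within upper_half_plane)"
      by (auto intro!: tendsto_eq_intros)
    show "((\<lambda>z. \<alpha> + 1) \<longlongrightarrow> \<alpha> + 1) (at (complex_of_real x) within upper_half_plane)"
      by simp
    show "\<forall>\<^sub>F z in at (complex_of_real x) within upper_half_plane. 0 \<le> Im z"
      by (auto simp: eventually_at_filter upper_half_plane_def)
  qed (use \<alpha> in auto)
  from tendsto_of_real[OF this, where ?'a = complex]
  have "((\<lambda>z. complex_of_real (Im z powr (\<alpha> + 1))) \<longlongrightarrow> 0) (at (complex_of_real x) within upper_half_plane)"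
    by simp
  moreover have "((\<lambda>z. p_poly k \<alpha> z) \<longlongrightarrow> p_poly k \<alpha> (of_real x)) (at (complex_of_real x) within upper_half_plane)" for k
    unfolding p_poly_def by (intro tendsto_intros)
  ultimately have "(?v \<longlongrightarrow> (\<Sum>k\<le>n. c k * 0 * p_poly k \<alpha> (of_real x))) (at (complex_of_real x) within upper_half_plane)"
    by (intro tendsto_intros)
  hence "(?v \<longlongrightarrow> 0) (at (complex_of_real x) within upper_half_plane)" by simp
  thus ?thesis
    by (rule Lim_transform_eventually) (auto simp: eventually_at_filter u)
qed

section \<open>Decomposition on the unit disc\<close>

lemma disc_mean_value:
  assumes "f holomorphic_on ball 0 1" "0 < s" "s < 1"
  shows "((\<lambda>x::real. f (of_real s * exp (2 * of_real pi * \<i> * of_real x))) has_integral f 0) {0..1}"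
proof -
  have "((\<lambda>w. f w / (w - 0)) has_contour_integral (2 * of_real pi * \<i> * f 0)) (circlepath 0 s)"
    using assms
    by (intro Cauchy_integral_circlepath_simple) (auto intro: holomorphic_on_subset)
  hence "((\<lambda>x. f (circlepath 0 s x) / circlepath 0 s x * vector_derivative (circlepath 0 s) (at x within {0..1}))
      has_integral (2 * of_real pi * \<i> * f 0)) {0..1}"
    by (simp add: has_contour_integral_def)
  hence "((\<lambda>x. 2 * of_real pi * \<i> * f (of_real s * exp (2 * of_real pi * \<i> * of_real x)))
      has_integral (2 * of_real pi * \<i> * f 0)) {0..1}"
  proof (rule has_integral_eq[rotated])
    fix x :: real assume x: "x \<in> {0..1}"
    show "f (circlepath 0 s x) / circlepath 0 s x * vector_derivative (circlepath 0 s) (at x within {0..1})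
       = 2 * of_real pi * \<i> * f (of_real s * exp (2 * of_real pi * \<i> * of_real x))"
      using assms x by (subst vector_derivative_circlepath01) (simp_all add: circlepath)
  qed
  from has_integral_mult_right[OF this, of "1 / (2 * of_real pi * \<i>)"]
  show ?thesis by (simp add: field_simps)
qed

lemma cnj_image_ball: "cnj ` ball 0 r = ball 0 r"
proof
  show "ball 0 r \<subseteq> cnj ` ball 0 r"
  proof
    fix z :: complex assume "z \<in> ball 0 r"
    thus "z \<in> cnj ` ball 0 r" by (intro image_eqI[of _ _ "cnj z"]) auto
  qed
qed auto

lemma disc_mean_value_cnj:
  assumes "f holomorphic_on ball 0 1" "0 < s" "s < 1"
  shows "((\<lambda>x::real. f (cnj (of_real s * exp (2 * of_real pi * \<i> * of_real x)))) has_integral f 0) {0..1}"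
proof -
  have "(\<lambda>z. cnj (f (cnj z))) holomorphic_on ball 0 1"
    using holomorphic_on_compose_cnj_cnj[of f "ball 0 1"] assms(1) cnj_image_ball by (simp add: o_def)
  from disc_mean_value[OF this assms(2,3)]
  have "((\<lambda>x::real. cnj (f (cnj (of_real s * exp (2 * of_real pi * \<i> * of_real x))))) has_integral cnj (f 0)) {0..1}"
    by simp
  from has_integral_linear[OF this bounded_linear_cnj] show ?thesis
    by (simp add: o_def)
qed

lemma continuous_on_slice:
  assumes "continuous_on (A \<times> B) (\<lambda>z. G (fst z) (snd z))" "w \<in> A"
  shows "continuous_on B (G w)"
proof -
  have "continuous_on B (\<lambda>t. G (fst (w, t)) (snd (w, t)))"
    by (rule continuous_on_compose2[OF assms(1)])
       (use assms(2) in \<open>auto intro: continuous_on_Pair continuous_on_const continuous_on_id\<close>)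
  thus ?thesis by simp
qed

lemma integral_blinfun_apply:
  fixes F :: "real \<Rightarrow> 'a::real_normed_vector \<Rightarrow>\<^sub>L 'b::banach"
  assumes "F integrable_on S"
  shows "blinfun_apply (integral S F) h = integral S (\<lambda>t. blinfun_apply (F t) h)"
  using integral_linear[OF assms blinfun.bounded_linear_left[of h]] by (simp add: o_def)

lemma Re_one_minus_pos:
  fixes w :: complex
  assumes "norm w < 1" "0 \<le> t" "t \<le> 1"
  shows "Re (1 - of_real t * w * cnj w) > 0"
proof -
  have "t * (norm w)\<^sup>2 \<le> 1 * (norm w)\<^sup>2" using assms by (intro mult_right_mono) auto
  also have "\<dots> < 1" using assms by (simp add: power_less_one_iff)
  finally have "t * (norm w)\<^sup>2 < 1" .
  moreover have "of_real t * w * cnj w = complex_of_real (t * (norm w)\<^sup>2)"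
    by (simp add: complex_norm_square mult.assoc del: of_real_power)
  ultimately show ?thesis by (simp only: minus_complex.sel one_complex.sel Re_complex_of_real)
qed

lemma has_derivative_powr_one_minus:
  fixes w :: complex
  assumes "norm w < 1" "0 \<le> t" "t \<le> 1"
  shows "((\<lambda>w. (1 - of_real t * w * cnj w) powr \<beta>) has_derivative
     (\<lambda>h. (\<beta> * (1 - of_real t * w * cnj w) powr (\<beta> - 1)) * (- of_real t * (w * cnj h + h * cnj w)))) (at w)"
proof -
  have "Re (1 - of_real t * w * cnj w) > 0"
    using assms by (rule Re_one_minus_pos)
  hence "1 - of_real t * w * cnj w \<notin> \<real>\<^sub>\<le>\<^sub>0"
    by (auto simp: complex_nonpos_Reals_iff)
  from has_field_derivative_powr[OF this]
  have "((\<lambda>z. z powr \<beta>) has_derivative (\<lambda>h. (\<beta> * (1 - of_real t * w * cnj w) powr (\<beta> - 1)) * h))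
     (at (1 - of_real t * w * cnj w))"
    by (simp add: has_field_derivative_def)
  moreover have cnj: "(cnj has_derivative cnj) (at w)"
    by (simp add: bounded_linear_imp_has_derivative bounded_linear_cnj)
  have "((\<lambda>w. 1 - of_real t * w * cnj w) has_derivative (\<lambda>h. - of_real t * (w * cnj h + h * cnj w))) (at w)"
    by (rule derivative_eq_intros cnj refl)+ (auto simp: algebra_simps)
  ultimately show ?thesis
    by (rule has_derivative_compose[rotated])
qed

text \<open>An explicit primitive with respect to cnj w, integrated along the radius. The base 1 - t
  w cnj w is a positive real on the disc; the complex \<open>powr\<close> is used so that the chain
  rule for holomorphic powers applies.\<close>

definition disc_potential :: "real \<Rightarrow> (complex \<Rightarrow> complex) \<Rightarrow> complex \<Rightarrow> complex" where
  "disc_potential \<alpha> F w =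
     cnj w * integral {0..1} (\<lambda>t. (1 - of_real t * w * cnj w) powr of_real \<alpha> * F (of_real t * cnj w))"

text \<open>The antiholomorphic derivative of the integrand is the total derivative
  \<open>d/dt (t (1 - t |w|\<^sup>2)\<^sup>\<alpha> F (t cnj w))\<close>, so that part integrates exactly.\<close>

lemma disc_potential_has_derivative:
  assumes F: "F holomorphic_on ball 0 1" and w0: "norm w0 < 1"
  shows "\<exists>P. (disc_potential \<alpha> F has_derivative
     (\<lambda>h. P * h + (1 - w0 * cnj w0) powr of_real \<alpha> * F (cnj w0) * cnj h)) (at w0)"
proof -
  define X where "X w t = 1 - of_real t * w * cnj w" for w :: complex and t :: real
  define a where "a = complex_of_real \<alpha>"
  define g where "g w t = cnj w * (X w t powr a * F (of_real t * cnj w))" for w t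
  define p where "p w t = - of_real t * cnj w * cnj w * (a * X w t powr (a - 1)) * F (of_real t * cnj w)" for w t
  define q where "q w t = X w t powr a * F (of_real t * cnj w)
      + cnj w * (- of_real t * w * (a * X w t powr (a - 1)) * F (of_real t * cnj w)
                 + X w t powr a * (of_real t * deriv F (of_real t * cnj w)))" for w t
  have inball: "norm (of_real t * cnj w) < 1" if "norm w < 1" "t \<in> {0..1}" for w t
  proof -
    have "\<bar>t\<bar> * norm w \<le> 1 * norm w" using that by (intro mult_right_mono) auto
    thus ?thesis using that by (simp add: norm_mult)
  qed
  have Xpos: "X w t \<notin> \<real>\<^sub>\<le>\<^sub>0" if "norm w < 1" "t \<in> {0..1}" for w t
    using Re_one_minus_pos[of w t] that by (auto simp: X_def complex_nonpos_Reals_iff)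
  have contF: "continuous_on (ball 0 1) F"
    using F holomorphic_on_imp_continuous_on by blast
  have contF': "continuous_on (ball 0 1) (deriv F)"
    using holomorphic_deriv[OF F] holomorphic_on_imp_continuous_on by blast
  \<comment> \<open>Differentiation under the integral sign requires the derivative as a continuous
    family of bounded operators; \<open>J p q\<close> is h \<mapsto> p h + q cnj h in that
    form.\<close>
  define J where "J p q = blinfun_mult_right p + (blinfun_mult_right q o\<^sub>L Blinfun cnj)" for p q :: complex
  have J: "blinfun_apply (J p q) h = p * h + q * cnj h" for p q h
    by (simp add: J_def blinfun.add_left bounded_linear_Blinfun_apply bounded_linear_cnj)
  have der: "((\<lambda>w. g w t) has_derivative blinfun_apply (J (p w t) (q w t))) (at w within ball 0 1)"
    if w: "w \<in> ball 0 1" and t: "t \<in> cbox 0 1" for w t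
  proof -
    have cnj: "(cnj has_derivative cnj) (at w)"
      by (simp add: bounded_linear_imp_has_derivative bounded_linear_cnj)
    have c: "((\<lambda>w. of_real t * cnj w) has_derivative (\<lambda>h. of_real t * cnj h)) (at w)"
      by (intro has_derivative_mult_right cnj)
    have "(F has_field_derivative deriv F (of_real t * cnj w)) (at (of_real t * cnj w))"
      using inball[of w t] w t F by (intro holomorphic_derivI[OF F]) auto
    hence "(F has_derivative (\<lambda>h. deriv F (of_real t * cnj w) * h)) (at (of_real t * cnj w))"
      by (simp add: has_field_derivative_def)
    from has_derivative_compose[OF c this]
    have dF: "((\<lambda>w. F (of_real t * cnj w)) has_derivative
       (\<lambda>h. deriv F (of_real t * cnj w) * (of_real t * cnj h))) (at w)" .
    have dX: "((\<lambda>w. X w t powr a) has_derivative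
       (\<lambda>h. (a * X w t powr (a - 1)) * (- of_real t * (w * cnj h + h * cnj w)))) (at w)"
      unfolding X_def using w t by (intro has_derivative_powr_one_minus) auto
    have "((\<lambda>w. g w t) has_derivative (\<lambda>h. p w t * h + q w t * cnj h)) (at w)"
      unfolding g_def
      by (rule has_derivative_eq_rhs[OF has_derivative_mult[OF cnj has_derivative_mult[OF dX dF]]])
         (auto simp: p_def q_def algebra_simps)
    thus ?thesis
      unfolding J by (rule has_derivative_at_withinI)
  qed
  have contX: "continuous_on (ball 0 1 \<times> {0..1}) (\<lambda>z. X (fst z) (snd z) powr b)" for b
  proof (rule continuous_on_powr_complex)
    have "Re (X w t) > 0" if "norm w < 1" "t \<in> {0..1}" for w t
      using Re_one_minus_pos[of w t] that by (simp only: X_def atLeastAtMost_iff)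
    hence "Re (X (fst z) (snd z)) > 0" if "z \<in> ball 0 1 \<times> {0..1}" for z
      using that by auto
    thus "ball 0 1 \<times> {0..1} \<subseteq> {z. 0 \<le> Re (X (fst z) (snd z)) \<or> Im (X (fst z) (snd z)) \<noteq> 0}"
      "\<And>z. z \<in> ball 0 1 \<times> {0..1} \<Longrightarrow> X (fst z) (snd z) = 0 \<Longrightarrow> 0 < Re b"
      by force+
    show "continuous_on (ball 0 1 \<times> {0..1}) (\<lambda>z. X (fst z) (snd z))"
      unfolding X_def by (intro continuous_intros)
  qed (rule continuous_intros)
  have cc: "continuous_on (ball 0 1 \<times> {0..1}) (\<lambda>z. G (of_real (snd z) * cnj (fst z)))"
    if "continuous_on (ball 0 1) G" for G :: "complex \<Rightarrow> complex"
    by (rule continuous_on_compose2[OF that]) (use inball in \<open>auto intro!: continuous_intros\<close>)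
  note cF = cc[OF contF] and cF' = cc[OF contF']
  have contpq: "continuous_on (ball 0 1 \<times> {0..1}) (\<lambda>z. p (fst z) (snd z))"
    "continuous_on (ball 0 1 \<times> {0..1}) (\<lambda>z. q (fst z) (snd z))"
    unfolding p_def q_def by (intro continuous_intros contX cF cF')+
  have contJ: "continuous_on (ball 0 1 \<times> cbox 0 1) (\<lambda>(w, t). J (p w t) (q w t))"
    unfolding case_prod_unfold J_def
    using contpq by (intro continuous_intros) auto
  have contg: "continuous_on {0..1} (g w)" "continuous_on {0..1} (p w)" "continuous_on {0..1} (q w)"
    if "w \<in> ball 0 1" for w
  proof -
    have "continuous_on (ball 0 1 \<times> {0..1}) (\<lambda>z. g (fst z) (snd z))"
      unfolding g_def by (intro continuous_intros contX cF)
    thus "continuous_on {0..1} (g w)" "continuous_on {0..1} (p w)" "continuous_on {0..1} (q w)"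
      using contpq that by (auto intro: continuous_on_slice)
  qed
  have w0b: "w0 \<in> ball 0 1" using w0 by simp
  have "((\<lambda>w. integral (cbox 0 1) (g w)) has_derivative
      blinfun_apply (integral (cbox 0 1) (\<lambda>t. J (p w0 t) (q w0 t)))) (at w0 within ball 0 1)"
    by (rule leibniz_rule[OF der _ contJ w0b]) (auto intro!: integrable_continuous_interval contg)
  moreover have "(\<lambda>w. integral (cbox 0 1) (g w)) = disc_potential \<alpha> F"
    by (rule ext) (simp add: g_def[abs_def] disc_potential_def X_def a_def)
  ultimately have 1: "(disc_potential \<alpha> F has_derivative
      blinfun_apply (integral {0..1} (\<lambda>t. J (p w0 t) (q w0 t)))) (at w0)"
    using w0 by (simp add: at_within_open[of w0 "ball 0 1"])
  have "continuous_on {0..1} (\<lambda>t. J (p w0 t) (q w0 t))"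
    by (rule continuous_on_slice[where A = "ball 0 1" and G = "\<lambda>w t. J (p w t) (q w t)" and w = w0])
       (use contJ w0 in \<open>auto simp: case_prod_unfold\<close>)
  hence Jint: "(\<lambda>t. J (p w0 t) (q w0 t)) integrable_on {0..1}"
    by (rule integrable_continuous_interval)
  have 2: "blinfun_apply (integral {0..1} (\<lambda>t. J (p w0 t) (q w0 t))) h =
     integral {0..1} (p w0) * h + integral {0..1} (q w0) * cnj h" for h
    unfolding integral_blinfun_apply[OF Jint] J
    using contg[OF w0b] by (subst integral_add) (auto intro!: integrable_continuous_interval continuous_intros)
  have "((\<lambda>t. q w0 t) has_integral
      of_real 1 * (X w0 1 powr a * F (of_real 1 * cnj w0)) - of_real 0 * (X w0 0 powr a * F (of_real 0 * cnj w0))) {0..1}"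
  proof (rule fundamental_theorem_of_calculus)
    fix t :: real assume t: "t \<in> {0..1}"
    have "(F has_field_derivative deriv F (of_real t * cnj w0)) (at (of_real t * cnj w0))"
      using inball[OF w0 t] F by (intro holomorphic_derivI[OF F]) auto
    hence dF: "((\<lambda>z. F (z * cnj w0)) has_field_derivative deriv F (of_real t * cnj w0) * cnj w0) (at (of_real t))"
      by (intro DERIV_chain2[of F]) (auto intro!: derivative_eq_intros)
    have dX: "((\<lambda>z. (1 - z * w0 * cnj w0) powr a) has_field_derivative
        - w0 * cnj w0 * (a * X w0 t powr (a - 1))) (at (of_real t))"
      using Xpos[OF w0 t] by (auto intro!: derivative_eq_intros simp: X_def)
    have "((\<lambda>z. z * ((1 - z * w0 * cnj w0) powr a * F (z * cnj w0))) has_field_derivative q w0 t) (at (of_real t))"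
      by (rule derivative_eq_intros dX dF refl)+ (auto simp: q_def X_def algebra_simps)
    from has_vector_derivative_real_field[OF this]
    show "((\<lambda>t. of_real t * (X w0 t powr a * F (of_real t * cnj w0))) has_vector_derivative q w0 t) (at t within {0..1})"
      unfolding X_def by (simp add: has_vector_derivative_at_within)
  qed auto
  hence 3: "integral {0..1} (q w0) = (1 - w0 * cnj w0) powr of_real \<alpha> * F (cnj w0)"
    by (simp add: integral_unique X_def a_def)
  show ?thesis
    using 1 unfolding 2[abs_def] 3 by blast
qed

text \<open>U and the potential have the same cnj h component in their derivatives, so the
  derivative of the difference is complex linear.\<close>

lemma disc_decomposition:
  assumes F: "F holomorphic_on ball 0 1"
    and U: "\<And>w. norm w < 1 \<Longrightarrow> \<exists>P. (U has_derivative
         (\<lambda>h. P * h + (1 - w * cnj w) powr of_real \<alpha> * F (cnj w) * cnj h)) (at w)"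
  shows "(\<lambda>w. U w - disc_potential \<alpha> F w) holomorphic_on ball 0 1"
proof -
  have "\<exists>D. ((\<lambda>w. U w - disc_potential \<alpha> F w) has_field_derivative D) (at w)" if w: "w \<in> ball 0 1" for w
  proof -
    obtain P where P: "(U has_derivative
         (\<lambda>h. P * h + (1 - w * cnj w) powr of_real \<alpha> * F (cnj w) * cnj h)) (at w)"
      using U w by auto
    obtain Q where Q: "(disc_potential \<alpha> F has_derivative
         (\<lambda>h. Q * h + (1 - w * cnj w) powr of_real \<alpha> * F (cnj w) * cnj h)) (at w)"
      using disc_potential_has_derivative[OF F] w by auto
    have "((\<lambda>w. U w - disc_potential \<alpha> F w) has_derivative (\<lambda>h. (P - Q) * h)) (at w)"
      by (rule has_derivative_eq_rhs[OF has_derivative_diff[OF P Q]]) (auto simp: algebra_simps)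
    thus ?thesis by (auto simp: has_field_derivative_def)
  qed
  thus ?thesis by (auto simp: holomorphic_on_open)
qed

section \<open>The Cayley transform and a gradient bound\<close>

text \<open>Needed twice: with \<phi> t = t and a continuous weight for the gradient bound, and with
  constant weight and \<phi> t = 1 - t^(1/(\<alpha>+1)) for the radial transform.\<close>

lemma holomorphic_on_radial_average:
  fixes F :: "complex \<Rightarrow> complex" and \<rho> :: "real \<Rightarrow> complex" and \<phi> :: "real \<Rightarrow> real"
  assumes F: "F holomorphic_on ball 0 1"
    and \<rho>: "continuous_on {0..1} \<rho>" and \<phi>: "continuous_on {0..1} \<phi>" "\<And>t. t \<in> {0..1} \<Longrightarrow> \<phi> t \<in> {0..1}"
  shows "(\<lambda>\<omega>. integral {0..1} (\<lambda>t. \<rho> t * F (of_real (\<phi> t) * \<omega>))) holomorphic_on ball 0 1"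
proof -
  have inball: "of_real (\<phi> t) * \<omega> \<in> ball 0 1" if "\<omega> \<in> ball 0 1" "t \<in> {0..1}" for \<omega> :: complex and t
  proof -
    have "\<bar>\<phi> t\<bar> * norm \<omega> \<le> 1 * norm \<omega>" using \<phi>(2)[OF that(2)] by (intro mult_right_mono) auto
    thus ?thesis using that by (simp add: norm_mult)
  qed
  have contF: "continuous_on (ball 0 1) F"
    using F holomorphic_on_imp_continuous_on by blast
  have contF': "continuous_on (ball 0 1) (deriv F)"
    using holomorphic_deriv[OF F] holomorphic_on_imp_continuous_on by blast
  have slice: "continuous_on {0..1} (\<lambda>t. \<rho> t * F (of_real (\<phi> t) * \<omega>))" if "\<omega> \<in> ball 0 1" for \<omega>
    by (intro continuous_intros \<rho> continuous_on_compose2[OF contF] \<phi>(1)) (use inball that in auto)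
  have snd: "continuous_on ((ball 0 1 :: complex set) \<times> {0..1}) (\<lambda>z. \<rho> (snd z))"
    "continuous_on ((ball 0 1 :: complex set) \<times> {0..1}) (\<lambda>z. \<phi> (snd z))"
    by (rule continuous_on_compose2[OF \<rho>], auto intro!: continuous_intros)
       (rule continuous_on_compose2[OF \<phi>(1)], auto intro!: continuous_intros)
  have joint: "continuous_on (ball 0 1 \<times> {0..1})
      (\<lambda>(\<omega>, t). \<rho> t * (deriv F (of_real (\<phi> t) * \<omega>) * of_real (\<phi> t)))"
    unfolding case_prod_unfold
    by (intro continuous_intros snd continuous_on_compose2[OF contF']) (use inball in auto)
  have der: "((\<lambda>\<omega>. \<rho> t * F (of_real (\<phi> t) * \<omega>)) has_field_derivative \<rho> t * (deriv F (of_real (\<phi> t) * \<omega>) * of_real (\<phi> t)))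
      (at \<omega> within ball 0 1)" if "\<omega> \<in> ball 0 1" "t \<in> {0..1}" for \<omega> t
  proof -
    have "(F has_field_derivative deriv F (of_real (\<phi> t) * \<omega>)) (at (of_real (\<phi> t) * \<omega>))"
      using inball[OF that] by (intro holomorphic_derivI[OF F]) auto
    hence "((\<lambda>\<omega>. F (of_real (\<phi> t) * \<omega>)) has_field_derivative deriv F (of_real (\<phi> t) * \<omega>) * of_real (\<phi> t)) (at \<omega>)"
      by (rule DERIV_chain2) (auto intro!: derivative_eq_intros)
    from DERIV_cmult[OF this, of "\<rho> t"] show ?thesis
      by (rule has_field_derivative_at_within)
  qed
  show ?thesis
    unfolding holomorphic_on_def cbox_interval[symmetric]
    by (intro ballI leibniz_rule_field_differentiable[where fx = "\<lambda>\<omega> t. \<rho> t * (deriv F (of_real (\<phi> t) * \<omega>) * of_real (\<phi> t))"])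
       (use der joint in \<open>auto intro!: integrable_continuous_interval slice\<close>)
qed

text \<open>Average w U(w) over |w| = 1/2. The term w h(w) has mean 0. In the potential the extra w
  turns the leading cnj w into the constant 1/4 and the weight into (1 - t/4)^\<alpha>, so what
  remains is G(cnj w) / 4 with G holomorphic and G(0) = \<kappa> F(0). The mean is at most S/2,
  whence K = 2/\<kappa>, which depends only on \<alpha>.\<close>

lemma disc_gradient_bound:
  obtains K :: real where "K > 0"
    "\<And>F U S. F holomorphic_on ball 0 1 \<Longrightarrow>
       (\<And>w. norm w < 1 \<Longrightarrow> \<exists>P. (U has_derivative
         (\<lambda>h. P * h + (1 - w * cnj w) powr of_real \<alpha> * F (cnj w) * cnj h)) (at w)) \<Longrightarrow>
       (\<And>w. norm w = 1/2 \<Longrightarrow> norm (U w) \<le> S) \<Longrightarrow> norm (F 0) \<le> K * S"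
proof -
  define \<kappa> where "\<kappa> = integral {0..1} (\<lambda>t::real. (1 - t / 4) powr \<alpha>)"
  have cont: "continuous_on {0..1} (\<lambda>t::real. (1 - t / 4) powr \<alpha>)"
    by (intro continuous_intros) auto
  \<comment> \<open>A lower bound for (1 - t/4)^\<alpha> on the unit interval: the minimum sits at t
    = 1 for \<alpha> \<ge> 0 and at t = 0 for \<alpha> < 0.\<close>
  define m where "m = min 1 ((3/4::real) powr \<alpha>)"
  have "integral {0..1} (\<lambda>t::real. m) \<le> \<kappa>"
    unfolding \<kappa>_def
  proof (rule integral_le)
    fix t :: real assume t: "t \<in> {0..1}"
    show "m \<le> (1 - t / 4) powr \<alpha>"
    proof (cases "\<alpha> \<ge> 0")
      case True
      hence "(3/4) powr \<alpha> \<le> (1 - t / 4) powr \<alpha>" using t by (intro powr_mono2) auto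
      thus ?thesis by (simp add: m_def)
    next
      case False
      hence "1 powr \<alpha> \<le> (1 - t / 4) powr \<alpha>" using t by (intro powr_mono2') auto
      thus ?thesis by (simp add: m_def)
    qed
  qed (use cont in \<open>auto intro: integrable_continuous_interval\<close>)
  hence "m \<le> \<kappa>" by simp
  moreover have "m > 0" by (simp add: m_def)
  ultimately have \<kappa>: "\<kappa> > 0" by linarith
  show thesis
  proof
    show "2 / \<kappa> > 0" using \<kappa> by simp
    fix F U and S :: real
    assume F: "F holomorphic_on ball 0 1"
      and U: "\<And>w. norm w < 1 \<Longrightarrow> \<exists>P. (U has_derivative
         (\<lambda>h. P * h + (1 - w * cnj w) powr of_real \<alpha> * F (cnj w) * cnj h)) (at w)"
      and S: "\<And>w. norm w = 1/2 \<Longrightarrow> norm (U w) \<le> S"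
    define e where "e x = of_real (1/2) * exp (2 * of_real pi * \<i> * of_real x)" for x :: real
    have e: "norm (e x) = 1/2" for x
      by (simp add: e_def norm_mult exp_eq_polar)
    define h where "h w = U w - disc_potential \<alpha> F w" for w
    have h: "h holomorphic_on ball 0 1"
      unfolding h_def by (rule disc_decomposition[OF F U])
    hence "(\<lambda>w. w * h w) holomorphic_on ball 0 1" by (intro holomorphic_intros)
    from disc_mean_value[OF this, of "1/2"]
    have 1: "((\<lambda>x. e x * h (e x)) has_integral 0) {0..1}"
      by (simp add: e_def)
    define G where "G \<omega> = integral {0..1} (\<lambda>t. of_real ((1 - t / 4) powr \<alpha>) * F (of_real t * \<omega>))" for \<omega>
    have "G holomorphic_on ball 0 1"
      unfolding G_def
      by (rule holomorphic_on_radial_average[OF F, where \<phi> = "\<lambda>t. t"])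
         (intro continuous_intros, auto)
    from disc_mean_value_cnj[OF this, of "1/2"]
    have "((\<lambda>x. G (cnj (e x))) has_integral G 0) {0..1}"
      by (simp add: e_def)
    from has_integral_mult_right[OF this, of "1/4"]
    have 2: "((\<lambda>x. 1/4 * G (cnj (e x))) has_integral 1/4 * G 0) {0..1}" .
    have "e x * disc_potential \<alpha> F (e x) = 1/4 * G (cnj (e x))" for x
    proof -
      have *: "e x * cnj (e x) = 1/4"
        using complex_norm_square[of "e x"] e[of x] by (simp add: power2_eq_square)
      have "(1 - of_real t * e x * cnj (e x)) powr of_real \<alpha> = complex_of_real ((1 - t / 4) powr \<alpha>)"
        if "t \<in> {0..1}" for t
      proof -
        have "1 - of_real t * e x * cnj (e x) = complex_of_real (1 - t / 4)"
          using * by (simp add: mult.assoc)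
        show ?thesis unfolding \<open>1 - of_real t * e x * cnj (e x) = _\<close>
          by (rule powr_of_real) (use that in auto)
      qed
      hence "disc_potential \<alpha> F (e x) = cnj (e x) * G (cnj (e x))"
        unfolding disc_potential_def G_def by (intro arg_cong2[of _ _ _ _ "(*)"] refl integral_cong) simp
      thus ?thesis using * by (simp flip: mult.assoc)
    qed
    hence "e x * h (e x) + 1/4 * G (cnj (e x)) = e x * U (e x)" for x
      unfolding h_def right_diff_distrib by simp
    hence "((\<lambda>x. e x * U (e x)) has_integral 0 + 1/4 * G 0) {0..1}"
      using has_integral_add[OF 1 2] by simp
    hence 3: "norm (0 + 1/4 * G 0) \<le> S / 2 * measure lborel (cbox (0::real) 1)"
    proof (intro has_integral_bound[where f = "\<lambda>x. e x * U (e x)"])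
      show "0 \<le> S / 2" using S[of "1/2"] norm_ge_zero[of "U (1/2)"] by (simp add: norm_divide del: norm_ge_zero)
      show "norm (e x * U (e x)) \<le> S / 2" for x using S[OF e, of x] unfolding norm_mult e by simp
    qed auto
    have "G 0 = integral {0..1} (\<lambda>t. complex_of_real ((1 - t / 4) powr \<alpha>) * F 0)"
      by (simp add: G_def)
    also have "\<dots> = integral {0..1} (\<lambda>t. complex_of_real ((1 - t / 4) powr \<alpha>)) * F 0"
      by (rule integral_mult_left)
    also have "integral {0..1} (\<lambda>t. complex_of_real ((1 - t / 4) powr \<alpha>)) = of_real \<kappa>"
      unfolding \<kappa>_def
      using integral_linear[OF integrable_continuous_interval[OF cont] bounded_linear_of_real[where ?'a = complex]]
      by (simp add: o_def)
    finally have "norm (G 0) = \<kappa> * norm (F 0)" using \<kappa> by (simp add: norm_mult)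
    thus "norm (F 0) \<le> 2 / \<kappa> * S" using 3 \<kappa> by (simp add: norm_divide norm_mult field_simps)
  qed
qed

text \<open>Sends 0 to z0 and 1 to infinity. The free centre turns an estimate at the origin of the
  disc into one at an arbitrary point of the half-plane; the global transport uses the centre
  \<i>.\<close>

definition cayley :: "complex \<Rightarrow> complex \<Rightarrow> complex" where
  "cayley z0 w = of_real (Re z0) + \<i> * of_real (Im z0) * ((1 + w) / (1 - w))"

lemma Re_one_minus_gt_0: "norm (w::complex) < 1 \<Longrightarrow> Re (1 - w) > 0"
  using complex_Re_le_cmod[of w] by simp

lemma Re_cayley_factor:
  assumes "w \<noteq> 1"
  shows "Re ((1 + w) / (1 - w)) = (1 - (norm w)\<^sup>2) / (norm (1 - w))\<^sup>2"
proof -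
  have "(1 + w) / (1 - w) = (1 + w) * cnj (1 - w) / of_real ((norm (1 - w))\<^sup>2)"
    by (rule complex_div_cnj)
  moreover have "Re ((1 + w) * cnj (1 - w)) = 1 - (norm w)\<^sup>2"
    unfolding cmod_power2 by (simp add: algebra_simps power2_eq_square)
  ultimately show ?thesis by (simp del: of_real_power)
qed

lemma Im_cayley:
  assumes "w \<noteq> 1"
  shows "Im (cayley z0 w) = Im z0 * ((1 - (norm w)\<^sup>2) / (norm (1 - w))\<^sup>2)"
proof -
  have "Im (of_real x + \<i> * of_real y * q) = y * Re q" for x y q by simp
  thus ?thesis unfolding cayley_def Re_cayley_factor[OF assms, symmetric] .
qed

lemma Im_cayley_pos:
  assumes "Im z0 > 0" "norm w < 1"
  shows "Im (cayley z0 w) > 0"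
proof -
  have "w \<noteq> 1" using assms by auto
  moreover have "(norm w)\<^sup>2 < 1" using assms by (simp add: power_less_one_iff)
  ultimately show ?thesis using assms by (simp add: Im_cayley)
qed

lemma cayley_has_field_derivative:
  assumes "w \<noteq> 1"
  shows "(cayley z0 has_field_derivative 2 * \<i> * of_real (Im z0) / (1 - w)\<^sup>2) (at w)"
  unfolding cayley_def[abs_def] using assms
  by (auto intro!: derivative_eq_intros simp: field_simps power2_eq_square)

text \<open>Splits a real power of |X| into a holomorphic and an antiholomorphic factor, so that the
  former can cancel against the factor (1 - w)^\<alpha> of the pullback.\<close>

lemma powr_mult_cnj_powr:
  assumes "X \<notin> \<real>\<^sub>\<le>\<^sub>0"
  shows "X powr of_real \<beta> * cnj X powr of_real \<beta> = of_real (norm X powr (2 * \<beta>))"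
proof -
  have X: "X \<noteq> 0" using assms by auto
  have "cnj X powr of_real \<beta> = cnj (X powr of_real \<beta>)"
    using assms by (subst cnj_powr) (auto simp: complex_nonpos_Reals_iff)
  hence "X powr of_real \<beta> * cnj X powr of_real \<beta> = of_real ((norm (X powr of_real \<beta>))\<^sup>2)"
    using complex_norm_square[of "X powr of_real \<beta>"] by simp
  also have "norm (X powr of_real \<beta>) = norm X powr \<beta>"
    using X by (simp add: norm_powr_real_powr')
  also have "(norm X powr \<beta>)\<^sup>2 = norm X powr (2 * \<beta>)"
    using X by (simp add: powr_powr power2_eq_square flip: powr_add)
  finally show ?thesis .
qed

text \<open>In the exponent of 1 - \<omega>, the part -\<alpha> is the antiholomorphic half of |1 -
  w|^(-2\<alpha>), coming from Im of the Cayley map, and -2 comes from the conjugated derivative of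
  that map, which also supplies -2\<i> and one factor Im z0.\<close>

definition disc_density :: "real \<Rightarrow> (complex \<Rightarrow> complex) \<Rightarrow> complex \<Rightarrow> complex \<Rightarrow> complex" where
  "disc_density \<alpha> f z0 \<omega> = - 2 * \<i> * of_real (Im z0 powr (\<alpha> + 1)) * (1 - \<omega>) powr (- of_real \<alpha> - 2) *
     f (of_real (Re z0) - \<i> * of_real (Im z0) * ((1 + \<omega>) / (1 - \<omega>)))"

lemma cnj_cayley: "cnj (cayley z0 w) = of_real (Re z0) - \<i> * of_real (Im z0) * ((1 + cnj w) / (1 - cnj w))"
  by (simp add: cayley_def)

lemma disc_density_holomorphic:
  assumes f: "f holomorphic_on {z. Im z < 0}" and z0: "Im z0 > 0"
  shows "disc_density \<alpha> f z0 holomorphic_on ball 0 1"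
proof -
  let ?g = "\<lambda>\<omega>. of_real (Re z0) - \<i> * of_real (Im z0) * ((1 + \<omega>) / (1 - \<omega>))"
  have ne: "1 - \<omega> \<notin> \<real>\<^sub>\<le>\<^sub>0" if "\<omega> \<in> ball 0 1" for \<omega> :: complex
    using Re_one_minus_gt_0[of \<omega>] that by (auto simp: complex_nonpos_Reals_iff)
  have "1 - \<omega> \<noteq> 0" if "\<omega> \<in> ball 0 1" for \<omega> :: complex
    using that by auto
  hence g: "?g holomorphic_on ball 0 1"
    by (intro holomorphic_intros) auto
  have "?g ` ball 0 1 \<subseteq> {z. Im z < 0}"
  proof safe
    fix \<omega> :: complex assume "\<omega> \<in> ball 0 1"
    hence "Im (cayley z0 (cnj \<omega>)) > 0" by (intro Im_cayley_pos z0) auto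
    moreover have "?g \<omega> = cnj (cayley z0 (cnj \<omega>))" unfolding cnj_cayley by simp
    ultimately show "Im (?g \<omega>) < 0" by (simp only:) simp
  qed
  from holomorphic_on_compose_gen[OF g f this]
  have "(\<lambda>\<omega>. f (?g \<omega>)) holomorphic_on ball 0 1" by (simp add: o_def)
  thus ?thesis
    unfolding disc_density_def[abs_def]
    by (intro holomorphic_intros) (use ne in auto)
qed

lemma cayley_pullback_has_derivative:
  assumes u: "(u has_derivative (\<lambda>h. p * h + of_real (Im z powr \<alpha>) * f (cnj z) * cnj h)) (at z)"
    and z: "z = cayley z0 w" and z0: "Im z0 > 0" and w: "norm w < 1"
  shows "\<exists>P. ((\<lambda>w. (1 - w) powr of_real \<alpha> * u (cayley z0 w)) has_derivative
      (\<lambda>h. P * h + (1 - w * cnj w) powr of_real \<alpha> * disc_density \<alpha> f z0 (cnj w) * cnj h)) (at w)"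
proof -
  define X where "X = 1 - w"
  define y0 where "y0 = Im z0"
  define a where "a = complex_of_real \<alpha>"
  have X0: "X \<notin> \<real>\<^sub>\<le>\<^sub>0"
    using Re_one_minus_gt_0[of w] w by (auto simp: X_def complex_nonpos_Reals_iff)
  hence X: "X \<noteq> 0" by auto
  have w1: "w \<noteq> 1" using w by auto
  have w2: "(norm w)\<^sup>2 < 1" using w by (simp add: power_less_one_iff)
  define d where "d = 2 * \<i> * of_real y0 / X\<^sup>2"
  have "(cayley z0 has_derivative (\<lambda>h. d * h)) (at w)"
    using cayley_has_field_derivative[OF w1, of z0] by (simp only: has_field_derivative_def d_def X_def y0_def)
  from has_derivative_compose[OF this u[unfolded z]]
  have 1: "((\<lambda>w. u (cayley z0 w)) has_derivative
     (\<lambda>h. p * (d * h) + of_real (Im z powr \<alpha>) * f (cnj z) * cnj (d * h))) (at w)"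
    by (simp add: z)
  have "((\<lambda>w. (1 - w) powr a) has_field_derivative - (a * X powr (a - 1))) (at w)"
    using X0 by (auto intro!: derivative_eq_intros simp: X_def)
  hence 2: "((\<lambda>w. (1 - w) powr a) has_derivative (\<lambda>h. - (a * X powr (a - 1)) * h)) (at w)"
    by (simp only: has_field_derivative_def)
  have 3: "((\<lambda>w. (1 - w) powr a * u (cayley z0 w)) has_derivative
     (\<lambda>h. (X powr a * p * d - (a * X powr (a - 1)) * u z) * h +
        (X powr a * of_real (Im z powr \<alpha>) * cnj d) * f (cnj z) * cnj h)) (at w)"
    by (rule has_derivative_eq_rhs[OF has_derivative_mult[OF 2 1]]) (auto simp: X_def z algebra_simps)
  have "Im z = y0 * (1 - (norm w)\<^sup>2) * (norm X powr (-2))"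
    unfolding z Im_cayley[OF w1] X_def y0_def by (simp add: powr_minus field_simps)
  hence "Im z powr \<alpha> = y0 powr \<alpha> * (1 - (norm w)\<^sup>2) powr \<alpha> * norm X powr (2 * - \<alpha>)"
    using z0 w2 by (simp add: powr_mult powr_powr y0_def)
  hence "complex_of_real (Im z powr \<alpha>) = of_real (y0 powr \<alpha>) * of_real ((1 - (norm w)\<^sup>2) powr \<alpha>) *
      (X powr of_real (- \<alpha>) * cnj X powr of_real (- \<alpha>))"
    unfolding powr_mult_cnj_powr[OF X0] by simp
  also have "complex_of_real ((1 - (norm w)\<^sup>2) powr \<alpha>) = (1 - w * cnj w) powr a"
    unfolding complex_norm_square[symmetric] a_def using w2
    by (simp flip: powr_of_real)
  finally have "X powr a * of_real (Im z powr \<alpha>) * cnj d =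
     (X powr a * X powr (- a)) * of_real (y0 powr \<alpha>) * (1 - w * cnj w) powr a * cnj X powr (- a) * cnj d"
    by (simp add: a_def mult_ac)
  also have "X powr a * X powr (- a) = 1"
    using X by (simp flip: powr_add)
  also have cd: "cnj d = - 2 * \<i> * of_real y0 / (cnj X)\<^sup>2"
    by (simp add: d_def)
  also have "cnj X powr (- a) = cnj X powr (- a - 2) * (cnj X)\<^sup>2"
    using X by (simp add: powr_diff)
  also have "1 * of_real (y0 powr \<alpha>) * (1 - w * cnj w) powr a * (cnj X powr (- a - 2) * (cnj X)\<^sup>2) *
       (- 2 * \<i> * of_real y0 / (cnj X)\<^sup>2) =
      (1 - w * cnj w) powr a * (- 2 * \<i> * of_real (y0 powr (\<alpha> + 1)) * cnj X powr (- a - 2))"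
    using X z0 by (simp add: field_simps powr_add y0_def)
  finally have E: "X powr a * of_real (Im z powr \<alpha>) * (- 2 * \<i> * of_real y0 / (cnj X)\<^sup>2) =
      (1 - w * cnj w) powr a * (- 2 * \<i> * of_real (y0 powr (\<alpha> + 1)) * cnj X powr (- a - 2))" .
  have "(X powr a * of_real (Im z powr \<alpha>) * cnj d) * f (cnj z) =
     (1 - w * cnj w) powr a * disc_density \<alpha> f z0 (cnj w)"
    unfolding cd E unfolding disc_density_def z cnj_cayley by (simp add: X_def y0_def a_def mult.assoc)
  thus ?thesis using 3 unfolding a_def by auto
qed

text \<open>On |w| = 1/2 both |1 + w| and |1 - w| lie between 1/2 and 3/2, which gives the factors
  1/3 and 3. The image is a hyperbolic circle about z0 whose size is comparable to Im z0.\<close>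

lemma cayley_half_circle:
  assumes "norm w = 1/2" "Im z0 > 0"
  shows "Im (cayley z0 w) \<ge> Im z0 / 3" "norm (cayley z0 w - of_real (Re z0)) \<le> 3 * Im z0"
proof -
  have w1: "w \<noteq> 1" using assms by auto
  have w34: "1 - (norm w)\<^sup>2 = 3/4" unfolding assms(1) by (simp add: power2_eq_square)
  have a: "norm (1 - w) \<le> 3/2" using norm_triangle_ineq4[of 1 w] assms by simp
  have b: "norm (1 - w) \<ge> 1/2" using norm_triangle_ineq2[of 1 w] assms by simp
  have c: "norm (1 + w) \<le> 3/2" using norm_triangle_ineq[of 1 w] assms by simp
  have "(norm (1 - w))\<^sup>2 \<le> (3/2)\<^sup>2" using a by (intro power_mono) auto
  hence "1/3 \<le> (3/4) / (norm (1 - w))\<^sup>2"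
    using w1 by (simp add: field_simps power2_eq_square)
  from mult_left_mono[OF this, of "Im z0"] show "Im (cayley z0 w) \<ge> Im z0 / 3"
    unfolding Im_cayley[OF w1] w34 using assms(2) by simp
  have "norm ((1 + w) / (1 - w)) \<le> (3/2) / (1/2)"
    unfolding norm_divide using a b c by (intro frac_le) auto
  from mult_left_mono[OF this, of "Im z0"] assms(2)
  have le: "Im z0 * norm ((1 + w) / (1 - w)) \<le> Im z0 * ((3/2) / (1/2))"
    by linarith
  show "norm (cayley z0 w - of_real (Re z0)) \<le> 3 * Im z0"
  proof -
    have eq: "norm (of_real x + \<i> * of_real (Im z0) * q - of_real x) = Im z0 * norm q" for x :: real and q
      using assms(2) by (simp add: norm_mult)
    show ?thesis unfolding cayley_def eq using le by simp
  qed
qed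

text \<open>At w = 0 the density has modulus 2 y0^(\<alpha>+1) |f(cnj z0)|, so the disc estimate
  centred at z0 applies. The disc constant does not see z0, hence K is uniform; the factor
  2^|\<alpha>| dominates |1 - w|^\<alpha> on the circle.\<close>

lemma half_plane_gradient_bound:
  obtains K :: real where "K > 0"
    "\<And>u f z0 S. f holomorphic_on {z. Im z < 0} \<Longrightarrow>
       (\<And>z. Im z > 0 \<Longrightarrow> \<exists>P. (u has_derivative (\<lambda>h. P * h + of_real (Im z powr \<alpha>) * f (cnj z) * cnj h)) (at z)) \<Longrightarrow>
       Im z0 > 0 \<Longrightarrow>
       (\<And>z. Im z \<ge> Im z0 / 3 \<Longrightarrow> norm (z - of_real (Re z0)) \<le> 3 * Im z0 \<Longrightarrow> norm (u z) \<le> S) \<Longrightarrow>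
       Im z0 powr (\<alpha> + 1) * norm (f (cnj z0)) \<le> K * S"
proof -
  obtain K where K: "K > 0"
    "\<And>F U S. F holomorphic_on ball 0 1 \<Longrightarrow>
       (\<And>w. norm w < 1 \<Longrightarrow> \<exists>P. (U has_derivative
         (\<lambda>h. P * h + (1 - w * cnj w) powr of_real \<alpha> * F (cnj w) * cnj h)) (at w)) \<Longrightarrow>
       (\<And>w. norm w = 1/2 \<Longrightarrow> norm (U w) \<le> S) \<Longrightarrow> norm (F 0) \<le> K * S"
    using disc_gradient_bound[of \<alpha>] by blast
  show thesis
  proof
    show "K * 2 powr \<bar>\<alpha>\<bar> > 0" using K by simp
    fix u f z0 and S :: real
    assume f: "f holomorphic_on {z. Im z < 0}"
      and u: "\<And>z. Im z > 0 \<Longrightarrow> \<exists>P. (u has_derivative (\<lambda>h. P * h + of_real (Im z powr \<alpha>) * f (cnj z) * cnj h)) (at z)"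
      and z0: "Im z0 > 0"
      and S: "\<And>z. Im z \<ge> Im z0 / 3 \<Longrightarrow> norm (z - of_real (Re z0)) \<le> 3 * Im z0 \<Longrightarrow> norm (u z) \<le> S"
    have "norm (disc_density \<alpha> f z0 0) \<le> K * (2 powr \<bar>\<alpha>\<bar> * S)"
    proof (rule K(2)[OF disc_density_holomorphic[OF f z0]])
      fix w :: complex assume "norm w < 1"
      thus "\<exists>P. ((\<lambda>w. (1 - w) powr of_real \<alpha> * u (cayley z0 w)) has_derivative
         (\<lambda>h. P * h + (1 - w * cnj w) powr of_real \<alpha> * disc_density \<alpha> f z0 (cnj w) * cnj h)) (at w)"
        using u[OF Im_cayley_pos[OF z0]] cayley_pullback_has_derivative[OF _ refl z0] by blast
    next
      fix w :: complex assume w: "norm w = 1/2"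
      have a: "norm (1 - w) \<le> 2" using norm_triangle_ineq4[of 1 w] w by simp
      have b: "norm (1 - w) \<ge> 1/2" using norm_triangle_ineq2[of 1 w] w by simp
      have "norm (1 - w) powr \<alpha> \<le> 2 powr \<bar>\<alpha>\<bar>"
      proof (cases "\<alpha> \<ge> 0")
        case True
        thus ?thesis using a by (auto intro: powr_mono2)
      next
        case False
        hence "norm (1 - w) powr \<alpha> \<le> (1/2) powr \<alpha>" using b by (intro powr_mono2') auto
        also have "\<dots> = 2 powr \<bar>\<alpha>\<bar>" using False by (simp add: powr_divide powr_minus_divide)
        finally show ?thesis .
      qed
      moreover have "norm ((1 - w) powr of_real \<alpha>) = norm (1 - w) powr \<alpha>"
        by (simp add: norm_powr_real_powr')
      ultimately show "norm ((1 - w) powr of_real \<alpha> * u (cayley z0 w)) \<le> 2 powr \<bar>\<alpha>\<bar> * S"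
        unfolding norm_mult using S cayley_half_circle[OF w z0] by (intro mult_mono) auto
    qed
    moreover have "norm (disc_density \<alpha> f z0 0) = 2 * (Im z0 powr (\<alpha> + 1) * norm (f (cnj z0)))"
    proof -
      have "of_real (Re z0) - \<i> * of_real (Im z0) = cnj z0"
        by (simp add: complex_eq_iff)
      thus ?thesis by (simp add: disc_density_def norm_mult)
    qed
    moreover have "Im z0 powr (\<alpha> + 1) * norm (f (cnj z0)) \<ge> 0" by simp
    ultimately show "Im z0 powr (\<alpha> + 1) * norm (f (cnj z0)) \<le> K * 2 powr \<bar>\<alpha>\<bar> * S"
      unfolding mult.assoc by linarith
  qed
qed

section \<open>Boundary behaviour of the potential\<close>

text \<open>The factor 1 - \<xi> is needed later to cancel a kernel as singular as 1/(1 - \<xi>). It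
  comes from Bernoulli's inequality with an integer exponent above |\<alpha>|; for negative \<alpha>
  one first factors out \<xi>^\<alpha>.\<close>

lemma one_minus_powr_bound:
  fixes \<alpha> :: real
  obtains m :: real where "m \<ge> 0" "\<And>\<xi>. 0 < \<xi> \<Longrightarrow> \<xi> < 1 \<Longrightarrow> \<bar>1 - \<xi> powr \<alpha>\<bar> \<le> m * (1 - \<xi>) * (1 + \<xi> powr \<alpha>)"
proof -
  obtain M :: nat where M: "\<bar>\<alpha>\<bar> \<le> real M" using real_arch_simple by blast
  show thesis
  proof
    fix \<xi> :: real assume \<xi>: "0 < \<xi>" "\<xi> < 1"
    have "1 + real M * (\<xi> - 1) \<le> (1 + (\<xi> - 1)) ^ M"
      using \<xi> by (intro Bernoulli_inequality) auto
    also have "\<dots> = \<xi> powr real M" using \<xi> by (simp add: powr_realpow)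
    also have "\<dots> \<le> \<xi> powr \<bar>\<alpha>\<bar>" using \<xi> M by (intro powr_mono') auto
    finally have 1: "1 - \<xi> powr \<bar>\<alpha>\<bar> \<le> real M * (1 - \<xi>)" by (simp add: algebra_simps)
    show "\<bar>1 - \<xi> powr \<alpha>\<bar> \<le> real M * (1 - \<xi>) * (1 + \<xi> powr \<alpha>)"
    proof (cases "\<alpha> \<ge> 0")
      case True
      hence "\<xi> powr \<alpha> \<le> 1" using \<xi> by (intro powr_le1) auto
      hence "\<bar>1 - \<xi> powr \<alpha>\<bar> \<le> real M * (1 - \<xi>) * 1" using 1 True by simp
      also have "\<dots> \<le> real M * (1 - \<xi>) * (1 + \<xi> powr \<alpha>)" using \<xi> by (intro mult_left_mono) auto
      finally show ?thesis .
    next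
      case False
      have eq: "\<xi> powr \<alpha> * \<xi> powr \<bar>\<alpha>\<bar> = 1" using False \<xi> by (simp flip: powr_add)
      have "1 \<le> \<xi> powr \<alpha>" using False \<xi> powr_mono'[of \<alpha> 0 \<xi>] by simp
      hence "\<bar>1 - \<xi> powr \<alpha>\<bar> = \<xi> powr \<alpha> * (1 - \<xi> powr \<bar>\<alpha>\<bar>)" using eq by (simp add: algebra_simps)
      also have "\<dots> \<le> \<xi> powr \<alpha> * (real M * (1 - \<xi>))" using 1 by (intro mult_left_mono) auto
      also have "\<dots> \<le> (1 + \<xi> powr \<alpha>) * (real M * (1 - \<xi>))" using \<xi> by (intro mult_right_mono) auto
      finally show ?thesis by (simp add: mult_ac)
    qed
  qed simp
qed

text \<open>This is \<open>(\<alpha>+1) \<integral>\<^sub>0\<^sup>1 (1-t)\<^sup>\<alpha> F(t\<omega>) dt\<close> after the substitution \<open>s = (1-t)\<^sup>\<alpha>\<^sup>+\<^sup>1\<close>, which makes the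
  integrand continuous even for \<open>\<alpha> < 0\<close>.\<close>

definition radial_transform :: "real \<Rightarrow> (complex \<Rightarrow> complex) \<Rightarrow> complex \<Rightarrow> complex" where
  "radial_transform \<alpha> F \<omega> = integral {0..1} (\<lambda>s. F (of_real (1 - s powr (1 / (\<alpha> + 1))) * \<omega>))"

lemma radial_transform_holomorphic:
  assumes "\<alpha> > -1" "F holomorphic_on ball 0 1"
  shows "radial_transform \<alpha> F holomorphic_on ball 0 1"
proof -
  have "(\<lambda>\<omega>. integral {0..1} (\<lambda>t. 1 * F (of_real (1 - t powr (1 / (\<alpha> + 1))) * \<omega>))) holomorphic_on ball 0 1"
    by (rule holomorphic_on_radial_average[OF assms(2)])
       (use assms(1) in \<open>auto intro!: continuous_on_diff continuous_on_powr' continuous_on_const continuous_on_id powr_le1\<close>)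
  thus ?thesis by (simp add: radial_transform_def[abs_def])
qed

text \<open>Inverse to \<xi> = (1 - t) / (1 - r^2 t). It is chosen so that 1 - t r^2 =
  \<open>moebius_w r \<xi>\<close> and 1 - t = \<xi> \<open>moebius_w r \<xi>\<close>: in the
  variable \<xi> the weights of the potential and of the transform differ by the factor
  \<xi>^\<alpha>, which no longer depends on r.\<close>

definition moebius_t :: "real \<Rightarrow> real \<Rightarrow> real" where
  "moebius_t r \<xi> = (1 - \<xi>) / (1 - r\<^sup>2 * \<xi>)"

definition moebius_w :: "real \<Rightarrow> real \<Rightarrow> real" where
  "moebius_w r \<xi> = (1 - r\<^sup>2) / (1 - r\<^sup>2 * \<xi>)"

definition moebius_integrand :: "real \<Rightarrow> real \<Rightarrow> complex \<Rightarrow> (complex \<Rightarrow> complex) \<Rightarrow> real \<Rightarrow> complex" where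
  "moebius_integrand r \<alpha> \<omega> F \<xi> =
     of_real (moebius_w r \<xi> powr (\<alpha> + 1) / (1 - r\<^sup>2 * \<xi>)) * F (of_real (moebius_t r \<xi>) * \<omega>)"

context
  fixes r \<alpha> :: real and \<omega> :: complex and F :: "complex \<Rightarrow> complex"
  assumes r: "0 \<le> r" "r < 1" and \<alpha>: "\<alpha> > -1" and F: "F holomorphic_on ball 0 1" and \<omega>: "norm \<omega> < 1"
begin

lemma moebius_facts:
  assumes "\<xi> \<in> {0..1}"
  shows "1 - r\<^sup>2 * \<xi> > 0" "1 - r\<^sup>2 > 0" "moebius_t r \<xi> \<in> {0..1}" "moebius_w r \<xi> > 0"
    "1 - moebius_t r \<xi> * r\<^sup>2 = moebius_w r \<xi>" "1 - moebius_t r \<xi> = \<xi> * moebius_w r \<xi>"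
proof -
  have r2: "r\<^sup>2 < 1" using r by (simp add: power_less_one_iff)
  thus 1: "1 - r\<^sup>2 > 0" by simp
  have "r\<^sup>2 * \<xi> \<le> r\<^sup>2 * 1" using assms by (intro mult_left_mono) auto
  with r2 show 2: "1 - r\<^sup>2 * \<xi> > 0" by simp
  have "r\<^sup>2 * \<xi> \<le> 1 * \<xi>" using assms r2 by (intro mult_right_mono) auto
  with 2 assms show "moebius_t r \<xi> \<in> {0..1}" by (auto simp: moebius_t_def field_simps)
  show "moebius_w r \<xi> > 0" using 1 2 by (simp add: moebius_w_def)
  show "1 - moebius_t r \<xi> * r\<^sup>2 = moebius_w r \<xi>" "1 - moebius_t r \<xi> = \<xi> * moebius_w r \<xi>"
    using 2 by (simp_all add: moebius_t_def moebius_w_def field_simps)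
qed

lemma continuous_on_radius: "continuous_on {0..1} (\<lambda>t. F (of_real t * \<omega>))"
proof (rule continuous_on_compose2[OF holomorphic_on_imp_continuous_on[OF F]])
  show "(\<lambda>t. complex_of_real t * \<omega>) ` {0..1} \<subseteq> ball 0 1"
  proof safe
    fix t :: real assume "t \<in> {0..1}"
    hence "\<bar>t\<bar> * norm \<omega> \<le> 1 * norm \<omega>" by (intro mult_right_mono) auto
    thus "of_real t * \<omega> \<in> ball 0 1" using \<omega> by (simp add: norm_mult)
  qed
qed (intro continuous_intros)

lemma moebius_has_derivative:
  assumes "\<xi> \<in> {0..1}"
  shows "(moebius_t r has_real_derivative - (moebius_w r \<xi> / (1 - r\<^sup>2 * \<xi>))) (at \<xi>)"
    "((\<lambda>\<xi>. \<xi> * moebius_w r \<xi>) has_real_derivative moebius_w r \<xi> / (1 - r\<^sup>2 * \<xi>)) (at \<xi>)"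
proof -
  define D where "D = 1 - r\<^sup>2 * \<xi>"
  have D: "D \<noteq> 0" using moebius_facts(1)[OF assms] by (simp add: D_def)
  have d: "((\<lambda>\<xi>. 1 - r\<^sup>2 * \<xi>) has_real_derivative - (r\<^sup>2)) (at \<xi>)"
    by (auto intro!: derivative_eq_intros)
  have 1: "(- 1 * D - (1 - \<xi>) * - (r\<^sup>2)) / (D * D) = - ((1 - r\<^sup>2) / D / D)"
    unfolding minus_divide_left divide_divide_eq_left
    by (rule arg_cong2[of _ _ _ _ "(/)"]) (simp_all add: D_def algebra_simps)
  have 2: "((1 - r\<^sup>2) * D - (\<xi> * (1 - r\<^sup>2)) * - (r\<^sup>2)) / (D * D) = (1 - r\<^sup>2) / D / D"
    unfolding divide_divide_eq_left
    by (rule arg_cong2[of _ _ _ _ "(/)"]) (simp_all add: D_def algebra_simps)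
  have "((\<lambda>\<xi>. (1 - \<xi>) / (1 - r\<^sup>2 * \<xi>)) has_real_derivative
      (- 1 * D - (1 - \<xi>) * - (r\<^sup>2)) / (D * D)) (at \<xi>)"
    unfolding D_def by (rule DERIV_divide d | use D in \<open>auto intro!: derivative_eq_intros simp: D_def\<close>)+
  thus "(moebius_t r has_real_derivative - (moebius_w r \<xi> / (1 - r\<^sup>2 * \<xi>))) (at \<xi>)"
    unfolding 1 unfolding moebius_t_def[abs_def] moebius_w_def D_def .
  have "((\<lambda>\<xi>. (\<xi> * (1 - r\<^sup>2)) / (1 - r\<^sup>2 * \<xi>)) has_real_derivative
      ((1 - r\<^sup>2) * D - (\<xi> * (1 - r\<^sup>2)) * - (r\<^sup>2)) / (D * D)) (at \<xi>)"
    unfolding D_def by (rule DERIV_divide d | use D in \<open>auto intro!: derivative_eq_intros simp: D_def\<close>)+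
  thus "((\<lambda>\<xi>. \<xi> * moebius_w r \<xi>) has_real_derivative moebius_w r \<xi> / (1 - r\<^sup>2 * \<xi>)) (at \<xi>)"
    unfolding 2 unfolding moebius_w_def D_def by simp
qed

lemma moebius_t_01: "moebius_t r 0 = 1" "moebius_t r 1 = 0"
  by (simp_all add: moebius_t_def)

lemma has_integral_moebius_potential:
  "(moebius_integrand r \<alpha> \<omega> F has_integral integral {0..1} (\<lambda>t. of_real ((1 - t * r\<^sup>2) powr \<alpha>) * F (of_real t * \<omega>))) {0..1}"
proof -
  let ?f = "\<lambda>t. of_real ((1 - t * r\<^sup>2) powr \<alpha>) * F (of_real t * \<omega>)"
  have "t * r\<^sup>2 < 1" if "t \<in> {0..1}" for t
    using moebius_facts(1)[OF that] by (simp add: mult.commute)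
  hence contf: "continuous_on {0..1} ?f"
    by (intro continuous_intros continuous_on_radius) force
  have "((\<lambda>\<xi>. (- (moebius_w r \<xi> / (1 - r\<^sup>2 * \<xi>))) *\<^sub>R ?f (moebius_t r \<xi>)) has_integral
     (integral {moebius_t r 0..moebius_t r 1} ?f - integral {moebius_t r 1..moebius_t r 0} ?f)) {0..1}"
  proof (rule has_integral_substitution_general[of "{}"])
    show "moebius_t r ` {0..1} \<subseteq> {0..1}" using moebius_facts(3) by auto
    show "continuous_on {0..1} (moebius_t r)"
      using moebius_has_derivative(1) by (intro DERIV_continuous_on) (rule has_field_derivative_at_within)
  qed (use contf moebius_has_derivative(1) in \<open>auto intro: has_field_derivative_at_within\<close>)
  \<comment> \<open>As \<xi> runs from 0 to 1, t runs from 1 down to 0, hence the sign.\<close>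
  from has_integral_neg[OF this, unfolded moebius_t_01]
  have "((\<lambda>\<xi>. - ((- (moebius_w r \<xi> / (1 - r\<^sup>2 * \<xi>))) *\<^sub>R ?f (moebius_t r \<xi>))) has_integral integral {0..1} ?f) {0..1}"
    by simp
  thus ?thesis
  proof (rule has_integral_eq[rotated])
    fix \<xi> :: real assume \<xi>: "\<xi> \<in> {0..1}"
    have "moebius_w r \<xi> / (1 - r\<^sup>2 * \<xi>) * moebius_w r \<xi> powr \<alpha> = moebius_w r \<xi> powr (\<alpha> + 1) / (1 - r\<^sup>2 * \<xi>)"
      using moebius_facts[OF \<xi>] by (simp add: powr_add)
    moreover have "- ((- x) *\<^sub>R (of_real y * c)) = of_real (x * y) * c" for x y and c :: complex
      by (simp add: scaleR_conv_of_real)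
    ultimately show "- ((- (moebius_w r \<xi> / (1 - r\<^sup>2 * \<xi>))) *\<^sub>R ?f (moebius_t r \<xi>)) = moebius_integrand r \<alpha> \<omega> F \<xi>"
      unfolding moebius_facts(5)[OF \<xi>] moebius_integrand_def by (simp only:)
  qed
qed

lemma has_integral_moebius_radial:
  "((\<lambda>\<xi>. of_real (\<xi> powr \<alpha>) * moebius_integrand r \<alpha> \<omega> F \<xi>) has_integral radial_transform \<alpha> F \<omega> / of_real (\<alpha> + 1)) {0..1}"
proof -
  let ?\<beta> = "1 / (\<alpha> + 1)"
  let ?f = "\<lambda>s. F (of_real (1 - s powr ?\<beta>) * \<omega>)"
  let ?g = "\<lambda>\<xi>. (\<xi> * moebius_w r \<xi>) powr (\<alpha> + 1)"
  let ?g' = "\<lambda>\<xi>. (\<alpha> + 1) * (\<xi> * moebius_w r \<xi>) powr \<alpha> * (moebius_w r \<xi> / (1 - r\<^sup>2 * \<xi>))"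
  have contf: "continuous_on {0..1} ?f"
    by (rule continuous_on_compose2[OF continuous_on_radius])
       (use \<alpha> in \<open>auto intro!: continuous_on_of_real continuous_on_diff continuous_on_powr' continuous_on_const continuous_on_id powr_le1\<close>)
  have g01: "\<xi> * moebius_w r \<xi> \<in> {0..1}" if "\<xi> \<in> {0..1}" for \<xi>
    using moebius_facts(3,6)[OF that] by auto
  have contw: "continuous_on {0..1} (\<lambda>\<xi>. \<xi> * moebius_w r \<xi>)"
    using moebius_has_derivative(2) by (intro DERIV_continuous_on) (rule has_field_derivative_at_within)
  have "((\<lambda>\<xi>. ?g' \<xi> *\<^sub>R ?f (?g \<xi>)) has_integral (integral {?g 0..?g 1} ?f - integral {?g 1..?g 0} ?f)) {0..1}"
  \<comment> \<open>The substitution is s = (1 - t)^(\<alpha>+1). For \<alpha> < 0 its derivative in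
    \<xi> is unbounded near 0, so that endpoint is put into the exceptional set.\<close>
  proof (rule has_integral_substitution_general[of "{0}"])
    show "?g ` {0..1} \<subseteq> {0..1}"
    proof safe
      fix \<xi> :: real assume "\<xi> \<in> {0..1}"
      from g01[OF this] \<alpha> show "?g \<xi> \<in> {0..1}" using powr_le1[of "\<alpha> + 1" "\<xi> * moebius_w r \<xi>"] by simp
    qed
    show "continuous_on {0..1} ?g"
      by (rule continuous_on_powr'[OF contw continuous_on_const]) (use g01 \<alpha> in force)
    fix \<xi> :: real assume \<xi>: "\<xi> \<in> {0..1} - {0}"
    have "(?g has_real_derivative ?g' \<xi>) (at \<xi>)"
      using DERIV_chain2[OF has_real_derivative_powr moebius_has_derivative(2)[of \<xi>], of "\<alpha> + 1"]
        \<xi> moebius_facts(4)[of \<xi>] by simp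
    thus "(?g has_real_derivative ?g' \<xi>) (at \<xi> within {0..1})"
      by (rule has_field_derivative_at_within)
  qed (use contf in auto)
  moreover have "moebius_w r 1 = 1" using moebius_facts(2)[of 1] by (simp add: moebius_w_def)
  ultimately have "((\<lambda>\<xi>. ?g' \<xi> *\<^sub>R ?f (?g \<xi>)) has_integral radial_transform \<alpha> F \<omega>) {0..1}"
    using \<alpha> by (simp add: radial_transform_def)
  hence "((\<lambda>\<xi>. ?g' \<xi> *\<^sub>R ?f (?g \<xi>) / of_real (\<alpha> + 1)) has_integral radial_transform \<alpha> F \<omega> / of_real (\<alpha> + 1)) {0..1}"
    by (rule has_integral_divide)
  thus ?thesis
  proof (rule has_integral_eq[rotated])
    fix \<xi> :: real assume \<xi>: "\<xi> \<in> {0..1}"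
    note m = moebius_facts[OF \<xi>]
    have "?g \<xi> powr ?\<beta> = \<xi> * moebius_w r \<xi>"
      using g01[OF \<xi>] \<alpha> by (simp add: powr_powr)
    hence "1 - ?g \<xi> powr ?\<beta> = moebius_t r \<xi>" using m(6) by simp
    moreover have "?g' \<xi> / (\<alpha> + 1) = \<xi> powr \<alpha> * (moebius_w r \<xi> powr (\<alpha> + 1) / (1 - r\<^sup>2 * \<xi>))"
      using m \<xi> \<alpha> by (simp add: powr_mult powr_add)
    ultimately have "of_real (?g' \<xi> / (\<alpha> + 1)) * ?f (?g \<xi>) = of_real (\<xi> powr \<alpha>) * moebius_integrand r \<alpha> \<omega> F \<xi>"
      unfolding moebius_integrand_def by (simp only: of_real_mult mult.assoc)
    moreover have "x *\<^sub>R c / of_real a = of_real (x / a) * c" for x a and c :: complex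
      by (simp add: scaleR_conv_of_real)
    ultimately show "?g' \<xi> *\<^sub>R ?f (?g \<xi>) / of_real (\<alpha> + 1) = of_real (\<xi> powr \<alpha>) * moebius_integrand r \<alpha> \<omega> F \<xi>"
      by (simp only:)
  qed
qed

end

lemma of_real_mult_in_ball:
  fixes w :: complex
  assumes "norm w < 1" "t \<in> {0..1}"
  shows "norm (of_real t * w) < 1"
proof -
  have "\<bar>t\<bar> * norm w \<le> 1 * norm w" using assms by (intro mult_right_mono) auto
  thus ?thesis using assms by (simp add: norm_mult)
qed

lemma disc_potential_eq_integral:
  assumes w: "norm w < 1"
  shows "disc_potential \<alpha> F w =
    cnj w * integral {0..1} (\<lambda>t. of_real ((1 - t * (norm w)\<^sup>2) powr \<alpha>) * F (of_real t * cnj w))"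
proof -
  have "(1 - of_real t * w * cnj w) powr of_real \<alpha> = complex_of_real ((1 - t * (norm w)\<^sup>2) powr \<alpha>)"
    if t: "t \<in> {0..1}" for t
  proof -
    have eq: "1 - of_real t * w * cnj w = complex_of_real (1 - t * (norm w)\<^sup>2)"
      by (simp add: complex_norm_square mult.assoc del: of_real_power)
    have "Re (1 - of_real t * w * cnj w) > 0" using w t by (intro Re_one_minus_pos) auto
    hence "1 - t * (norm w)\<^sup>2 \<ge> 0" unfolding eq by simp
    thus ?thesis unfolding eq by (rule powr_of_real)
  qed
  thus ?thesis
    unfolding disc_potential_def by (intro arg_cong2[of _ _ _ _ "(*)"] refl integral_cong) simp
qed

text \<open>Disc counterpart of y^(\<alpha>+1) |f(cnj z)|, the quantity that the gradient bound
  controls.\<close>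

definition weighted_norm :: "real \<Rightarrow> (complex \<Rightarrow> complex) \<Rightarrow> complex \<Rightarrow> real" where
  "weighted_norm \<alpha> F w = (1 - (norm w)\<^sup>2) powr (\<alpha> + 1) * norm (F (cnj w))"

lemma weighted_norm_nonneg: "weighted_norm \<alpha> F w \<ge> 0"
  by (simp add: weighted_norm_def)

text \<open>With t = \<open>moebius_t\<close>, the power in the integrand has base 1 - t r^2, and t
  \<le> 1 gives 1 - t r^2 \<le> 1 - (t r)^2, the weight at the point t w. So F is sampled with the
  weight under which it is known to be small.\<close>

lemma norm_moebius_integrand_le:
  assumes F: "F holomorphic_on ball 0 1" and \<alpha>: "\<alpha> > -1" and w: "norm w < 1" and \<xi>: "\<xi> \<in> {0..1}"
  shows "norm (moebius_integrand (norm w) \<alpha> (cnj w) F \<xi>) \<le>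
    weighted_norm \<alpha> F (of_real (moebius_t (norm w) \<xi>) * w) / (1 - (norm w)\<^sup>2 * \<xi>)"
proof -
  let ?r = "norm w"
  define T where "T = moebius_t ?r \<xi>"
  note m = moebius_facts[OF norm_ge_zero w \<alpha> F w \<xi>]
  have T: "T \<in> {0..1}" using m by (simp add: T_def)
  have "T * ?r\<^sup>2 \<ge> T * T * ?r\<^sup>2"
    using T by (intro mult_right_mono) (auto simp: mult_left_le)
  hence "moebius_w ?r \<xi> \<le> 1 - (norm (of_real T * w))\<^sup>2"
    using m(3,5) by (simp add: T_def norm_mult power_mult_distrib power2_eq_square mult_ac)
  hence "moebius_w ?r \<xi> powr (\<alpha> + 1) \<le> (1 - (norm (of_real T * w))\<^sup>2) powr (\<alpha> + 1)"
    using m(4) \<alpha> by (intro powr_mono2) auto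
  hence "moebius_w ?r \<xi> powr (\<alpha> + 1) * norm (F (of_real T * cnj w)) \<le> weighted_norm \<alpha> F (of_real T * w)"
    unfolding weighted_norm_def by (simp add: mult_right_mono)
  hence "moebius_w ?r \<xi> powr (\<alpha> + 1) * norm (F (of_real T * cnj w)) / (1 - ?r\<^sup>2 * \<xi>)
      \<le> weighted_norm \<alpha> F (of_real T * w) / (1 - ?r\<^sup>2 * \<xi>)"
    using m(1) by (intro divide_right_mono) auto
  thus ?thesis
    unfolding moebius_integrand_def norm_mult norm_of_real using m(1) by (simp add: T_def)
qed

text \<open>Extended by 0 to the circle, the weighted norm is continuous on the closed disc without
  the point 1. The radii ending at the points of a convergent sequence, together with the radius of
  its limit, form a compact set that avoids 1.\<close>

lemma weighted_norm_bounded: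
  assumes F: "F holomorphic_on ball 0 1" and \<alpha>: "\<alpha> > -1"
    and lim: "\<And>w0. norm w0 = 1 \<Longrightarrow> w0 \<noteq> 1 \<Longrightarrow> (weighted_norm \<alpha> F \<longlongrightarrow> 0) (at w0 within ball 0 1)"
    and W: "W \<longlonglongrightarrow> w0" "\<And>n. norm (W n) < 1" and w0: "norm w0 = 1" "w0 \<noteq> 1"
  obtains K where "K \<ge> 0" "\<And>n t. t \<in> {0..1} \<Longrightarrow> weighted_norm \<alpha> F (of_real t * W n) \<le> K"
proof -
  define \<Phi> where "\<Phi> w = (if norm w < 1 then weighted_norm \<alpha> F w else 0)" for w
  have contF: "continuous_on (ball 0 1) F" using F holomorphic_on_imp_continuous_on by blast
  have "continuous_on (ball 0 1) (weighted_norm \<alpha> F)"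
    unfolding weighted_norm_def[abs_def]
    by (intro continuous_intros continuous_on_compose2[OF contF] continuous_on_powr')
       (use \<alpha> in \<open>auto intro!: continuous_intros simp: power_le_one\<close>)
  hence c1: "isCont (weighted_norm \<alpha> F) w" if "w \<in> ball 0 1" for w
    using that by (simp add: continuous_on_eq_continuous_at)
  have cb: "continuous (at w within cball 0 1) \<Phi>" if w: "norm w \<le> 1" "w \<noteq> 1" for w
  proof (cases "norm w < 1")
    case True
    have "eventually (\<lambda>w. w \<in> ball 0 1) (nhds w)"
      using True by (intro eventually_nhds_in_open) auto
    hence "eventually (\<lambda>w. \<Phi> w = weighted_norm \<alpha> F w) (nhds w)"
      by eventually_elim (simp add: \<Phi>_def)
    hence "isCont \<Phi> w" using c1[of w] True by (simp add: isCont_cong)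
    thus ?thesis by (rule continuous_at_imp_continuous_at_within)
  next
    case False
    with w have nw: "norm w = 1" by simp
    have "(\<Phi> \<longlongrightarrow> 0) (at w within ball 0 1)"
      by (rule Lim_transform_eventually[OF lim[OF nw w(2)]]) (auto simp: eventually_at_filter \<Phi>_def)
    moreover have "(\<Phi> \<longlongrightarrow> 0) (at w within sphere 0 1)"
      by (rule tendsto_eventually) (auto simp: eventually_at_filter \<Phi>_def)
    ultimately have "(\<Phi> \<longlongrightarrow> 0) (at w within ball 0 1 \<union> sphere 0 1)"
      by (simp add: Lim_within_Un)
    moreover have "ball 0 1 \<union> sphere 0 1 = (cball 0 1 :: complex set)" by auto
    ultimately show ?thesis using nw by (simp add: continuous_within \<Phi>_def)
  qed
  have within: "continuous (at w within cball 0 1 - {1}) \<Phi>" if "norm w \<le> 1" "w \<noteq> 1" for w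
    by (rule continuous_within_subset[OF cb[OF that]]) auto
  have cont: "continuous_on (cball 0 1 - {1}) \<Phi>"
    unfolding continuous_on_eq_continuous_within
  proof
    fix w :: complex assume "w \<in> cball 0 1 - {1}"
    thus "continuous (at w within cball 0 1 - {1}) \<Phi>" by (intro within) auto
  qed
  define N where "N = insert w0 (range W)"
  have N: "compact N" unfolding N_def by (rule compact_sequence_with_limit[OF W(1)])
  define P where "P = (\<lambda>(t, w). complex_of_real t * w) ` ({0..1} \<times> N)"
  have "compact P"
    unfolding P_def case_prod_unfold
    by (intro compact_continuous_image compact_Times N compact_Icc continuous_intros)
  have "P \<subseteq> cball 0 1 - {1}"
  proof
    fix v assume "v \<in> P"
    then obtain t w where v: "v = of_real t * w" and t: "0 \<le> t" "t \<le> 1" and w: "w \<in> N"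
      by (auto simp: P_def)
    have nw: "norm w \<le> 1" using w w0 W(2) by (auto simp: N_def intro: less_imp_le)
    have le: "norm v \<le> t" using t nw by (simp add: v norm_mult mult_left_le)
    \<comment> \<open>Modulus 1 forces t = 1, so v would itself be w0 or a member of the
      sequence.\<close>
    moreover have "v \<noteq> 1"
    proof
      assume v1: "v = 1"
      with le t have "t = 1" by simp
      with v v1 have "w = 1" by simp
      with w w0 W(2) show False by (auto simp: N_def) (metis norm_one order_less_irrefl)
    qed
    ultimately show "v \<in> cball 0 1 - {1}" using t by simp
  qed
  hence "compact (\<Phi> ` P)"
    using cont \<open>compact P\<close> by (intro compact_continuous_image) (auto intro: continuous_on_subset)
  then obtain K where "\<forall>x\<in>P. norm (\<Phi> x) \<le> K"
    by (auto dest!: compact_imp_bounded simp: bounded_iff)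
  hence K: "norm (\<Phi> x) \<le> K" if "x \<in> P" for x using that by blast
  show thesis
  proof
    show "max K 0 \<ge> 0" by simp
    fix n and t :: real assume t: "t \<in> {0..1}"
    have "(\<lambda>(t, w). complex_of_real t * w) (t, W n) \<in> P"
      unfolding P_def using t by (intro imageI) (auto simp: N_def)
    hence "of_real t * W n \<in> P" by simp
    from K[OF this] show "weighted_norm \<alpha> F (of_real t * W n) \<le> max K 0"
      using of_real_mult_in_ball[OF W(2) t, of n] by (simp add: \<Phi>_def weighted_norm_nonneg)
  qed
qed

text \<open>Sequences are used because dominated convergence and the compact set of radii both call
  for them. The first limit cancels the potential against the transform; the second says that the
  transform grows more slowly than 1/(1 - |w|), which is needed later for divided
  differences.\<close>

lemma radial_boundary_limits_seq:
  assumes F: "F holomorphic_on ball 0 1" and \<alpha>: "\<alpha> > -1"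
    and lim: "\<And>w0. norm w0 = 1 \<Longrightarrow> w0 \<noteq> 1 \<Longrightarrow> (weighted_norm \<alpha> F \<longlongrightarrow> 0) (at w0 within ball 0 1)"
    and W: "W \<longlonglongrightarrow> w0" "\<And>n. norm (W n) < 1" and w0: "norm w0 = 1" "w0 \<noteq> 1"
  shows "(\<lambda>n. disc_potential \<alpha> F (W n) - cnj (W n) * radial_transform \<alpha> F (cnj (W n)) / of_real (\<alpha> + 1)) \<longlonglongrightarrow> 0"
    and "(\<lambda>n. of_real (1 - norm (W n)) * radial_transform \<alpha> F (cnj (W n))) \<longlonglongrightarrow> 0"
proof -
  obtain K where K: "K \<ge> 0" "\<And>n t. t \<in> {0..1} \<Longrightarrow> weighted_norm \<alpha> F (of_real t * W n) \<le> K"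
    using weighted_norm_bounded[OF F \<alpha> lim W w0] by blast
  obtain m where m: "m \<ge> 0" "\<And>\<xi>. 0 < \<xi> \<Longrightarrow> \<xi> < 1 \<Longrightarrow> \<bar>1 - \<xi> powr \<alpha>\<bar> \<le> m * (1 - \<xi>) * (1 + \<xi> powr \<alpha>)"
    using one_minus_powr_bound[of \<alpha>] by blast
  define r where "r n = norm (W n)" for n
  have r: "0 \<le> r n" "r n < 1" for n using W by (auto simp: r_def)
  have rlim: "r \<longlonglongrightarrow> 1" unfolding r_def using tendsto_norm[OF W(1)] w0 by simp
  define A where "A n = moebius_integrand (r n) \<alpha> (cnj (W n)) F" for n
  define T where "T n = moebius_t (r n)" for n
  have cW: "norm (cnj (W n)) < 1" for n using W(2) by simp
  have I1: "(A n has_integral integral {0..1} (\<lambda>t. of_real ((1 - t * (r n)\<^sup>2) powr \<alpha>) * F (of_real t * cnj (W n)))) {0..1}" for n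
    unfolding A_def by (rule has_integral_moebius_potential[OF r \<alpha> F cW])
  have I2: "((\<lambda>\<xi>. of_real (\<xi> powr \<alpha>) * A n \<xi>) has_integral radial_transform \<alpha> F (cnj (W n)) / of_real (\<alpha> + 1)) {0..1}" for n
    unfolding A_def by (rule has_integral_moebius_radial[OF r \<alpha> F cW])
  have A: "norm (A n \<xi>) \<le> weighted_norm \<alpha> F (of_real (T n \<xi>) * W n) / (1 - (r n)\<^sup>2 * \<xi>)" if "\<xi> \<in> {0..1}" for n \<xi>
    unfolding A_def T_def r_def by (rule norm_moebius_integrand_le[OF F \<alpha> W(2) that])
  have T01: "T n \<xi> \<in> {0..1}" if "\<xi> \<in> {0..1}" for n \<xi>
    unfolding T_def by (rule moebius_facts(3)[OF r \<alpha> F cW that])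
  have den: "1 - \<xi> \<le> 1 - (r n)\<^sup>2 * \<xi>" "1 - r n \<le> 1 - (r n)\<^sup>2 * \<xi>" if "0 < \<xi>" "\<xi> < 1" for n \<xi>
  proof -
    have "(r n)\<^sup>2 \<le> r n" using r[of n] by (simp add: power2_eq_square mult_left_le)
    moreover have "(r n)\<^sup>2 * \<xi> \<le> 1 * \<xi>" "(r n)\<^sup>2 * \<xi> \<le> (r n)\<^sup>2 * 1"
      using that r[of n] by (intro mult_right_mono mult_left_mono; simp add: power_le_one)+
    ultimately show "1 - \<xi> \<le> 1 - (r n)\<^sup>2 * \<xi>" "1 - r n \<le> 1 - (r n)\<^sup>2 * \<xi>" by auto
  qed
  \<comment> \<open>For a fixed \<xi> strictly inside the interval, t tends to 1 as r does, so the
    sampled points run into w0, where the weighted norm tends to 0.\<close>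
  have \<Phi>lim: "(\<lambda>n. weighted_norm \<alpha> F (of_real (T n \<xi>) * W n)) \<longlonglongrightarrow> 0" if \<xi>: "0 < \<xi>" "\<xi> < 1" for \<xi>
  proof -
    have "(\<lambda>n. (1 - \<xi>) / (1 - (r n)\<^sup>2 * \<xi>)) \<longlonglongrightarrow> (1 - \<xi>) / (1 - 1\<^sup>2 * \<xi>)"
      using \<xi> by (intro tendsto_intros rlim) auto
    hence "(\<lambda>n. T n \<xi>) \<longlonglongrightarrow> 1" using \<xi> by (simp add: T_def moebius_t_def)
    hence "(\<lambda>n. of_real (T n \<xi>) * W n) \<longlonglongrightarrow> of_real 1 * w0"
      by (intro tendsto_intros W)
    moreover have "of_real (T n \<xi>) * W n \<in> ball 0 1 - {w0}" for n
    proof -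
      have "norm (of_real (T n \<xi>) * W n) < 1" using of_real_mult_in_ball[OF W(2) T01] \<xi> by simp
      thus ?thesis using w0 by auto
    qed
    ultimately show ?thesis
      using lim[OF w0] unfolding tendsto_at_iff_sequentially by (force simp: o_def)
  qed
  have powr_int: "(\<lambda>\<xi>. \<xi> powr \<alpha>) integrable_on {0<..<1::real}"
    using integrable_on_powr_from_0[of \<alpha> 1] \<alpha> by (simp add: integrable_on_Icc_iff_Ioo)
  have "(\<lambda>\<xi>. 1 :: real) integrable_on {0..1::real}"
    by (rule integrable_const_ivl)
  hence one_int: "(\<lambda>\<xi>. 1 :: real) integrable_on {0<..<1::real}"
    by (simp only: integrable_on_Icc_iff_Ioo)
  have J1: "((\<lambda>\<xi>. of_real (1 - \<xi> powr \<alpha>) * A n \<xi>) has_integral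
      integral {0..1} (\<lambda>t. of_real ((1 - t * (r n)\<^sup>2) powr \<alpha>) * F (of_real t * cnj (W n))) -
      radial_transform \<alpha> F (cnj (W n)) / of_real (\<alpha> + 1)) {0<..<1}" for n
    using has_integral_diff[OF I1 I2, of n n] by (simp add: has_integral_Icc_iff_Ioo left_diff_distrib)
  \<comment> \<open>The kernel 1/(1 - r^2 \<xi>) is at most 1/(1 - \<xi>), which the factor 1 -
    \<xi> inside |1 - \<xi>^\<alpha>| cancels. What remains is dominated by m K (1 +
    \<xi>^\<alpha>), integrable because \<alpha> > -1.\<close>
  have "(\<lambda>n. integral {0<..<1} (\<lambda>\<xi>. of_real (1 - \<xi> powr \<alpha>) * A n \<xi>)) \<longlonglongrightarrow> integral {0<..<1} (\<lambda>\<xi>::real. 0 :: complex)"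
  proof (rule dominated_convergence(2)[where h = "\<lambda>\<xi>. m * K * (1 + \<xi> powr \<alpha>)"])
    show "(\<lambda>\<xi>. of_real (1 - \<xi> powr \<alpha>) * A n \<xi>) integrable_on {0<..<1}" for n
      using J1 by blast
    show "(\<lambda>\<xi>. m * K * (1 + \<xi> powr \<alpha>)) integrable_on {0<..<1}"
      by (intro integrable_on_mult_right integrable_add powr_int one_int)
    have main: "norm (of_real (1 - \<xi> powr \<alpha>) * A n \<xi>) \<le> m * (1 + \<xi> powr \<alpha>) * weighted_norm \<alpha> F (of_real (T n \<xi>) * W n)"
      if \<xi>: "\<xi> \<in> {0<..<1}" for n \<xi>
    proof -
      have "norm (of_real (1 - \<xi> powr \<alpha>) * A n \<xi>) = \<bar>1 - \<xi> powr \<alpha>\<bar> * norm (A n \<xi>)"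
        by (simp only: norm_mult norm_of_real)
      also have "\<dots> \<le> (m * (1 - \<xi>) * (1 + \<xi> powr \<alpha>)) * (weighted_norm \<alpha> F (of_real (T n \<xi>) * W n) / (1 - \<xi>))"
      proof (intro mult_mono m)
        have "norm (A n \<xi>) \<le> weighted_norm \<alpha> F (of_real (T n \<xi>) * W n) / (1 - (r n)\<^sup>2 * \<xi>)"
          using A \<xi> by simp
        also have "\<dots> \<le> weighted_norm \<alpha> F (of_real (T n \<xi>) * W n) / (1 - \<xi>)"
          using den(1)[of \<xi> n] \<xi> by (intro divide_left_mono weighted_norm_nonneg mult_pos_pos; simp; linarith)
        finally show "norm (A n \<xi>) \<le> weighted_norm \<alpha> F (of_real (T n \<xi>) * W n) / (1 - \<xi>)" .
      qed (use \<xi> m in auto)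
      also have "\<dots> = m * (1 + \<xi> powr \<alpha>) * weighted_norm \<alpha> F (of_real (T n \<xi>) * W n)"
        using \<xi> by simp
      finally show ?thesis .
    qed
    fix \<xi> :: real assume \<xi>: "\<xi> \<in> {0<..<1}"
    show "norm (of_real (1 - \<xi> powr \<alpha>) * A n \<xi>) \<le> m * K * (1 + \<xi> powr \<alpha>)" for n
    proof -
      have "m * (1 + \<xi> powr \<alpha>) * weighted_norm \<alpha> F (of_real (T n \<xi>) * W n) \<le> m * (1 + \<xi> powr \<alpha>) * K"
        using m T01[of \<xi> n] \<xi> by (intro mult_left_mono K) auto
      thus ?thesis using main[OF \<xi>, of n] by (simp add: mult_ac)
    qed
    have L: "(\<lambda>n. m * (1 + \<xi> powr \<alpha>) * weighted_norm \<alpha> F (of_real (T n \<xi>) * W n)) \<longlonglongrightarrow> m * (1 + \<xi> powr \<alpha>) * 0"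
      using \<xi> by (intro tendsto_intros \<Phi>lim) auto
    show "(\<lambda>n. of_real (1 - \<xi> powr \<alpha>) * A n \<xi>) \<longlonglongrightarrow> 0"
      by (rule Lim_null_comparison[OF _ L[unfolded mult_zero_right]], rule always_eventually, rule allI, rule main[OF \<xi>])
  qed
  from this[unfolded integral_unique[OF J1]]
  have "(\<lambda>n. integral {0..1} (\<lambda>t. of_real ((1 - t * (r n)\<^sup>2) powr \<alpha>) * F (of_real t * cnj (W n))) -
      radial_transform \<alpha> F (cnj (W n)) / of_real (\<alpha> + 1)) \<longlonglongrightarrow> 0"
    by simp
  from tendsto_mult[OF tendsto_cnj[OF W(1)] this]
  show "(\<lambda>n. disc_potential \<alpha> F (W n) - cnj (W n) * radial_transform \<alpha> F (cnj (W n)) / of_real (\<alpha> + 1)) \<longlonglongrightarrow> 0"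
    using disc_potential_eq_integral[OF W(2)] by (simp add: r_def right_diff_distrib)
  have J2: "((\<lambda>\<xi>. of_real (1 - r n) * (of_real (\<xi> powr \<alpha>) * A n \<xi>)) has_integral
      of_real (1 - r n) * (radial_transform \<alpha> F (cnj (W n)) / of_real (\<alpha> + 1))) {0<..<1}" for n
    using has_integral_mult_right[OF I2[of n], of "of_real (1 - r n)"] by (simp add: has_integral_Icc_iff_Ioo)
  \<comment> \<open>Here no cancellation is available, but (1 - r) / (1 - r^2 \<xi>) is at most 1
    and tends to 0 for every \<xi> < 1.\<close>
  have "(\<lambda>n. integral {0<..<1} (\<lambda>\<xi>. of_real (1 - r n) * (of_real (\<xi> powr \<alpha>) * A n \<xi>))) \<longlonglongrightarrow> integral {0<..<1} (\<lambda>\<xi>::real. 0 :: complex)"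
  proof (rule dominated_convergence(2)[where h = "\<lambda>\<xi>. K * \<xi> powr \<alpha>"])
    show "(\<lambda>\<xi>. of_real (1 - r n) * (of_real (\<xi> powr \<alpha>) * A n \<xi>)) integrable_on {0<..<1}" for n
      using J2 by blast
    show "(\<lambda>\<xi>. K * \<xi> powr \<alpha>) integrable_on {0<..<1}"
      by (intro integrable_on_mult_right powr_int)
    fix \<xi> :: real assume \<xi>: "\<xi> \<in> {0<..<1}"
    hence \<xi>1: "0 < \<xi>" "\<xi> < 1" by auto
    have main: "norm (of_real (1 - r n) * (of_real (\<xi> powr \<alpha>) * A n \<xi>)) \<le> K * \<xi> powr \<alpha> * ((1 - r n) / (1 - (r n)\<^sup>2 * \<xi>))" for n
    proof -
      have "norm (A n \<xi>) \<le> weighted_norm \<alpha> F (of_real (T n \<xi>) * W n) / (1 - (r n)\<^sup>2 * \<xi>)"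
        using A \<xi> by simp
      also have "\<dots> \<le> K / (1 - (r n)\<^sup>2 * \<xi>)"
      proof (intro divide_right_mono K)
        show "T n \<xi> \<in> {0..1}" using T01[of \<xi> n] \<xi> by simp
        show "0 \<le> 1 - (r n)\<^sup>2 * \<xi>" using den(1)[OF \<xi>1, of n] \<xi>1 by linarith
      qed
      finally have "(1 - r n) * (\<xi> powr \<alpha> * norm (A n \<xi>)) \<le> (1 - r n) * (\<xi> powr \<alpha> * (K / (1 - (r n)\<^sup>2 * \<xi>)))"
        using r[of n] by (intro mult_left_mono) auto
      moreover have "norm (of_real (1 - r n) * (of_real (\<xi> powr \<alpha>) * A n \<xi>)) = (1 - r n) * (\<xi> powr \<alpha> * norm (A n \<xi>))"
        using r[of n] by (simp only: norm_mult norm_of_real) simp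
      ultimately show ?thesis by (simp add: mult_ac)
    qed
    show "norm (of_real (1 - r n) * (of_real (\<xi> powr \<alpha>) * A n \<xi>)) \<le> K * \<xi> powr \<alpha>" for n
    proof -
      have "(1 - r n) / (1 - (r n)\<^sup>2 * \<xi>) \<le> 1" using den[OF \<xi>1, of n] \<xi>1 by (subst divide_le_eq_1_pos; linarith)
      hence "K * \<xi> powr \<alpha> * ((1 - r n) / (1 - (r n)\<^sup>2 * \<xi>)) \<le> K * \<xi> powr \<alpha> * 1"
        using K by (intro mult_left_mono) auto
      thus ?thesis using main[of n] by simp
    qed
    have L: "(\<lambda>n. K * \<xi> powr \<alpha> * ((1 - r n) / (1 - (r n)\<^sup>2 * \<xi>))) \<longlonglongrightarrow> K * \<xi> powr \<alpha> * ((1 - 1) / (1 - 1\<^sup>2 * \<xi>))"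
      using \<xi> by (intro tendsto_intros rlim) auto
    show "(\<lambda>n. of_real (1 - r n) * (of_real (\<xi> powr \<alpha>) * A n \<xi>)) \<longlonglongrightarrow> 0"
      by (rule Lim_null_comparison[OF _ L[unfolded diff_self div_0 mult_zero_right]], rule always_eventually, rule allI, rule main)
  qed
  from this[unfolded integral_unique[OF J2]]
  have "(\<lambda>n. of_real (1 - r n) * (radial_transform \<alpha> F (cnj (W n)) / of_real (\<alpha> + 1))) \<longlonglongrightarrow> 0"
    by simp
  from tendsto_mult_right[OF this, of "of_real (\<alpha> + 1)"]
  show "(\<lambda>n. of_real (1 - norm (W n)) * radial_transform \<alpha> F (cnj (W n))) \<longlonglongrightarrow> 0"
    using \<alpha> by (simp add: r_def of_real_eq_iff[of "\<alpha> + 1" 0, simplified])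
qed

lemma radial_boundary_limits:
  assumes F: "F holomorphic_on ball 0 1" and \<alpha>: "\<alpha> > -1"
    and lim: "\<And>w0. norm w0 = 1 \<Longrightarrow> w0 \<noteq> 1 \<Longrightarrow> (weighted_norm \<alpha> F \<longlongrightarrow> 0) (at w0 within ball 0 1)"
    and w0: "norm w0 = 1" "w0 \<noteq> 1"
  shows "((\<lambda>w. disc_potential \<alpha> F w - cnj w * radial_transform \<alpha> F (cnj w) / of_real (\<alpha> + 1)) \<longlongrightarrow> 0) (at w0 within ball 0 1)"
    and "((\<lambda>w. of_real (1 - norm w) * radial_transform \<alpha> F (cnj w)) \<longlongrightarrow> 0) (at w0 within ball 0 1)"
  unfolding tendsto_at_iff_sequentially o_def
  using radial_boundary_limits_seq[OF F \<alpha> lim _ _ w0] by auto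

section \<open>The radial transform\<close>

text \<open>The beta integral (\<alpha>+1) B(k+1, \<alpha>+1) = k! / (\<alpha>+2)_k in the variable
  s; it is the multiplier by which the transform acts on the k-th Taylor coefficient.\<close>

definition radial_moment :: "real \<Rightarrow> nat \<Rightarrow> real" where
  "radial_moment \<alpha> k = integral {0..1} (\<lambda>s. (1 - s powr (1 / (\<alpha> + 1))) ^ k)"

lemma continuous_on_one_minus_powr:
  assumes "\<alpha> > -1"
  shows "continuous_on {0..1} (\<lambda>s::real. 1 - s powr (1 / (\<alpha> + 1)))"
  by (intro continuous_on_diff continuous_on_powr' continuous_on_const continuous_on_id) (use assms in auto)

lemma one_minus_powr_in_01:
  fixes \<alpha> s :: real
  assumes "\<alpha> > -1" "s \<in> {0..1}"
  shows "1 - s powr (1 / (\<alpha> + 1)) \<in> {0..1}"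
  using assms powr_le1[of "1 / (\<alpha> + 1)" s] by auto

lemma radial_moment_has_integral:
  assumes "\<alpha> > -1"
  shows "((\<lambda>s. (1 - s powr (1 / (\<alpha> + 1))) ^ k) has_integral radial_moment \<alpha> k) {0..1}"
  unfolding radial_moment_def
  by (intro integrable_integral integrable_continuous_interval continuous_on_power continuous_on_one_minus_powr assms)

text \<open>With x = 1 - s^\<beta>, integrate the derivative of s x^(k+1), which vanishes at both
  ends, and replace s^\<beta> by 1 - x. The interior form of the fundamental theorem is used since
  s^\<beta> need not be differentiable at 0.\<close>

lemma radial_moment_Suc:
  assumes \<alpha>: "\<alpha> > -1"
  shows "(\<alpha> + 2 + real k) * radial_moment \<alpha> (Suc k) = real (Suc k) * radial_moment \<alpha> k"
proof -
  define \<beta> where "\<beta> = 1 / (\<alpha> + 1)"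
  have \<beta>: "\<beta> > 0" using \<alpha> by (simp add: \<beta>_def)
  let ?x = "\<lambda>s. 1 - s powr \<beta>"
  let ?G = "\<lambda>s. s * ?x s ^ Suc k"
  let ?g = "\<lambda>s. (1 + real (Suc k) * \<beta>) * ?x s ^ Suc k - real (Suc k) * \<beta> * ?x s ^ k"
  have g1: "(?g has_integral (?G 1 - ?G 0)) {0..1}"
  proof (rule fundamental_theorem_of_calculus_interior)
    show "continuous_on {0..1} ?G"
      using continuous_on_one_minus_powr[OF \<alpha>] unfolding \<beta>_def
      by (intro continuous_on_mult continuous_on_power continuous_on_id)
    fix s :: real assume s: "s \<in> {0<..<1}"
    have "((\<lambda>s. s powr \<beta>) has_real_derivative \<beta> * s powr (\<beta> - 1)) (at s)"
      using s by (intro has_real_derivative_powr) auto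
    hence "(?x has_real_derivative (0 - \<beta> * s powr (\<beta> - 1))) (at s)"
      by (intro DERIV_diff DERIV_const)
    from DERIV_mult[OF DERIV_ident DERIV_power[OF this, of "Suc k"]]
    have "(?G has_real_derivative 1 * ?x s ^ Suc k + (real (Suc k) * ((0 - \<beta> * s powr (\<beta> - 1)) * ?x s ^ k)) * s) (at s)"
      by simp
    moreover have P: "s powr (\<beta> - 1) * s = s powr \<beta>" using s by (simp add: powr_diff)
    have "1 * X + (m * ((0 - \<beta> * p) * Y)) * s = X - m * \<beta> * Y * (p * s)" for X m p Y
      by (simp add: algebra_simps)
    hence "1 * ?x s ^ Suc k + (real (Suc k) * ((0 - \<beta> * s powr (\<beta> - 1)) * ?x s ^ k)) * s
        = ?x s ^ Suc k - real (Suc k) * \<beta> * ?x s ^ k * s powr \<beta>"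
      by (simp only: P)
    moreover have "\<dots> = ?g s" by (simp add: algebra_simps)
    ultimately show "(?G has_vector_derivative ?g s) (at s)"
      by (simp only: has_real_derivative_iff_has_vector_derivative)
  qed auto
  have g2: "(?g has_integral (1 + real (Suc k) * \<beta>) * radial_moment \<alpha> (Suc k) - real (Suc k) * \<beta> * radial_moment \<alpha> k) {0..1}"
    using radial_moment_has_integral[OF \<alpha>] unfolding \<beta>_def
    by (intro has_integral_diff has_integral_mult_right)
  from has_integral_unique[OF g2 g1]
  have "(1 + real (Suc k) * \<beta>) * radial_moment \<alpha> (Suc k) - real (Suc k) * \<beta> * radial_moment \<alpha> k = 0"
    by simp
  hence "(\<alpha> + 1) * ((1 + real (Suc k) * \<beta>) * radial_moment \<alpha> (Suc k)) = (\<alpha> + 1) * (real (Suc k) * \<beta> * radial_moment \<alpha> k)"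
    by simp
  moreover have "(\<alpha> + 1) * ((1 + m * \<beta>) * R) = (\<alpha> + 1 + m * ((\<alpha> + 1) * \<beta>)) * R"
    "(\<alpha> + 1) * (m * \<beta> * R) = m * ((\<alpha> + 1) * \<beta>) * R" for m R
    by (simp_all add: algebra_simps)
  moreover have "(\<alpha> + 1) * \<beta> = 1" using \<alpha> by (simp add: \<beta>_def)
  ultimately have "(\<alpha> + 1 + real (Suc k)) * radial_moment \<alpha> (Suc k) = real (Suc k) * radial_moment \<alpha> k"
    by (simp only: mult_1_right)
  thus ?thesis by (simp add: add.assoc)
qed

lemma radial_moment_0: "\<alpha> > -1 \<Longrightarrow> radial_moment \<alpha> 0 = 1"
  by (simp add: radial_moment_def)

lemma radial_moment_pos:
  assumes \<alpha>: "\<alpha> > -1"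
  shows "radial_moment \<alpha> k > 0"
proof (induction k)
  case (Suc k)
  have "(\<alpha> + 2 + real k) * radial_moment \<alpha> (Suc k) > 0"
    unfolding radial_moment_Suc[OF \<alpha>] using Suc by simp
  thus ?case using \<alpha> by (simp add: zero_less_mult_iff)
qed (use radial_moment_0[OF \<alpha>] in simp)

text \<open>Precisely the identity that converts the binomial coefficients of (1 -
  \<omega>)^(-(\<alpha>+2+j)) into those of (1 - \<omega>)^(-(j+1)).\<close>

lemma radial_moment_pochhammer:
  assumes \<alpha>: "\<alpha> > -1"
  shows "radial_moment \<alpha> (j + n) * pochhammer (\<alpha> + 2 + real j) n = radial_moment \<alpha> j * pochhammer (real j + 1) n"
proof (induction n)
  case (Suc n)
  have "radial_moment \<alpha> (j + Suc n) * pochhammer (\<alpha> + 2 + real j) (Suc n) =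
      ((\<alpha> + 2 + real (j + n)) * radial_moment \<alpha> (Suc (j + n))) * pochhammer (\<alpha> + 2 + real j) n"
    by (simp add: pochhammer_Suc algebra_simps)
  also have "\<dots> = real (Suc (j + n)) * (radial_moment \<alpha> (j + n) * pochhammer (\<alpha> + 2 + real j) n)"
    unfolding radial_moment_Suc[OF \<alpha>] by simp
  also have "\<dots> = radial_moment \<alpha> j * pochhammer (real j + 1) (Suc n)"
    unfolding Suc by (simp add: pochhammer_Suc algebra_simps)
  finally show ?case .
qed simp

lemma radial_transform_sums:
  assumes \<alpha>: "\<alpha> > -1" and F: "\<And>\<omega>. norm \<omega> < 1 \<Longrightarrow> (\<lambda>k. b k * \<omega> ^ k) sums F \<omega>"
    and \<omega>: "norm \<omega> < 1"
  shows "(\<lambda>k. of_real (radial_moment \<alpha> k) * b k * \<omega> ^ k) sums radial_transform \<alpha> F \<omega>"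
proof -
  let ?x = "\<lambda>s. 1 - s powr (1 / (\<alpha> + 1))"
  define g where "g k s = b k * (of_real (?x s) * \<omega>) ^ k" for k and s :: real
  \<comment> \<open>Convergence at a point of larger modulus gives absolute convergence at \<omega>,
    hence the majorant for integrating term by term.\<close>
  obtain \<rho> where \<rho>: "norm \<omega> < \<rho>" "\<rho> < 1" using dense \<omega> by blast
  have "summable (\<lambda>k. b k * of_real \<rho> ^ k)"
    using F[of "of_real \<rho>"] \<rho> norm_ge_zero[of \<omega>] by (auto simp: sums_iff)
  hence summ: "summable (\<lambda>k. norm (b k * \<omega> ^ k))"
    by (rule powser_insidea) (use \<rho> norm_ge_zero[of \<omega>] in auto)
  have "uniform_limit {0..1} (\<lambda>n s. \<Sum>k<n. g k s) (\<lambda>s. \<Sum>k. g k s) sequentially"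
  proof (rule Weierstrass_m_test[OF _ summ])
    fix k and s :: real assume s: "s \<in> {0..1}"
    note x = one_minus_powr_in_01[OF \<alpha> s]
    have "norm (g k s) = \<bar>?x s\<bar> ^ k * norm (b k * \<omega> ^ k)"
      unfolding g_def power_mult_distrib norm_mult norm_power norm_of_real by (simp only: mult_ac)
    also have "\<dots> \<le> 1 * norm (b k * \<omega> ^ k)" using x by (intro mult_right_mono power_le_one) auto
    finally show "norm (g k s) \<le> norm (b k * \<omega> ^ k)" by simp
  qed
  moreover have "(\<Sum>k. g k s) = F (of_real (?x s) * \<omega>)" if "s \<in> {0..1}" for s
    unfolding g_def using F[OF of_real_mult_in_ball[OF \<omega> one_minus_powr_in_01[OF \<alpha> that]]] by (simp add: sums_iff)
  ultimately have "uniform_limit {0..1} (\<lambda>n s. \<Sum>k<n. g k s) (\<lambda>s. F (of_real (?x s) * \<omega>)) sequentially"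
    by (subst (asm) uniform_limit_cong'[where g = "\<lambda>n s. \<Sum>k<n. g k s" and i = "\<lambda>s. F (of_real (?x s) * \<omega>)"]) auto
  then obtain I J where IJ: "\<And>n. ((\<lambda>s. \<Sum>k<n. g k s) has_integral I n) {0..1}"
    "((\<lambda>s. F (of_real (?x s) * \<omega>)) has_integral J) {0..1}" "I \<longlonglongrightarrow> J"
    by (rule uniform_limit_integral)
       (use \<alpha> in \<open>auto simp: g_def intro!: continuous_intros continuous_on_powr'\<close>)
  have "(g k has_integral of_real (radial_moment \<alpha> k) * b k * \<omega> ^ k) {0..1}" for k
  proof -
    have "((\<lambda>s. complex_of_real (?x s ^ k)) has_integral of_real (radial_moment \<alpha> k)) {0..1}"
      using has_integral_linear[OF radial_moment_has_integral[OF \<alpha>] bounded_linear_of_real[where ?'a = complex]]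
      by (simp add: o_def)
    from has_integral_mult_left[OF this, of "b k * \<omega> ^ k"] show ?thesis
      by (simp add: g_def[abs_def] power_mult_distrib mult_ac)
  qed
  hence "((\<lambda>s. \<Sum>k<n. g k s) has_integral (\<Sum>k<n. of_real (radial_moment \<alpha> k) * b k * \<omega> ^ k)) {0..1}" for n
    by (intro has_integral_sum) auto
  hence "I n = (\<Sum>k<n. of_real (radial_moment \<alpha> k) * b k * \<omega> ^ k)" for n
    using IJ(1) has_integral_unique by blast
  hence "I = (\<lambda>n. \<Sum>k<n. of_real (radial_moment \<alpha> k) * b k * \<omega> ^ k)" ..
  with IJ(3) have "(\<lambda>k. of_real (radial_moment \<alpha> k) * b k * \<omega> ^ k) sums J"
    by (simp add: sums_def)
  thus ?thesis using IJ(2) by (simp add: radial_transform_def integral_unique)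
qed

text \<open>The transform multiplies Taylor coefficients by the moments, which are positive, so a
  vanishing transform forces vanishing coefficients.\<close>

lemma radial_transform_inj:
  assumes \<alpha>: "\<alpha> > -1" and F: "F holomorphic_on ball 0 1"
    and zero: "\<And>\<omega>. norm \<omega> < 1 \<Longrightarrow> radial_transform \<alpha> F \<omega> = 0" and \<omega>: "norm \<omega> < 1"
  shows "F \<omega> = 0"
proof -
  define b where "b k = (deriv ^^ k) F 0 / fact k" for k
  have b: "(\<lambda>k. b k * \<omega> ^ k) sums F \<omega>" if "norm \<omega> < 1" for \<omega>
    using holomorphic_power_series[OF F, of \<omega>] that by (simp add: b_def)
  define a where "a k = of_real (radial_moment \<alpha> k) * b k" for k
  have a: "(\<lambda>k. a k * (\<omega> - 0) ^ k) sums 0" if "norm (\<omega> - 0) < 1" for \<omega>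
    using radial_transform_sums[OF \<alpha> b, of \<omega>] zero[of \<omega>] that by (simp add: a_def)
  have "a k = 0" for k
  proof (rule ccontr)
    assume ne: "a k \<noteq> 0"
    \<comment> \<open>The library fact on isolated zeros of power series speaks of a nonzero
      coefficient of positive index; index 0 is the value at the centre.\<close>
    have "k \<noteq> 0" using a[of 0] ne by (auto intro: ccontr)
    then obtain s where "s > 0" "\<And>z. z \<in> cball 0 s - {0 :: complex} \<Longrightarrow> (0::complex) \<noteq> 0"
      using powser_0_nonzero[of 1 0 a "\<lambda>_. 0" k] a ne by auto
    from this(2)[of "of_real s"] this(1) show False by simp
  qed
  moreover have "radial_moment \<alpha> k \<noteq> 0" for k
    using radial_moment_pos[OF \<alpha>, of k] by simp
  ultimately have "b k = 0" for k
    by (simp add: a_def)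
  thus ?thesis using b[OF \<omega>] by (simp add: sums_iff)
qed

section \<open>The radial transform on binomial series and its inversion\<close>

lemma one_minus_powr_sums:
  fixes a \<omega> :: complex
  assumes "norm \<omega> < 1"
  shows "(\<lambda>n. pochhammer a n / fact n * \<omega> ^ n) sums (1 - \<omega>) powr (- a)"
proof -
  have "(\<lambda>n. (- a gchoose n) * (- \<omega>) ^ n) sums (1 + - \<omega>) powr (- a)"
    by (rule gen_binomial_complex) (use assms in simp)
  moreover have "(- a gchoose n) * (- \<omega>) ^ n = pochhammer a n / fact n * \<omega> ^ n" for n
  proof -
    have "(- 1) ^ n * (- \<omega>) ^ n = \<omega> ^ n" by (simp flip: power_mult_distrib)
    thus ?thesis by (simp add: gbinomial_pochhammer mult_ac)
  qed
  ultimately show ?thesis by simp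
qed

lemma radial_transform_basis:
  assumes \<alpha>: "\<alpha> > -1" and \<omega>: "norm \<omega> < 1"
  shows "radial_transform \<alpha> (\<lambda>\<omega>. \<omega> ^ j * (1 - \<omega>) powr (- (of_real \<alpha> + 2 + of_nat j))) \<omega> =
     of_real (radial_moment \<alpha> j) * (\<omega> ^ j * (1 - \<omega>) powr (- (of_nat j + 1)))"
proof -
  define b :: "nat \<Rightarrow> complex" where
    "b k = (if k < j then 0 else pochhammer (of_real \<alpha> + 2 + of_nat j) (k - j) / fact (k - j))" for k
  have shift: "(\<lambda>k. c k * \<omega> ^ k) sums (\<omega> ^ j * s)"
    if "\<And>n. c (n + j) = d n" "\<And>k. k < j \<Longrightarrow> c k = 0" "(\<lambda>n. d n * \<omega> ^ n) sums s"
    for c d :: "nat \<Rightarrow> complex" and \<omega> s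
  proof -
    have "(\<lambda>n. c (n + j) * \<omega> ^ (n + j)) sums (\<omega> ^ j * s)"
      using sums_mult[OF that(3), of "\<omega> ^ j"] by (simp add: that(1) power_add mult_ac)
    from sums_iff_shift[THEN iffD1, OF this] show ?thesis by (simp add: that(2))
  qed
  have b: "(\<lambda>k. b k * \<omega> ^ k) sums (\<omega> ^ j * (1 - \<omega>) powr (- (of_real \<alpha> + 2 + of_nat j)))"
    if "norm \<omega> < 1" for \<omega>
    by (rule shift[OF _ _ one_minus_powr_sums[OF that]]) (simp_all add: b_def)
  have "(\<lambda>k. of_real (radial_moment \<alpha> k) * b k * \<omega> ^ k) sums
      radial_transform \<alpha> (\<lambda>\<omega>. \<omega> ^ j * (1 - \<omega>) powr (- (of_real \<alpha> + 2 + of_nat j))) \<omega>"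
    by (rule radial_transform_sums[OF \<alpha> b \<omega>])
  moreover have "(\<lambda>k. of_real (radial_moment \<alpha> k) * b k * \<omega> ^ k) sums
     (\<omega> ^ j * (of_real (radial_moment \<alpha> j) * (1 - \<omega>) powr (- (of_nat j + 1))))"
  proof (rule shift[where d = "\<lambda>n. of_real (radial_moment \<alpha> j) * (pochhammer (of_nat j + 1) n / fact n)"])
    fix n
    have "complex_of_real (radial_moment \<alpha> (j + n) * pochhammer (\<alpha> + 2 + real j) n) =
        of_real (radial_moment \<alpha> j * pochhammer (real j + 1) n)"
      by (simp only: radial_moment_pochhammer[OF \<alpha>])
    thus "of_real (radial_moment \<alpha> (n + j)) * b (n + j) =
        of_real (radial_moment \<alpha> j) * (pochhammer (of_nat j + 1) n / fact n)"
      by (simp add: b_def pochhammer_of_real[symmetric] add.commute[of n j])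
  next
    show "(\<lambda>n. of_real (radial_moment \<alpha> j) * (pochhammer (of_nat j + 1) n / fact n) * \<omega> ^ n) sums
        (of_real (radial_moment \<alpha> j) * (1 - \<omega>) powr (- (of_nat j + 1)))"
      using sums_mult[OF one_minus_powr_sums[OF \<omega>, of "of_nat j + 1"], of "of_real (radial_moment \<alpha> j)"]
      by (simp add: mult.assoc)
  qed (simp add: b_def)
  ultimately show ?thesis
    using sums_unique2 by (fastforce simp: mult_ac)
qed

lemma radial_transform_has_integral:
  assumes \<alpha>: "\<alpha> > -1" and F: "F holomorphic_on ball 0 1" and \<omega>: "norm \<omega> < 1"
  shows "((\<lambda>s. F (of_real (1 - s powr (1 / (\<alpha> + 1))) * \<omega>)) has_integral radial_transform \<alpha> F \<omega>) {0..1}"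
  unfolding radial_transform_def
proof (intro integrable_integral integrable_continuous_interval continuous_on_compose2[OF holomorphic_on_imp_continuous_on[OF F]])
  show "continuous_on {0..1} (\<lambda>s. complex_of_real (1 - s powr (1 / (\<alpha> + 1))) * \<omega>)"
    by (intro continuous_on_mult continuous_on_of_real continuous_on_one_minus_powr \<alpha> continuous_on_const)
  show "(\<lambda>s. complex_of_real (1 - s powr (1 / (\<alpha> + 1))) * \<omega>) ` {0..1} \<subseteq> ball 0 1"
    using of_real_mult_in_ball[OF \<omega> one_minus_powr_in_01[OF \<alpha>]] by (auto simp del: of_real_diff)
qed

text \<open>The function \<open>B j\<close> is carried to a moment times (\<omega>/(1-\<omega>))^j /
  (1-\<omega>). Dividing the coefficients of the given polynomial by the moments yields a
  combination G with the same transform as F, and injectivity gives F = G.\<close>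

lemma radial_transform_polynomial_imp:
  assumes \<alpha>: "\<alpha> > -1" and F: "F holomorphic_on ball 0 1"
    and q: "\<And>\<omega>. norm \<omega> < 1 \<Longrightarrow> \<omega> * radial_transform \<alpha> F \<omega> = poly q (\<omega> / (1 - \<omega>))"
  obtains p where "\<And>\<omega>. norm \<omega> < 1 \<Longrightarrow> F \<omega> = (1 - \<omega>) powr (- of_real \<alpha> - 2) * poly p (\<omega> / (1 - \<omega>))"
proof -
  obtain q0 q2 where q02: "q = pCons q0 q2" by (cases q)
  \<comment> \<open>The left side vanishes at \<omega> = 0, so q is divisible by its variable; the
    quotient q2 accounts for the transform without the factor \<omega>.\<close>
  have "q0 = 0" using q[of 0] by (simp add: q02)
  define t where "t j = coeff q2 j / of_real (radial_moment \<alpha> j)" for j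
  define d where "d = degree q2"
  define B where "B j \<omega> = \<omega> ^ j * (1 - \<omega>) powr (- (of_real \<alpha> + 2 + of_nat j))" for j and \<omega> :: complex
  have nz: "1 - \<omega> \<noteq> 0" if "norm \<omega> < 1" for \<omega> :: complex using that by auto
  have Bhol: "B j holomorphic_on ball 0 1" for j
    unfolding B_def[abs_def]
  proof (intro holomorphic_intros)
    fix \<omega> :: complex assume "\<omega> \<in> ball 0 1"
    thus "1 - \<omega> \<notin> \<real>\<^sub>\<le>\<^sub>0" using Re_one_minus_gt_0[of \<omega>] by (auto simp: complex_nonpos_Reals_iff)
  qed
  define G where "G \<omega> = (\<Sum>j\<le>d. t j * B j \<omega>)" for \<omega>
  have FG: "(\<lambda>\<omega>. F \<omega> - G \<omega>) holomorphic_on ball 0 1"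
    unfolding G_def by (intro holomorphic_intros F Bhol)
  have RB: "radial_transform \<alpha> (B j) \<omega> = of_real (radial_moment \<alpha> j) * (\<omega> ^ j / (1 - \<omega>) ^ Suc j)"
    if "norm \<omega> < 1" for j \<omega>
  proof -
    have "(1 - \<omega>) powr (- (of_nat j + 1)) = inverse ((1 - \<omega>) powr (of_nat (Suc j)))"
      by (simp only: powr_minus of_nat_Suc add.commute)
    also have "\<dots> = inverse ((1 - \<omega>) ^ Suc j)"
      by (subst powr_complexpow) (rule nz[OF that], rule refl)
    finally show ?thesis
      using radial_transform_basis[OF \<alpha> that, of j] by (simp only: B_def[abs_def] divide_inverse)
  qed
  have zero: "radial_transform \<alpha> (\<lambda>\<omega>. F \<omega> - G \<omega>) \<omega> = 0" if \<omega>: "norm \<omega> < 1" "\<omega> \<noteq> 0" for \<omega>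
  proof -
    have "((\<lambda>s. F (of_real (1 - s powr (1 / (\<alpha> + 1))) * \<omega>) - G (of_real (1 - s powr (1 / (\<alpha> + 1))) * \<omega>))
      has_integral radial_transform \<alpha> F \<omega> - (\<Sum>j\<le>d. t j * radial_transform \<alpha> (B j) \<omega>)) {0..1}"
      unfolding G_def
      by (intro has_integral_diff has_integral_sum has_integral_mult_right radial_transform_has_integral \<alpha> F Bhol \<omega>) auto
    hence "radial_transform \<alpha> (\<lambda>\<omega>. F \<omega> - G \<omega>) \<omega> = radial_transform \<alpha> F \<omega> - (\<Sum>j\<le>d. t j * radial_transform \<alpha> (B j) \<omega>)"
      by (simp only: radial_transform_def integral_unique)
    also have "(\<Sum>j\<le>d. t j * radial_transform \<alpha> (B j) \<omega>) = (\<Sum>j\<le>d. coeff q2 j * (\<omega> / (1 - \<omega>)) ^ j) / (1 - \<omega>)"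
      unfolding sum_divide_distrib
    proof (intro sum.cong refl)
      fix j
      have "complex_of_real (radial_moment \<alpha> j) \<noteq> 0" using radial_moment_pos[OF \<alpha>, of j] by simp
      thus "t j * radial_transform \<alpha> (B j) \<omega> = coeff q2 j * (\<omega> / (1 - \<omega>)) ^ j / (1 - \<omega>)"
        unfolding RB[OF \<omega>(1)] t_def by (simp add: power_divide field_simps)
    qed
    also have "(\<Sum>j\<le>d. coeff q2 j * (\<omega> / (1 - \<omega>)) ^ j) = poly q2 (\<omega> / (1 - \<omega>))"
      by (simp add: poly_altdef d_def)
    also have "radial_transform \<alpha> F \<omega> = poly q2 (\<omega> / (1 - \<omega>)) / (1 - \<omega>)"
    proof -
      have "\<omega> * radial_transform \<alpha> F \<omega> = \<omega> * (poly q2 (\<omega> / (1 - \<omega>)) / (1 - \<omega>))"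
        using q[OF \<omega>(1)] by (simp add: q02 \<open>q0 = 0\<close>)
      thus ?thesis by (rule mult_left_cancel[OF \<omega>(2), THEN iffD1])
    qed
    finally show ?thesis by simp
  qed
  \<comment> \<open>The cancellation of \<omega> was possible only off the centre; continuity
    supplies the value there.\<close>
  have "radial_transform \<alpha> (\<lambda>\<omega>. F \<omega> - G \<omega>) 0 = 0"
  proof -
    have "continuous_on (ball 0 1) (radial_transform \<alpha> (\<lambda>\<omega>. F \<omega> - G \<omega>))"
      by (intro holomorphic_on_imp_continuous_on radial_transform_holomorphic \<alpha> FG)
    hence "isCont (radial_transform \<alpha> (\<lambda>\<omega>. F \<omega> - G \<omega>)) 0"
      by (simp add: continuous_on_eq_continuous_at)
    moreover have "eventually (\<lambda>\<omega>::complex. \<omega> \<in> ball 0 1 \<and> \<omega> \<noteq> 0) (at 0)"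
      using eventually_at_ball[of 1 "0::complex" UNIV] by (auto simp: eventually_at_filter)
    hence "eventually (\<lambda>\<omega>. radial_transform \<alpha> (\<lambda>\<omega>. F \<omega> - G \<omega>) \<omega> = 0) (at 0)"
      by eventually_elim (rule zero, auto)
    hence "(radial_transform \<alpha> (\<lambda>\<omega>. F \<omega> - G \<omega>) \<longlongrightarrow> 0) (at 0)"
      by (rule tendsto_eventually)
    ultimately show ?thesis
      by (intro tendsto_unique[OF _ _ \<open>(_ \<longlongrightarrow> 0) (at 0)\<close>]) (auto simp: isCont_def)
  qed
  with zero have all0: "radial_transform \<alpha> (\<lambda>\<omega>. F \<omega> - G \<omega>) \<omega> = 0" if "norm \<omega> < 1" for \<omega>
    using that by (cases "\<omega> = 0") auto
  show thesis
  proof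
    fix \<omega> :: complex assume \<omega>: "norm \<omega> < 1"
    have "F \<omega> = G \<omega>" using radial_transform_inj[OF \<alpha> FG all0 \<omega>] by simp
    also have "\<dots> = (\<Sum>j\<le>d. (1 - \<omega>) powr (- of_real \<alpha> - 2) * (t j * (\<omega> / (1 - \<omega>)) ^ j))"
      unfolding G_def
    proof (intro sum.cong refl)
      fix j
      have "(1 - \<omega>) powr (- (of_real \<alpha> + 2 + of_nat j)) = (1 - \<omega>) powr ((- of_real \<alpha> - 2) - of_nat j)"
        by (rule arg_cong[of _ _ "\<lambda>e. (1 - \<omega>) powr e"]) simp
      also have "\<dots> = (1 - \<omega>) powr (- of_real \<alpha> - 2) / (1 - \<omega>) ^ j"
        using nz[OF \<omega>] by (subst powr_diff) simp
      finally show "t j * B j \<omega> = (1 - \<omega>) powr (- of_real \<alpha> - 2) * (t j * (\<omega> / (1 - \<omega>)) ^ j)"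
        by (simp add: B_def power_divide)
    qed
    also have "\<dots> = (1 - \<omega>) powr (- of_real \<alpha> - 2) * poly (\<Sum>j\<le>d. monom (t j) j) (\<omega> / (1 - \<omega>))"
      by (simp add: poly_sum poly_monom sum_distrib_left)
    finally show "F \<omega> = (1 - \<omega>) powr (- of_real \<alpha> - 2) * poly (\<Sum>j\<le>d. monom (t j) j) (\<omega> / (1 - \<omega>))" .
  qed
qed


text \<open>Because \<alpha> > -1, the weight is at most 1/(1 - |w|), so the potential costs just
  one more power than F.\<close>

lemma disc_potential_bound:
  assumes \<alpha>: "\<alpha> > -1" and F: "F holomorphic_on ball 0 1"
    and bound: "\<And>\<omega>. norm \<omega> < 1 \<Longrightarrow> norm (F \<omega>) \<le> K * (1 / (1 - norm \<omega>)) ^ M"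
    and w: "norm w < 1"
  shows "norm (disc_potential \<alpha> F w) \<le> K * (1 / (1 - norm w)) ^ Suc M"
proof -
  define s where "s = 1 / (1 - norm w)"
  have s: "s \<ge> 1" using w by (simp add: s_def)
  have K: "K \<ge> 0" using order.trans[OF norm_ge_zero bound[of 0]] by simp
  have le1: "t * (norm w)\<^sup>2 \<le> norm w" if "t \<in> {0..1}" for t
  proof -
    have "t * (norm w)\<^sup>2 \<le> 1 * (norm w)\<^sup>2" using that by (intro mult_right_mono) auto
    also have "\<dots> \<le> norm w" using w by (simp add: power2_eq_square mult_left_le)
    finally show ?thesis .
  qed
  let ?f = "\<lambda>t. complex_of_real ((1 - t * (norm w)\<^sup>2) powr \<alpha>) * F (of_real t * cnj w)"
  have cw: "norm (cnj w) < 1" using w by simp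
  have "(?f has_integral integral {0..1} ?f) {0..1}"
  proof (intro integrable_integral integrable_continuous_interval continuous_on_mult continuous_on_radius[of 0 \<alpha>])
    show "continuous_on {0..1} (\<lambda>t. complex_of_real ((1 - t * (norm w)\<^sup>2) powr \<alpha>))"
      using le1 w by (intro continuous_intros) force
  qed (use F cw \<alpha> in auto)
  hence hi: "(?f has_integral integral {0..1} ?f) (cbox 0 1)"
    by (simp only: cbox_interval)
  have "norm (integral {0..1} ?f) \<le> (s * (K * s ^ M)) * measure lborel (cbox (0::real) 1)"
  proof (rule has_integral_bound[OF _ hi])
    show "0 \<le> s * (K * s ^ M)" using s K by simp
    fix t :: real assume "t \<in> cbox 0 1"
    hence t: "t \<in> {0..1}" by simp
    have pos: "1 - t * (norm w)\<^sup>2 \<ge> 1 - norm w" using le1[OF t] by simp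
    have "(1 - t * (norm w)\<^sup>2) powr \<alpha> \<le> s"
    proof (cases "\<alpha> \<ge> 0")
      case True
      hence "(1 - t * (norm w)\<^sup>2) powr \<alpha> \<le> 1" using pos w t by (intro powr_le1) auto
      thus ?thesis using s by simp
    next
      case False
      have "(1 - t * (norm w)\<^sup>2) powr \<alpha> \<le> (1 - t * (norm w)\<^sup>2) powr (-1)"
        using \<alpha> pos w t by (intro powr_mono') auto
      also have "\<dots> = 1 / (1 - t * (norm w)\<^sup>2)" using pos w by (simp add: powr_minus_divide)
      also have "\<dots> \<le> s" unfolding s_def using pos w by (intro divide_left_mono mult_pos_pos) auto
      finally show ?thesis .
    qed
    moreover have "norm (F (of_real t * cnj w)) \<le> K * s ^ M"
    proof -
      have "norm (of_real t * cnj w) \<le> norm w" using t by (simp add: norm_mult mult_left_le_one_le)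
      hence "1 / (1 - norm (of_real t * cnj w)) \<le> s"
        unfolding s_def using w by (intro divide_left_mono mult_pos_pos) auto
      hence "K * (1 / (1 - norm (of_real t * cnj w))) ^ M \<le> K * s ^ M"
        using K of_real_mult_in_ball[OF cw t] by (intro mult_left_mono power_mono) auto
      thus ?thesis using bound[OF of_real_mult_in_ball[OF cw t]] by linarith
    qed
    ultimately show "norm (?f t) \<le> s * (K * s ^ M)"
      unfolding norm_mult norm_of_real by (intro mult_mono) (use s in auto)
  qed
  hence I: "norm (integral {0..1} ?f) \<le> s * (K * s ^ M)" by simp
  have "norm (disc_potential \<alpha> F w) \<le> 1 * (s * (K * s ^ M))"
    unfolding disc_potential_eq_integral[OF w] norm_mult
    by (rule mult_mono[OF _ I]) (use w in auto)
  thus ?thesis by (simp add: s_def mult_ac)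
qed

text \<open>An average of F over points of modulus at most |\<omega>| with total mass 1, so nothing
  is lost.\<close>

lemma radial_transform_bound:
  assumes \<alpha>: "\<alpha> > -1" and F: "F holomorphic_on ball 0 1"
    and bound: "\<And>\<omega>. norm \<omega> < 1 \<Longrightarrow> norm (F \<omega>) \<le> K * (1 / (1 - norm \<omega>)) ^ M"
    and w: "norm \<omega> < 1"
  shows "norm (radial_transform \<alpha> F \<omega>) \<le> K * (1 / (1 - norm \<omega>)) ^ M"
proof -
  have K: "K \<ge> 0" using order.trans[OF norm_ge_zero bound[of 0]] by simp
  have "norm (radial_transform \<alpha> F \<omega>) \<le> K * (1 / (1 - norm \<omega>)) ^ M * measure lborel (cbox (0::real) 1)"
  proof (rule has_integral_bound)
    show "0 \<le> K * (1 / (1 - norm \<omega>)) ^ M" using K w by simp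
    show "((\<lambda>s. F (of_real (1 - s powr (1 / (\<alpha> + 1))) * \<omega>)) has_integral radial_transform \<alpha> F \<omega>) (cbox 0 1)"
      using radial_transform_has_integral[OF \<alpha> F w] by simp
    fix s :: real assume "s \<in> cbox 0 1"
    hence s: "s \<in> {0..1}" by simp
    define t where "t = 1 - s powr (1 / (\<alpha> + 1))"
    have t: "t \<in> {0..1}" unfolding t_def by (rule one_minus_powr_in_01[OF \<alpha> s])
    have "norm (of_real t * \<omega>) \<le> norm \<omega>" using t by (simp add: norm_mult mult_left_le_one_le)
    hence "1 / (1 - norm (of_real t * \<omega>)) \<le> 1 / (1 - norm \<omega>)"
      using w by (intro divide_left_mono mult_pos_pos) auto
    hence "K * (1 / (1 - norm (of_real t * \<omega>))) ^ M \<le> K * (1 / (1 - norm \<omega>)) ^ M"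
      using K of_real_mult_in_ball[OF w t] by (intro mult_left_mono power_mono) auto
    thus "norm (F (of_real (1 - s powr (1 / (\<alpha> + 1))) * \<omega>)) \<le> K * (1 / (1 - norm \<omega>)) ^ M"
      using bound[OF of_real_mult_in_ball[OF w t]] unfolding t_def by linarith
  qed
  thus ?thesis by simp
qed

section \<open>The inverse Cayley transform\<close>

definition cayley_inv :: "complex \<Rightarrow> complex" where
  "cayley_inv z = (z - \<i>) / (z + \<i>)"

lemma Im_ge_0_imp_nonzero: "Im z \<ge> 0 \<Longrightarrow> z + \<i> \<noteq> 0"
  by (auto simp: complex_eq_iff)

lemma one_minus_cayley_inv: "Im z \<ge> 0 \<Longrightarrow> 1 - cayley_inv z = 2 * \<i> / (z + \<i>)"
  using Im_ge_0_imp_nonzero[of z] by (simp add: cayley_inv_def field_simps)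

lemma cayley_cayley_inv:
  assumes "Im z \<ge> 0"
  shows "cayley \<i> (cayley_inv z) = z"
proof -
  have nz: "z + \<i> \<noteq> 0" by (rule Im_ge_0_imp_nonzero[OF assms])
  have "1 + cayley_inv z = 2 * z / (z + \<i>)" using nz by (simp add: cayley_inv_def field_simps)
  thus ?thesis unfolding cayley_def one_minus_cayley_inv[OF assms] using nz by simp
qed

lemma one_minus_norm_cayley_inv:
  assumes "Im z \<ge> 0"
  shows "1 - (norm (cayley_inv z))\<^sup>2 = 4 * Im z / (norm (z + \<i>))\<^sup>2"
proof -
  have nz: "norm (z + \<i>) \<noteq> 0" using Im_ge_0_imp_nonzero[OF assms] by simp
  have "(norm (z + \<i>))\<^sup>2 - (norm (z - \<i>))\<^sup>2 = 4 * Im z"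
    unfolding cmod_power2 by (simp add: power2_eq_square algebra_simps)
  moreover have "1 - (norm (cayley_inv z))\<^sup>2 = ((norm (z + \<i>))\<^sup>2 - (norm (z - \<i>))\<^sup>2) / (norm (z + \<i>))\<^sup>2"
    unfolding cayley_inv_def norm_divide power_divide using nz by (simp add: diff_divide_distrib)
  ultimately show ?thesis by simp
qed

lemma norm_cayley_inv_less: "Im z > 0 \<Longrightarrow> norm (cayley_inv z) < 1"
proof -
  assume z: "Im z > 0"
  hence "1 - (norm (cayley_inv z))\<^sup>2 > 0"
    unfolding one_minus_norm_cayley_inv[OF less_imp_le[OF z]]
    using Im_ge_0_imp_nonzero[of z] by (intro divide_pos_pos) auto
  thus ?thesis by (simp add: power_less_one_iff)
qed

lemma cayley_inv_of_real: "norm (cayley_inv (of_real x)) = 1" "cayley_inv (of_real x) \<noteq> 1"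
proof -
  have "1 - (norm (cayley_inv (of_real x)))\<^sup>2 = 0"
    by (subst one_minus_norm_cayley_inv) auto
  thus "norm (cayley_inv (of_real x)) = 1"
    by (simp add: power2_eq_1_iff) (smt (verit) norm_ge_zero)
  have "1 - cayley_inv (of_real x) \<noteq> 0"
    using one_minus_cayley_inv[of "of_real x"] Im_ge_0_imp_nonzero[of "of_real x"] by simp
  thus "cayley_inv (of_real x) \<noteq> 1" by auto
qed

lemma cayley_inv_tendsto: "(cayley_inv \<longlongrightarrow> cayley_inv (of_real x)) (at (of_real x) within S)"
  unfolding cayley_inv_def by (intro tendsto_intros Im_ge_0_imp_nonzero) auto

lemma filterlim_cayley_inv:
  "filterlim cayley_inv (at (cayley_inv (of_real x)) within ball 0 1) (at (of_real x) within {z. Im z > 0})"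
  unfolding filterlim_at
proof
  show "\<forall>\<^sub>F z in at (complex_of_real x) within {z. Im z > 0}. cayley_inv z \<in> ball 0 1 \<and> cayley_inv z \<noteq> cayley_inv (of_real x)"
    unfolding eventually_at_filter
  proof (intro always_eventually allI impI)
    fix z :: complex assume "z \<in> {z. Im z > 0}"
    hence "norm (cayley_inv z) < 1" by (intro norm_cayley_inv_less) simp
    thus "cayley_inv z \<in> ball 0 1 \<and> cayley_inv z \<noteq> cayley_inv (of_real x)"
      using cayley_inv_of_real(1)[of x] by auto
  qed
qed (rule cayley_inv_tendsto)

text \<open>Stated as a power of |z| times the angular factor |z| / Im z: the two play different
  roles below, the first being lowered by induction and the second absorbed by a contour
  weight.\<close>

lemma inverse_one_minus_cayley_inv_le:
  assumes z: "Im z > 0" "norm z \<ge> 1"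
  shows "1 / (1 - norm (cayley_inv z)) \<le> 2 * norm z * (norm z / Im z)"
proof -
  let ?r = "norm (cayley_inv z)"
  have r: "?r < 1" by (rule norm_cayley_inv_less[OF z(1)])
  have eq: "(1 - ?r) * (1 + ?r) = 4 * Im z / (norm (z + \<i>))\<^sup>2"
    using one_minus_norm_cayley_inv[of z] z by (simp add: power2_eq_square algebra_simps)
  have n: "norm (z + \<i>) > 0" using Im_ge_0_imp_nonzero[of z] z by simp
  have "norm (z + \<i>) \<le> 2 * norm z" using norm_triangle_ineq[of z \<i>] z by simp
  hence n2: "(norm (z + \<i>))\<^sup>2 \<le> (2 * norm z)\<^sup>2" using n by (intro power_mono) auto
  have "4 * Im z / (2 * norm z)\<^sup>2 \<le> 4 * Im z / (norm (z + \<i>))\<^sup>2"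
    using z n n2 by (intro divide_left_mono mult_pos_pos) auto
  also have "\<dots> \<le> (1 - ?r) * 2" unfolding eq[symmetric] using r by (intro mult_left_mono) auto
  finally have "Im z / (2 * (norm z)\<^sup>2) \<le> 1 - ?r" by (simp add: power_mult_distrib)
  moreover have "Im z / (2 * (norm z)\<^sup>2) > 0" using z by (intro divide_pos_pos mult_pos_pos) auto
  ultimately have "1 / (1 - ?r) \<le> 1 / (Im z / (2 * (norm z)\<^sup>2))"
    using r by (intro divide_left_mono mult_pos_pos) auto
  thus ?thesis by (simp add: power2_eq_square mult_ac)
qed

section \<open>Holomorphic functions without a jump across the real line\<close>

text \<open>Turns limits at single real points into continuity on the closed half-plane, and thereby
  makes compactness available. It serves for the jump, for u itself, and for the final uniqueness
  argument.\<close>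

lemma continuous_on_zero_extension:
  fixes v :: "complex \<Rightarrow> 'a::real_normed_vector"
  assumes cont1: "continuous_on {z. Im z > 0} v"
    and lim: "\<And>x::real. (v \<longlongrightarrow> 0) (at (of_real x) within {z. Im z > 0})"
  shows "continuous_on {z. Im z \<ge> 0} (\<lambda>z. if Im z > 0 then v z else 0)"
proof -
  define D where "D z = (if Im z > 0 then v z else 0)" for z
  have op: "open {z. Im z > 0}" by (rule open_halfspace_Im_gt)
  have "continuous (at z within {z. Im z \<ge> 0}) D" if "Im z \<ge> 0" for z
  proof (cases "Im z > 0")
    case True
    have "isCont v z"
      using cont1 True op by (simp add: continuous_on_eq_continuous_at)
    moreover have "eventually (\<lambda>w. w \<in> {w. Im w > 0}) (nhds z)"
      using eventually_nhds_in_open[OF op, of z] True by simp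
    hence "eventually (\<lambda>w. D w = v w) (nhds z)"
      by eventually_elim (simp add: D_def)
    ultimately have "isCont D z"
      by (simp add: isCont_cong)
    thus ?thesis by (rule continuous_at_imp_continuous_at_within)
  next
    case False
    with that have z: "z = of_real (Re z)" by (simp add: complex_eq_iff)
    have "{z. Im z \<ge> 0} = {z. Im z > 0} \<union> {z. Im z = 0}" by auto
    moreover have "(D \<longlongrightarrow> 0) (at z within {z. Im z > 0})"
      using lim[of "Re z"] z by (auto intro: Lim_transform_eventually simp: eventually_at_filter D_def)
    moreover have "(D \<longlongrightarrow> 0) (at z within {z. Im z = 0})"
      by (rule tendsto_eventually) (auto simp: eventually_at_filter D_def)
    ultimately have "(D \<longlongrightarrow> 0) (at z within {z. Im z \<ge> 0})"
      by (simp add: Lim_within_Un)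
    thus ?thesis using False by (simp add: continuous_within D_def)
  qed
  thus ?thesis
    by (auto simp: continuous_on_eq_continuous_within D_def[abs_def])
qed

text \<open>The difference extended by 0 is uniformly continuous on a compact rectangle, so the
  pointwise jump condition holds uniformly for |x| \<le> X.\<close>

lemma half_plane_jump_uniform:
  fixes X :: real
  assumes a: "a holomorphic_on {z. Im z > 0}" and b: "b holomorphic_on {z. Im z < 0}"
    and jump: "\<And>x::real. ((\<lambda>z. a z - b (cnj z)) \<longlongrightarrow> 0) (at (of_real x) within {z. Im z > 0})"
    and d: "d > 0"
  shows "\<exists>e>0. \<forall>\<epsilon> x. 0 < \<epsilon> \<and> \<epsilon> < e \<and> \<bar>x\<bar> \<le> X \<longrightarrow>
     norm (a (of_real x + \<i> * of_real \<epsilon>) - b (of_real x - \<i> * of_real \<epsilon>)) < d"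
proof -
  define D where "D z = (if Im z > 0 then a z - b (cnj z) else 0)" for z
  have cont1: "continuous_on {z. Im z > 0} (\<lambda>z. a z - b (cnj z))"
  proof (intro continuous_on_diff)
    show "continuous_on {z. Im z > 0} a" using a holomorphic_on_imp_continuous_on by blast
    have "continuous_on {z. Im z < 0} b" using b holomorphic_on_imp_continuous_on by blast
    thus "continuous_on {z. Im z > 0} (\<lambda>z. b (cnj z))"
      by (rule continuous_on_compose2) (auto intro!: continuous_intros)
  qed
  have cont: "continuous_on {z. Im z \<ge> 0} D"
    unfolding D_def[abs_def] by (rule continuous_on_zero_extension[OF cont1 jump])
  define K where "K = cbox (Complex (-X) 0) (Complex X 1)"
  have inK: "Complex x y \<in> K \<longleftrightarrow> \<bar>x\<bar> \<le> X \<and> 0 \<le> y \<and> y \<le> 1" for x y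
    by (auto simp: K_def in_cbox_complex_iff)
  have "K \<subseteq> {z. Im z \<ge> 0}" by (auto simp: K_def in_cbox_complex_iff)
  hence "uniformly_continuous_on K D"
    using cont by (intro compact_uniformly_continuous) (auto intro: continuous_on_subset simp: K_def)
  then obtain e where e: "e > 0" "\<And>z w. z \<in> K \<Longrightarrow> w \<in> K \<Longrightarrow> dist w z < e \<Longrightarrow> dist (D w) (D z) < d"
    using d unfolding uniformly_continuous_on_def by metis
  show ?thesis
  proof (intro exI[of _ "min e 1"] conjI allI impI)
    fix \<epsilon> x assume *: "0 < \<epsilon> \<and> \<epsilon> < min e 1 \<and> \<bar>x\<bar> \<le> X"
    have "dist (D (Complex x \<epsilon>)) (D (Complex x 0)) < d"
      by (rule e(2)) (use * in \<open>auto simp: inK dist_norm cmod_def\<close>)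
    moreover have "Complex x \<epsilon> = of_real x + \<i> * of_real \<epsilon>" "cnj (Complex x \<epsilon>) = of_real x - \<i> * of_real \<epsilon>"
      by (auto simp: complex_eq_iff)
    ultimately show "norm (a (of_real x + \<i> * of_real \<epsilon>) - b (of_real x - \<i> * of_real \<epsilon>)) < d"
      using * by (simp add: D_def dist_norm)
  qed (use e in auto)
qed

text \<open>On a vertical side one of X - \<zeta>, X + \<zeta> has modulus |Im \<zeta>|; on a
  horizontal side |Im \<zeta>| = X. Either way the weight base is at most 9 y / X, against 3 X / y
  from the angular factor of G; their product 27 no longer involves y.\<close>

lemma corner_weight_bound:
  fixes \<zeta> \<zeta>' G :: complex
  assumes X: "X > 0" and C: "C \<ge> 0"
    and G: "norm G \<le> C / norm \<zeta>' * (norm \<zeta>' / y) ^ M"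
    and \<zeta>': "X \<le> norm \<zeta>'" "norm \<zeta>' \<le> 3 * X" and y: "y > 0" "y \<ge> \<bar>Im \<zeta>\<bar>"
    and \<zeta>: "\<bar>Re \<zeta>\<bar> \<le> X" "\<bar>Im \<zeta>\<bar> \<le> X" "\<bar>Re \<zeta>\<bar> = X \<or> \<bar>Im \<zeta>\<bar> = X"
  shows "norm (G * (1 - \<zeta>\<^sup>2 / of_real (X\<^sup>2)) ^ M) \<le> 27 ^ M * C / X"
proof -
  have fac: "1 - \<zeta>\<^sup>2 / of_real (X\<^sup>2) = (of_real X - \<zeta>) * (of_real X + \<zeta>) / of_real (X\<^sup>2)"
    using X by (simp add: field_simps power2_eq_square)
  have n: "norm \<zeta> \<le> 2 * X" using cmod_le[of \<zeta>] \<zeta> by linarith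
  have p: "norm (of_real X - \<zeta>) \<le> 3 * X" "norm (of_real X + \<zeta>) \<le> 3 * X"
    using norm_triangle_ineq4[of "of_real X" \<zeta>] norm_triangle_ineq[of "of_real X" \<zeta>] n X by auto
  have "norm (of_real X - \<zeta>) * norm (of_real X + \<zeta>) \<le> 9 * \<bar>Im \<zeta>\<bar> * X"
    using \<zeta>(3)
  proof
    assume "\<bar>Im \<zeta>\<bar> = X"
    thus ?thesis using mult_mono[OF p] X by simp
  next
    assume "\<bar>Re \<zeta>\<bar> = X"
    hence "Re \<zeta> = X \<or> Re \<zeta> = - X" by linarith
    thus ?thesis
    proof
      assume "Re \<zeta> = X"
      hence "norm (of_real X - \<zeta>) = \<bar>Im \<zeta>\<bar>" by (simp add: cmod_def)
      hence "norm (of_real X - \<zeta>) * norm (of_real X + \<zeta>) \<le> \<bar>Im \<zeta>\<bar> * (3 * X)"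
        using p by (simp add: mult_left_mono)
      also have "\<dots> \<le> 9 * \<bar>Im \<zeta>\<bar> * X" using X by simp
      finally show ?thesis .
    next
      assume "Re \<zeta> = - X"
      hence "norm (of_real X + \<zeta>) = \<bar>Im \<zeta>\<bar>" by (simp add: cmod_def)
      hence "norm (of_real X - \<zeta>) * norm (of_real X + \<zeta>) \<le> (3 * X) * \<bar>Im \<zeta>\<bar>"
        using p by (simp add: mult_right_mono)
      also have "\<dots> \<le> 9 * \<bar>Im \<zeta>\<bar> * X" using X by simp
      finally show ?thesis .
    qed
  qed
  also have "\<dots> \<le> 9 * y * X" using y X by simp
  finally have "norm (1 - \<zeta>\<^sup>2 / of_real (X\<^sup>2)) \<le> 9 * y * X / X\<^sup>2"
    unfolding fac norm_divide norm_mult norm_of_real using X by (simp add: divide_right_mono)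
  also have "\<dots> = 9 * y / X" using X by (simp add: power2_eq_square)
  finally have w: "norm (1 - \<zeta>\<^sup>2 / of_real (X\<^sup>2)) \<le> 9 * y / X" .
  have "norm (G * (1 - \<zeta>\<^sup>2 / of_real (X\<^sup>2)) ^ M) \<le> (C / X * (3 * X / y) ^ M) * (9 * y / X) ^ M"
    unfolding norm_mult norm_power
  proof (intro mult_mono power_mono w)
    show "norm G \<le> C / X * (3 * X / y) ^ M"
      by (rule order.trans[OF G], intro mult_mono divide_left_mono power_mono divide_right_mono)
         (use \<zeta>' y X C in \<open>auto intro!: mult_pos_pos\<close>)
  qed (use X C y in auto)
  also have "\<dots> = C / X * ((3 * X / y) * (9 * y / X)) ^ M"
    by (simp only: power_mult_distrib mult.assoc)
  also have "(3 * X / y) * (9 * y / X) = 27" using X y by simp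
  finally show ?thesis by (simp add: mult_ac)
qed

lemma contour_integral_rectpath_split:
  assumes f: "continuous_on (path_image (rectpath p q)) f"
  shows "contour_integral (rectpath p q) f =
      contour_integral (linepath p (Complex (Re q) (Im p))) f +
      contour_integral (linepath (Complex (Re q) (Im p)) q) f +
      contour_integral (linepath q (Complex (Re p) (Im q))) f +
      contour_integral (linepath (Complex (Re p) (Im q)) p) f"
proof -
  have "f contour_integrable_on linepath r s"
    if "closed_segment r s \<subseteq> path_image (rectpath p q)" for r s
    using that f by (intro contour_integrable_continuous_linepath) (rule continuous_on_subset)
  moreover have "path_image (rectpath p q) =
     closed_segment p (Complex (Re q) (Im p)) \<union> closed_segment (Complex (Re q) (Im p)) q \<union>
     closed_segment q (Complex (Re p) (Im q)) \<union> closed_segment (Complex (Re p) (Im q)) p"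
    by (simp add: rectpath_def Let_def path_image_join Un_assoc)
  ultimately have "f contour_integrable_on linepath p (Complex (Re q) (Im p))"
    "f contour_integrable_on linepath (Complex (Re q) (Im p)) q"
    "f contour_integrable_on linepath q (Complex (Re p) (Im q))"
    "f contour_integrable_on linepath (Complex (Re p) (Im q)) p"
    by auto
  thus ?thesis
    by (simp add: rectpath_def Let_def contour_integral_join contour_integrable_join add.assoc)
qed

lemma convex_halfspace_Im: "convex {z. Im z > r}" "convex {z. Im z < r}"
  by (simp_all add: convex_halfspace_Im_gt convex_halfspace_Im_lt)

text \<open>The weight \<open>(1 - \<zeta>\<^sup>2/X\<^sup>2)\<^sup>M\<close> vanishes at the two corners where the outer sides of the
  contour meet the real line, which compensates the blow-up of \<open>a\<close> and \<open>b\<close> there.\<close>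

lemma half_plane_pair_estimate:
  fixes a b :: "complex \<Rightarrow> complex"
  assumes a: "a holomorphic_on {z. Im z > 0}" and b: "b holomorphic_on {z. Im z < 0}"
    and C: "C \<ge> 0"
    and bound_a: "\<And>z. Im z > 0 \<Longrightarrow> norm z \<ge> R \<Longrightarrow> norm (a z) \<le> C / norm z * (norm z / Im z) ^ M"
    and bound_b: "\<And>z. Im z < 0 \<Longrightarrow> norm z \<ge> R \<Longrightarrow> norm (b z) \<le> C / norm z * (norm z / - Im z) ^ M"
    and z0: "Im z0 < 0" and X: "X > 0" "X \<ge> R" "X \<ge> 2 * norm z0" and \<epsilon>: "0 < \<epsilon>" "\<epsilon> \<le> X"
    and d: "\<And>x. \<bar>x\<bar> \<le> X \<Longrightarrow> norm (a (of_real x + \<i> * of_real \<epsilon>) - b (of_real x - \<i> * of_real \<epsilon>)) \<le> d"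
  shows "2 * pi * norm (b (z0 - \<i> * of_real \<epsilon>) * (1 - z0\<^sup>2 / of_real (X\<^sup>2)) ^ M)
     \<le> 16 * 27 ^ M * C / X + d / \<bar>Im z0\<bar> * (2 * X)"
proof -
  define \<psi> where "\<psi> \<zeta> = (1 - \<zeta>\<^sup>2 / of_real (X\<^sup>2)) ^ M" for \<zeta> :: complex
  have \<psi>: "\<psi> holomorphic_on S" for S
    unfolding \<psi>_def using X by (intro holomorphic_intros) auto
  \<comment> \<open>Shifting a up and b down by \<epsilon> makes both defined on the real segment
    itself, where the two contours share an edge.\<close>
  define g1 where "g1 \<zeta> = a (\<zeta> + \<i> * of_real \<epsilon>) * \<psi> \<zeta> / (\<zeta> - z0)" for \<zeta>
  define g2 where "g2 \<zeta> = b (\<zeta> - \<i> * of_real \<epsilon>) * \<psi> \<zeta> / (\<zeta> - z0)" for \<zeta>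
  \<comment> \<open>On Im \<zeta> > -e the shifted argument of a stays in the upper half-plane and
    the pole z0 is avoided, so \<open>g1\<close> is holomorphic in a neighbourhood of the upper
    rectangle.\<close>
  define e where "e = min \<epsilon> (- Im z0)"
  have e: "e > 0" "e \<le> \<epsilon>" "e \<le> - Im z0" using \<epsilon> z0 by (auto simp: e_def)
  have as: "(\<lambda>\<zeta>. a (\<zeta> + \<i> * of_real \<epsilon>)) holomorphic_on {\<zeta>. Im \<zeta> > - e}"
    using holomorphic_on_compose_gen[OF _ a, of "\<lambda>\<zeta>. \<zeta> + \<i> * of_real \<epsilon>" "{\<zeta>. Im \<zeta> > - e}"] e
    by (force intro!: holomorphic_intros simp: o_def)
  have bs: "(\<lambda>\<zeta>. b (\<zeta> - \<i> * of_real \<epsilon>)) holomorphic_on {\<zeta>. Im \<zeta> < \<epsilon>}"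
    using holomorphic_on_compose_gen[OF _ b, of "\<lambda>\<zeta>. \<zeta> - \<i> * of_real \<epsilon>" "{\<zeta>. Im \<zeta> < \<epsilon>}"]
    by (force intro!: holomorphic_intros simp: o_def)
  have g1: "g1 holomorphic_on {\<zeta>. Im \<zeta> > - e}"
    unfolding g1_def using e by (intro holomorphic_intros as \<psi>) auto
  have g2c: "continuous_on ({\<zeta>. Im \<zeta> < \<epsilon>} - {z0}) g2"
    unfolding g2_def
    by (intro holomorphic_on_imp_continuous_on holomorphic_intros holomorphic_on_subset[OF bs] \<psi>) auto
  let ?p = "Complex (- X) 0" and ?q = "Complex X X" and ?r = "Complex (- X) (- X)" and ?s = "Complex X 0"
  have z0X: "\<bar>Re z0\<bar> < X" "\<bar>Im z0\<bar> < X"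
    using abs_Re_le_cmod[of z0] abs_Im_le_cmod[of z0] X by linarith+
  have im1: "path_image (rectpath ?p ?q) \<subseteq> {\<zeta>. Im \<zeta> > - e}"
    using path_image_rectpath_subset_cbox[of ?p ?q] X e by (force simp: in_cbox_complex_iff)
  have z0box: "z0 \<in> box ?r ?s" using z0X z0 by (auto simp: in_box_complex_iff)
  have im2: "path_image (rectpath ?r ?s) \<subseteq> {\<zeta>. Im \<zeta> < \<epsilon>} - {z0}"
  proof -
    have "path_image (rectpath ?r ?s) \<subseteq> {\<zeta>. Im \<zeta> < \<epsilon>}"
      using path_image_rectpath_subset_cbox[of ?r ?s] X \<epsilon> by (force simp: in_cbox_complex_iff)
    moreover have "z0 \<notin> path_image (rectpath ?r ?s)"
      using path_image_rectpath_cbox_minus_box[of ?r ?s] z0box X by simp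
    ultimately show ?thesis by blast
  qed
  have "(g1 has_contour_integral 0) (rectpath ?p ?q)"
    by (rule Cauchy_theorem_convex_simple[OF g1 convex_halfspace_Im(1)]) (use im1 in auto)
  hence "contour_integral (rectpath ?p ?q) g1 = 0" by (rule contour_integral_unique)
  hence I1: "contour_integral (linepath ?p ?s) g1 +
      contour_integral (linepath ?s ?q) g1 +
      contour_integral (linepath ?q (Complex (- X) X)) g1 +
      contour_integral (linepath (Complex (- X) X) ?p) g1 = 0"
    by (subst (asm) contour_integral_rectpath_split)
       (use holomorphic_on_imp_continuous_on[OF g1] im1 in \<open>auto intro: continuous_on_subset\<close>)
  have "((\<lambda>\<zeta>. (b (\<zeta> - \<i> * of_real \<epsilon>) * \<psi> \<zeta>) / (\<zeta> - z0)) has_contour_integral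
      (2 * pi * \<i> * winding_number (rectpath ?r ?s) z0 * (b (z0 - \<i> * of_real \<epsilon>) * \<psi> z0))) (rectpath ?r ?s)"
    by (rule Cauchy_integral_formula_convex_simple[OF convex_halfspace_Im(2)])
       (use im2 z0 \<epsilon> in \<open>auto intro!: holomorphic_intros bs \<psi> simp: interior_open open_halfspace_Im_lt\<close>)
  moreover have "winding_number (rectpath ?r ?s) z0 = 1"
    by (rule winding_number_rectpath[OF z0box])
  ultimately have "contour_integral (rectpath ?r ?s) g2 = 2 * pi * \<i> * (b (z0 - \<i> * of_real \<epsilon>) * \<psi> z0)"
    by (simp add: contour_integral_unique g2_def[abs_def])
  hence I2: "contour_integral (linepath ?r (Complex X (- X))) g2 +
      contour_integral (linepath (Complex X (- X)) ?s) g2 +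
      contour_integral (linepath ?s ?p) g2 +
      contour_integral (linepath ?p ?r) g2 = 2 * pi * \<i> * (b (z0 - \<i> * of_real \<epsilon>) * \<psi> z0)"
    by (subst (asm) contour_integral_rectpath_split)
       (use g2c im2 in \<open>auto intro: continuous_on_subset\<close>)
  have seg: "\<bar>x\<bar> \<le> X \<and> y = 0" if "Complex x y \<in> closed_segment ?p ?s" for x y
    using that X by (auto simp: closed_segment_same_Im closed_segment_eq_real_ivl split: if_splits)
  have segp: "\<bar>Re \<zeta>\<bar> \<le> X \<and> Im \<zeta> = 0" if "\<zeta> \<in> closed_segment ?p ?s" for \<zeta>
    using seg[of "Re \<zeta>" "Im \<zeta>"] that by simp
  have int1: "g1 contour_integrable_on linepath ?p ?s"
    by (intro contour_integrable_continuous_linepath continuous_on_subset[OF holomorphic_on_imp_continuous_on[OF g1]])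
       (use segp e in force)
  have int2: "g2 contour_integrable_on linepath ?p ?s"
    by (intro contour_integrable_continuous_linepath continuous_on_subset[OF g2c])
       (use segp \<epsilon> z0 in force)
  have rev: "contour_integral (linepath ?s ?p) g2 = - contour_integral (linepath ?p ?s) g2"
    by (metis contour_integral_reversepath reversepath_linepath valid_path_linepath)
  have far: "norm (\<zeta> - z0) \<ge> X / 2" if "norm \<zeta> \<ge> X" for \<zeta>
    using norm_triangle_ineq2[of \<zeta> z0] X that by linarith
  \<comment> \<open>The corner bound divided by |\<zeta> - z0| \<ge> X/2. The six outer sides have
    total length 8 X, which produces the constant 16.\<close>
  define B where "B = 27 ^ M * C / X / (X / 2)"
  have B: "B \<ge> 0" unfolding B_def using C X by simp
  have side: "norm (g1 \<zeta>) \<le> B" if "0 \<le> Im \<zeta>" "Im \<zeta> \<le> X" "\<bar>Re \<zeta>\<bar> \<le> X" "\<bar>Re \<zeta>\<bar> = X \<or> Im \<zeta> = X" for \<zeta>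
  proof -
    let ?z = "\<zeta> + \<i> * of_real \<epsilon>"
    have n: "norm \<zeta> \<ge> X" using that abs_Re_le_cmod[of \<zeta>] abs_Im_le_cmod[of \<zeta>] by linarith
    have "X \<le> norm ?z" using that \<epsilon> abs_Re_le_cmod[of ?z] abs_Im_le_cmod[of ?z] by auto
    moreover have "norm ?z \<le> 3 * X" using cmod_le[of ?z] that \<epsilon> by auto
    ultimately have "norm (a ?z * \<psi> \<zeta>) \<le> 27 ^ M * C / X"
      unfolding \<psi>_def using that \<epsilon> X C bound_a[of ?z]
      by (intro corner_weight_bound[where y = "Im ?z"]) auto
    thus ?thesis
      unfolding g1_def norm_divide B_def using far[OF n] X C by (intro frac_le) auto
  qed
  have side2: "norm (g2 \<zeta>) \<le> B" if "- X \<le> Im \<zeta>" "Im \<zeta> \<le> 0" "\<bar>Re \<zeta>\<bar> \<le> X" "\<bar>Re \<zeta>\<bar> = X \<or> Im \<zeta> = - X" for \<zeta>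
  proof -
    let ?z = "\<zeta> - \<i> * of_real \<epsilon>"
    have n: "norm \<zeta> \<ge> X" using that abs_Re_le_cmod[of \<zeta>] abs_Im_le_cmod[of \<zeta>] by linarith
    have "X \<le> norm ?z" using that \<epsilon> abs_Re_le_cmod[of ?z] abs_Im_le_cmod[of ?z] by auto
    moreover have "norm ?z \<le> 3 * X" using cmod_le[of ?z] that \<epsilon> by auto
    ultimately have "norm (b ?z * \<psi> \<zeta>) \<le> 27 ^ M * C / X"
      unfolding \<psi>_def using that \<epsilon> X C bound_b[of ?z]
      by (intro corner_weight_bound[where y = "- Im ?z"]) auto
    thus ?thesis
      unfolding g2_def norm_divide B_def using far[OF n] X C by (intro frac_le) auto
  qed
  have vert: "Re \<zeta> = x \<and> min y1 y2 \<le> Im \<zeta> \<and> Im \<zeta> \<le> max y1 y2" if "\<zeta> \<in> closed_segment (Complex x y1) (Complex x y2)" for \<zeta> x y1 y2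
    using that by (auto simp: closed_segment_same_Re closed_segment_eq_real_ivl split: if_splits)
  have hor: "Im \<zeta> = y \<and> min x1 x2 \<le> Re \<zeta> \<and> Re \<zeta> \<le> max x1 x2" if "\<zeta> \<in> closed_segment (Complex x1 y) (Complex x2 y)" for \<zeta> y x1 x2
    using that by (auto simp: closed_segment_same_Im closed_segment_eq_real_ivl split: if_splits)
  have L: "norm (contour_integral (linepath r s) g) \<le> B * norm (s - r)"
    if "\<And>\<zeta>. \<zeta> \<in> closed_segment r s \<Longrightarrow> norm (g \<zeta>) \<le> B" "continuous_on (closed_segment r s) g" for r s g
    using that B by (intro contour_integral_bound_linepath contour_integrable_continuous_linepath) auto
  have c1: "continuous_on (closed_segment r s) g1" if "Im r \<ge> 0" "Im s \<ge> 0" for r s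
  proof -
    have "closed_segment r s \<subseteq> {\<zeta>. Im \<zeta> > - e}"
      using that e by (intro closed_segment_subset convex_halfspace_Im) auto
    thus ?thesis using holomorphic_on_imp_continuous_on[OF g1] continuous_on_subset by blast
  qed
  have c2: "continuous_on (closed_segment r s) g2" if "closed_segment r s \<subseteq> path_image (rectpath ?r ?s)" for r s
    using that im2 g2c continuous_on_subset by blast
  have pim2: "path_image (rectpath ?r ?s) = closed_segment ?r (Complex X (- X)) \<union>
      closed_segment (Complex X (- X)) ?s \<union> closed_segment ?s ?p \<union> closed_segment ?p ?r"
    by (simp add: rectpath_def Let_def path_image_join Un_assoc)
  have "norm (contour_integral (linepath ?s ?q) g1) \<le> B * norm (?q - ?s)"
  proof (rule L)
    fix \<zeta> assume "\<zeta> \<in> closed_segment ?s ?q"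
    from vert[OF this] X show "norm (g1 \<zeta>) \<le> B" by (intro side) auto
  qed (rule c1, (use X in simp_all))
  moreover have "norm (?q - ?s) = X" using X by (simp add: cmod_def)
  ultimately have S1: "norm (contour_integral (linepath ?s ?q) g1) \<le> B * (X)" by simp
  have "norm (contour_integral (linepath ?q (Complex (- X) X)) g1) \<le> B * norm ((Complex (- X) X) - ?q)"
  proof (rule L)
    fix \<zeta> assume "\<zeta> \<in> closed_segment ?q (Complex (- X) X)"
    from hor[OF this] X show "norm (g1 \<zeta>) \<le> B" by (intro side) auto
  qed (rule c1, (use X in simp_all))
  moreover have "norm ((Complex (- X) X) - ?q) = 2 * X" using X by (simp add: cmod_def real_sqrt_mult)
  ultimately have S2: "norm (contour_integral (linepath ?q (Complex (- X) X)) g1) \<le> B * (2 * X)" by simp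
  have "norm (contour_integral (linepath (Complex (- X) X) ?p) g1) \<le> B * norm (?p - (Complex (- X) X))"
  proof (rule L)
    fix \<zeta> assume "\<zeta> \<in> closed_segment (Complex (- X) X) ?p"
    from vert[OF this] X show "norm (g1 \<zeta>) \<le> B" by (intro side) auto
  qed (rule c1, (use X in simp_all))
  moreover have "norm (?p - (Complex (- X) X)) = X" using X by (simp add: cmod_def)
  ultimately have S3: "norm (contour_integral (linepath (Complex (- X) X) ?p) g1) \<le> B * (X)" by simp
  have "norm (contour_integral (linepath ?r (Complex X (- X))) g2) \<le> B * norm ((Complex X (- X)) - ?r)"
  proof (rule L)
    fix \<zeta> assume "\<zeta> \<in> closed_segment ?r (Complex X (- X))"
    from hor[OF this] X show "norm (g2 \<zeta>) \<le> B" by (intro side2) auto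
  qed (rule c2, unfold pim2, blast)
  moreover have "norm ((Complex X (- X)) - ?r) = 2 * X" using X by (simp add: cmod_def real_sqrt_mult)
  ultimately have T1: "norm (contour_integral (linepath ?r (Complex X (- X))) g2) \<le> B * (2 * X)" by simp
  have "norm (contour_integral (linepath (Complex X (- X)) ?s) g2) \<le> B * norm (?s - (Complex X (- X)))"
  proof (rule L)
    fix \<zeta> assume "\<zeta> \<in> closed_segment (Complex X (- X)) ?s"
    from vert[OF this] X show "norm (g2 \<zeta>) \<le> B" by (intro side2) auto
  qed (rule c2, unfold pim2, blast)
  moreover have "norm (?s - (Complex X (- X))) = X" using X by (simp add: cmod_def)
  ultimately have T2: "norm (contour_integral (linepath (Complex X (- X)) ?s) g2) \<le> B * (X)" by simp
  have "norm (contour_integral (linepath ?p ?r) g2) \<le> B * norm (?r - ?p)"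
  proof (rule L)
    fix \<zeta> assume "\<zeta> \<in> closed_segment ?p ?r"
    from vert[OF this] X show "norm (g2 \<zeta>) \<le> B" by (intro side2) auto
  qed (rule c2, unfold pim2, blast)
  moreover have "norm (?r - ?p) = X" using X by (simp add: cmod_def)
  ultimately have T3: "norm (contour_integral (linepath ?p ?r) g2) \<le> B * (X)" by simp
  have "norm (contour_integral (linepath ?p ?s) (\<lambda>\<zeta>. g1 \<zeta> - g2 \<zeta>)) \<le> d / \<bar>Im z0\<bar> * norm (?s - ?p)"
  proof (rule contour_integral_bound_linepath)
    show "(\<lambda>\<zeta>. g1 \<zeta> - g2 \<zeta>) contour_integrable_on linepath ?p ?s"
      using int1 int2 by (rule contour_integrable_diff)
    have d0: "d \<ge> 0" by (rule order.trans[OF norm_ge_zero d[of 0]]) (use X in simp)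
    thus "0 \<le> d / \<bar>Im z0\<bar>" by simp
    fix \<zeta> assume "\<zeta> \<in> closed_segment ?p ?s"
    with segp have x: "\<bar>Re \<zeta>\<bar> \<le> X" "\<zeta> = of_real (Re \<zeta>)" by (auto simp: complex_eq_iff)
    define x where "x = Re \<zeta>"
    have "1 - \<zeta>\<^sup>2 / of_real (X\<^sup>2) = complex_of_real (1 - x\<^sup>2 / X\<^sup>2)"
      using x by (simp add: x_def)
    moreover have "\<bar>x\<bar>\<^sup>2 \<le> X\<^sup>2" using x by (intro power_mono) (auto simp: x_def)
    hence "\<bar>1 - x\<^sup>2 / X\<^sup>2\<bar> \<le> 1" using X by (simp add: field_simps)
    ultimately have "norm (\<psi> \<zeta>) \<le> 1"
      by (simp only: \<psi>_def norm_power norm_of_real) (simp add: power_le_one)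
    moreover have "norm (a (\<zeta> + \<i> * of_real \<epsilon>) - b (\<zeta> - \<i> * of_real \<epsilon>)) \<le> d"
      using d[of x] x by (simp add: x_def)
    ultimately have "norm ((a (\<zeta> + \<i> * of_real \<epsilon>) - b (\<zeta> - \<i> * of_real \<epsilon>)) * \<psi> \<zeta>) \<le> d * 1"
      unfolding norm_mult using d0 by (intro mult_mono) auto
    moreover have "norm (\<zeta> - z0) \<ge> \<bar>Im z0\<bar>"
      using abs_Im_le_cmod[of "\<zeta> - z0"] x(2) by (metis Im_complex_of_real abs_minus_commute diff_0_right minus_complex.simps(2))
    ultimately have "norm ((a (\<zeta> + \<i> * of_real \<epsilon>) - b (\<zeta> - \<i> * of_real \<epsilon>)) * \<psi> \<zeta> / (\<zeta> - z0)) \<le> d / \<bar>Im z0\<bar>"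
      unfolding norm_divide using z0 d0 by (intro frac_le) auto
    also have "(a (\<zeta> + \<i> * of_real \<epsilon>) - b (\<zeta> - \<i> * of_real \<epsilon>)) * \<psi> \<zeta> / (\<zeta> - z0) = g1 \<zeta> - g2 \<zeta>"
      by (simp add: g1_def g2_def diff_divide_distrib left_diff_distrib)
    finally show "norm (g1 \<zeta> - g2 \<zeta>) \<le> d / \<bar>Im z0\<bar>" .
  qed
  moreover have "contour_integral (linepath ?p ?s) (\<lambda>\<zeta>. g1 \<zeta> - g2 \<zeta>) =
      contour_integral (linepath ?p ?s) g1 - contour_integral (linepath ?p ?s) g2"
    using int1 int2 by (rule contour_integral_diff)
  moreover have "norm (?s - ?p) = 2 * X" using X by (simp add: cmod_def real_sqrt_mult)
  ultimately have J: "norm (contour_integral (linepath ?p ?s) g1 - contour_integral (linepath ?p ?s) g2) \<le> d / \<bar>Im z0\<bar> * (2 * X)"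
    by simp
  have tri: "norm w \<le> norm j + (norm s1 + norm s2 + norm s3 + (norm t1 + norm t2 + norm t3))"
    if "w = j + (s1 + s2 + s3 + (t1 + t2 + t3))" for w j s1 s2 s3 t1 t2 t3 :: complex
    unfolding that by (intro order.trans[OF norm_triangle_ineq] add_mono order.refl)
  have "norm (2 * pi * \<i> * (b (z0 - \<i> * of_real \<epsilon>) * \<psi> z0)) \<le>
     d / \<bar>Im z0\<bar> * (2 * X) + (B * X + B * (2 * X) + B * X + (B * (2 * X) + B * X + B * X))"
    by (rule order.trans[OF tri add_mono[OF J add_mono[OF add_mono[OF add_mono[OF S1 S2] S3] add_mono[OF add_mono[OF T1 T2] T3]]]])
       (use I1 I2 rev in \<open>simp add: algebra_simps\<close>)
  also have "norm (2 * pi * \<i> * (b (z0 - \<i> * of_real \<epsilon>) * \<psi> z0)) = 2 * pi * norm (b (z0 - \<i> * of_real \<epsilon>) * \<psi> z0)"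
    by (simp add: norm_mult)
  also have "B * X + B * (2 * X) + B * X + (B * (2 * X) + B * X + B * X) = 16 * 27 ^ M * C / X"
    using X by (simp add: B_def field_simps)
  finally show ?thesis unfolding \<psi>_def by (simp add: add.commute)
qed


text \<open>Cauchy's theorem above and Cauchy's formula below are added: the two real edges cancel
  up to the jump. The order of limits matters: \<epsilon> tends to 0 with X fixed, and only then X
  to infinity.\<close>

lemma half_plane_pair_vanish:
  fixes a b :: "complex \<Rightarrow> complex"
  assumes a: "a holomorphic_on {z. Im z > 0}" and b: "b holomorphic_on {z. Im z < 0}"
    and jump: "\<And>x::real. ((\<lambda>z. a z - b (cnj z)) \<longlongrightarrow> 0) (at (of_real x) within {z. Im z > 0})"
    and C: "C \<ge> 0"
    and bound_a: "\<And>z. Im z > 0 \<Longrightarrow> norm z \<ge> R \<Longrightarrow> norm (a z) \<le> C / norm z * (norm z / Im z) ^ M"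
    and bound_b: "\<And>z. Im z < 0 \<Longrightarrow> norm z \<ge> R \<Longrightarrow> norm (b z) \<le> C / norm z * (norm z / - Im z) ^ M"
    and z0: "Im z0 < 0"
  shows "b z0 = 0"
proof -
  define \<psi> where "\<psi> X = (1 - z0\<^sup>2 / of_real (X\<^sup>2)) ^ M" for X :: real
  have contb: "isCont b z0"
    using holomorphic_on_imp_continuous_on[OF b] z0
    by (simp add: continuous_on_eq_continuous_at open_halfspace_Im_lt)
  have *: "2 * pi * norm (b z0 * \<psi> X) \<le> 16 * 27 ^ M * C / X"
    if X: "X > 0" "X \<ge> R" "X \<ge> 2 * norm z0" for X
  proof (rule field_le_epsilon)
    fix \<eta> :: real assume \<eta>: "\<eta> > 0"
    \<comment> \<open>Chosen so that the jump term d / |Im z0| * (2 X) of the estimate is exactly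
      \<eta>.\<close>
    define d where "d = \<eta> * \<bar>Im z0\<bar> / (2 * X)"
    have d: "d > 0" unfolding d_def using \<eta> X z0 by (intro divide_pos_pos mult_pos_pos) auto
    obtain e where e: "e > 0" "\<And>\<epsilon> x. 0 < \<epsilon> \<Longrightarrow> \<epsilon> < e \<Longrightarrow> \<bar>x\<bar> \<le> X \<Longrightarrow>
       norm (a (of_real x + \<i> * of_real \<epsilon>) - b (of_real x - \<i> * of_real \<epsilon>)) < d"
      using half_plane_jump_uniform[OF a b jump d, of X] by blast
    have "eventually (\<lambda>\<epsilon>. \<epsilon> \<in> {0<..<min e X}) (at_right (0::real))"
      using e X by (intro eventually_at_right_real) auto
    hence ev: "eventually (\<lambda>\<epsilon>. 2 * pi * norm (b (z0 - \<i> * of_real \<epsilon>) * \<psi> X) \<le> 16 * 27 ^ M * C / X + \<eta>) (at_right 0)"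
    proof eventually_elim
      case (elim \<epsilon>)
      have "2 * pi * norm (b (z0 - \<i> * of_real \<epsilon>) * \<psi> X)
         \<le> 16 * 27 ^ M * C / X + d / \<bar>Im z0\<bar> * (2 * X)"
        unfolding \<psi>_def
        by (rule half_plane_pair_estimate[OF a b C bound_a bound_b z0 X])
           (use elim e(2) in \<open>auto intro: less_imp_le\<close>)
      also have "d / \<bar>Im z0\<bar> * (2 * X) = \<eta>" using X z0 by (simp add: d_def)
      finally show ?case .
    qed
    have "((\<lambda>\<epsilon>. z0 - \<i> * of_real \<epsilon>) \<longlongrightarrow> z0) (at_right (0::real))"
      by (auto intro!: tendsto_eq_intros)
    hence "((\<lambda>\<epsilon>. b (z0 - \<i> * of_real \<epsilon>)) \<longlongrightarrow> b z0) (at_right (0::real))"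
      by (rule isCont_tendsto_compose[OF contb])
    hence "((\<lambda>\<epsilon>. 2 * pi * norm (b (z0 - \<i> * of_real \<epsilon>) * \<psi> X)) \<longlongrightarrow> 2 * pi * norm (b z0 * \<psi> X)) (at_right (0::real))"
      by (intro tendsto_intros)
    thus "2 * pi * norm (b z0 * \<psi> X) \<le> 16 * 27 ^ M * C / X + \<eta>"
      using ev by (rule tendsto_upperbound) simp
  qed
  \<comment> \<open>At the fixed point z0 the contour weight tends to 1 while the bound decays like
    1/X.\<close>
  have "((\<lambda>X. 1 - z0\<^sup>2 / of_real (X\<^sup>2)) \<longlongrightarrow> 1 - 0) (at_top :: real filter)"
  proof (intro tendsto_intros tendsto_divide_0[OF tendsto_const])
    have "filterlim (\<lambda>X::real. X\<^sup>2) at_top at_top"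
      by (intro filterlim_pow_at_top filterlim_ident) auto
    thus "filterlim (\<lambda>X::real. complex_of_real (X\<^sup>2)) at_infinity at_top"
      by (intro filterlim_norm_at_top_imp_at_infinity) (simp add: norm_power)
  qed
  from tendsto_power[OF this, of M] have "(\<psi> \<longlongrightarrow> 1) at_top"
    by (simp add: \<psi>_def[abs_def])
  hence "((\<lambda>X. 2 * pi * norm (b z0 * \<psi> X)) \<longlongrightarrow> 2 * pi * norm (b z0 * 1)) at_top"
    by (intro tendsto_intros)
  moreover have "((\<lambda>X::real. 16 * 27 ^ M * C / X) \<longlongrightarrow> 0) at_top"
    by (intro tendsto_divide_0[OF tendsto_const] filterlim_at_top_imp_at_infinity filterlim_ident)
  moreover have "eventually (\<lambda>X. 2 * pi * norm (b z0 * \<psi> X) \<le> 16 * 27 ^ M * C / X) at_top"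
    using eventually_gt_at_top[of 0] eventually_ge_at_top[of R] eventually_ge_at_top[of "2 * norm z0"]
    by eventually_elim (rule *)
  ultimately have "2 * pi * norm (b z0 * 1) \<le> 0"
    by (intro tendsto_le[of at_top]) auto
  thus ?thesis using pi_gt_zero by (auto simp: mult_le_0_iff)
qed

text \<open>Induction on the order of growth. Replacing a and b by divided differences at -\<i>
  gains one power of |z| and keeps the absence of a jump; order 0 is the vanishing statement. The
  polynomial is built as an expansion at -\<i>, hence its argument z + \<i>.\<close>

lemma half_plane_pair_polynomial:
  fixes a b :: "complex \<Rightarrow> complex"
  assumes "a holomorphic_on {z. Im z > 0}" and "b holomorphic_on {z. Im z < 0}"
    and "\<And>x::real. ((\<lambda>z. a z - b (cnj z)) \<longlongrightarrow> 0) (at (of_real x) within {z. Im z > 0})"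
    and "\<And>x::real. ((\<lambda>z. of_real (Im z) * b (cnj z)) \<longlongrightarrow> 0) (at (of_real x) within {z. Im z > 0})"
    and "C \<ge> 0"
    and "\<And>z. Im z > 0 \<Longrightarrow> norm z \<ge> R \<Longrightarrow> norm (a z) \<le> C * norm z ^ n / norm z * (norm z / Im z) ^ M"
    and "\<And>z. Im z < 0 \<Longrightarrow> norm z \<ge> R \<Longrightarrow> norm (b z) \<le> C * norm z ^ n / norm z * (norm z / - Im z) ^ M"
  shows "\<exists>q. \<forall>z. Im z < 0 \<longrightarrow> b z = poly q (z + \<i>)"
  using assms
proof (induction n arbitrary: a b C R)
  case 0
  hence "b z = 0" if "Im z < 0" for z
    using half_plane_pair_vanish[of a b C R M z] that by simp
  thus ?case by (intro exI[of _ 0]) simp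
next
  case (Suc n)
  \<comment> \<open>The same constant is subtracted from both functions, so the jump is unchanged,
    and b - c vanishes at -\<i>, where the divisor has its zero.\<close>
  define c where "c = b (- \<i>)"
  define a' where "a' z = (a z - c) / (z + \<i>)" for z
  define b' where "b' z = (if z = - \<i> then deriv b (- \<i>) else (b z - c) / (z + \<i>))" for z
  have a': "a' holomorphic_on {z. Im z > 0}"
    unfolding a'_def by (intro holomorphic_intros Suc.prems) (auto simp: complex_eq_iff)
  have b': "b' holomorphic_on {z. Im z < 0}"
    using pole_lemma[OF Suc.prems(2), of "- \<i>"]
    by (simp add: b'_def[abs_def] c_def interior_open open_halfspace_Im_lt cong: if_cong)
  have nz: "of_real x + \<i> \<noteq> 0" "of_real x - \<i> \<noteq> 0" for x :: real by (auto simp: complex_eq_iff)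
  have lim: "((\<lambda>z. z) \<longlongrightarrow> complex_of_real x) (at (of_real x) within {z. Im z > 0})"
    "((\<lambda>z. cnj z) \<longlongrightarrow> complex_of_real x) (at (of_real x) within {z. Im z > 0})" for x
    by (auto intro!: tendsto_eq_intros)
  have inv: "((\<lambda>z. 1 / (z + \<i>)) \<longlongrightarrow> 1 / (of_real x + \<i>)) (at (of_real x) within {z. Im z > 0})"
    "((\<lambda>z. 1 / (cnj z + \<i>)) \<longlongrightarrow> 1 / (of_real x + \<i>)) (at (of_real x) within {z. Im z > 0})" for x
    by (intro tendsto_intros lim nz)+
  have imc: "((\<lambda>z. of_real (Im z) * c) \<longlongrightarrow> 0) (at (complex_of_real x) within {z. Im z > 0})" for x
    by (auto intro!: tendsto_eq_intros)
  have ne: "eventually (\<lambda>z. Im z > 0 \<and> cnj z \<noteq> - \<i> \<and> z + \<i> \<noteq> 0) (at (complex_of_real x) within {z. Im z > 0})" for x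
  proof -
    have "eventually (\<lambda>z. cnj z \<noteq> - \<i>) (at (complex_of_real x) within {z. Im z > 0})"
      using lim(2)[of x] by (rule tendsto_imp_eventually_ne) (auto simp: complex_eq_iff)
    moreover have "eventually (\<lambda>z. Im z > 0) (at (complex_of_real x) within {z. Im z > 0})"
      by (auto simp: eventually_at_filter)
    ultimately show ?thesis by eventually_elim (auto simp: complex_eq_iff)
  qed
  have jump': "((\<lambda>z. a' z - b' (cnj z)) \<longlongrightarrow> 0) (at (of_real x) within {z. Im z > 0})" for x
  proof -
    \<comment> \<open>The two divisors z + \<i> and cnj z + \<i> differ by 2 \<i> Im z, so division
      leaves an error Im z (b - c) over nonvanishing limits. The smallness assumption on Im z * b is
      what removes it.\<close>
    have "((\<lambda>z. (a z - b (cnj z)) * (1 / (z + \<i>)) + (-2 * \<i>) * (of_real (Im z) * b (cnj z) - of_real (Im z) * c) *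
           (1 / (z + \<i>)) * (1 / (cnj z + \<i>))) \<longlongrightarrow>
        0 * (1 / (of_real x + \<i>)) + (-2 * \<i>) * (0 - 0) * (1 / (of_real x + \<i>)) * (1 / (of_real x + \<i>)))
        (at (complex_of_real x) within {z. Im z > 0})"
      by (intro tendsto_add tendsto_mult tendsto_diff tendsto_const Suc.prems(3,4) inv imc)
    hence L: "((\<lambda>z. (a z - b (cnj z)) * (1 / (z + \<i>)) + (-2 * \<i>) * (of_real (Im z) * b (cnj z) - of_real (Im z) * c) *
           (1 / (z + \<i>)) * (1 / (cnj z + \<i>))) \<longlongrightarrow> 0) (at (complex_of_real x) within {z. Im z > 0})"
      by (simp only: mult_zero_left mult_zero_right diff_self add_0)
    have "eventually (\<lambda>z. (a z - b (cnj z)) * (1 / (z + \<i>)) + (-2 * \<i>) * (of_real (Im z) * b (cnj z) - of_real (Im z) * c) *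
           (1 / (z + \<i>)) * (1 / (cnj z + \<i>)) = a' z - b' (cnj z)) (at (complex_of_real x) within {z. Im z > 0})"
      using ne
    proof eventually_elim
      case (elim z)
      define w where "w = cnj z + \<i>"
      have w: "w \<noteq> 0" using elim by (auto simp: w_def add_eq_0_iff2)
      have im: "(- 2 * \<i>) * of_real (Im z) = w - (z + \<i>)"
        by (simp add: w_def complex_eq_iff)
      have im': "(-2 * \<i>) * (of_real (Im z) * b (cnj z) - of_real (Im z) * c) = (w - (z + \<i>)) * (b (cnj z) - c)"
        unfolding im[symmetric] by (simp add: algebra_simps)
      have key: "(P - Q) * (1 / v) + (w - v) * (Q - c) * (1 / v) * (1 / w) = (P - c) / v - (Q - c) / w"
        if "v \<noteq> 0" for P Q v :: complex
        using that w by (simp add: field_simps)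
      have "(a z - b (cnj z)) * (1 / (z + \<i>)) + (-2 * \<i>) * (of_real (Im z) * b (cnj z) - of_real (Im z) * c) *
           (1 / (z + \<i>)) * (1 / w) = (a z - c) / (z + \<i>) - (b (cnj z) - c) / w"
        unfolding im' by (rule key) (use elim in simp)
      moreover have "b' (cnj z) = (b (cnj z) - c) / w"
        using elim by (simp add: b'_def w_def)
      ultimately show ?case by (simp only: a'_def w_def)
    qed
    with L show ?thesis
      by (rule Lim_transform_eventually)
  qed
  have small': "((\<lambda>z. of_real (Im z) * b' (cnj z)) \<longlongrightarrow> 0) (at (of_real x) within {z. Im z > 0})" for x
  proof -
    have "((\<lambda>z. (of_real (Im z) * b (cnj z) - of_real (Im z) * c) * (1 / (cnj z + \<i>))) \<longlongrightarrow>
        (0 - 0) * (1 / (of_real x + \<i>))) (at (complex_of_real x) within {z. Im z > 0})"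
      by (intro tendsto_mult tendsto_diff Suc.prems(4) inv imc)
    hence L: "((\<lambda>z. (of_real (Im z) * b (cnj z) - of_real (Im z) * c) * (1 / (cnj z + \<i>))) \<longlongrightarrow> 0)
        (at (complex_of_real x) within {z. Im z > 0})"
      by (simp only: mult_zero_left diff_self)
    have "eventually (\<lambda>z. (of_real (Im z) * b (cnj z) - of_real (Im z) * c) * (1 / (cnj z + \<i>)) =
        of_real (Im z) * b' (cnj z)) (at (complex_of_real x) within {z. Im z > 0})"
      using ne by eventually_elim (simp add: b'_def right_diff_distrib diff_divide_distrib)
    with L show ?thesis
      by (rule Lim_transform_eventually)
  qed
  \<comment> \<open>The factor 2 comes from |z + \<i>| \<ge> |z|/2 for |z| \<ge> 2; the constant |c|
    is absorbed since |z|^n (|z| / y)^M \<ge> 1.\<close>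
  define C' where "C' = 2 * (C + norm c)"
  have quot: "norm ((v - c) / (z + \<i>)) \<le> C' * norm z ^ n / norm z * (norm z / y) ^ M"
    if z: "norm z \<ge> max R 2" and y: "y > 0" "y \<le> norm z"
      and v: "norm v \<le> C * norm z ^ Suc n / norm z * (norm z / y) ^ M" for v z y
  proof -
    have zi: "norm (z + \<i>) \<ge> norm z / 2"
      using norm_triangle_ineq2[of z "- \<i>"] z by simp
    have "1 \<le> norm z / y" using y by simp
    hence "1 * 1 \<le> norm z ^ n * (norm z / y) ^ M" using z by (intro mult_mono one_le_power) auto
    from mult_left_mono[OF this, of "norm c"]
    have "norm c \<le> norm c * (norm z ^ n * (norm z / y) ^ M)" by simp
    moreover have eq: "C * norm z ^ Suc n / norm z * (norm z / y) ^ M = C * (norm z ^ n * (norm z / y) ^ M)"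
      using z by (auto simp: field_simps)
    ultimately have "norm (v - c) \<le> (C + norm c) * (norm z ^ n * (norm z / y) ^ M)"
      using norm_triangle_ineq4[of v c] v[unfolded eq] unfolding distrib_right by linarith
    hence "norm ((v - c) / (z + \<i>)) \<le> (C + norm c) * (norm z ^ n * (norm z / y) ^ M) / (norm z / 2)"
 
      unfolding norm_divide using zi z order.trans[OF norm_ge_zero] by (intro frac_le) auto
    also have "\<dots> = C' * norm z ^ n / norm z * (norm z / y) ^ M" by (simp add: C'_def)
    finally show ?thesis .
  qed
  have "\<exists>q. \<forall>z. Im z < 0 \<longrightarrow> b' z = poly q (z + \<i>)"
  proof (rule Suc.IH[OF a' b' jump' small'])
    show "C' \<ge> 0" using Suc.prems(5) by (simp add: C'_def)
    show "norm (a' z) \<le> C' * norm z ^ n / norm z * (norm z / Im z) ^ M"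
      if "Im z > 0" "norm z \<ge> max R 2" for z
      unfolding a'_def using that abs_Im_le_cmod[of z] by (intro quot Suc.prems(6)) auto
    show "norm (b' z) \<le> C' * norm z ^ n / norm z * (norm z / - Im z) ^ M"
      if "Im z < 0" "norm z \<ge> max R 2" for z
    proof -
      have "z \<noteq> - \<i>" using that by auto
      hence "b' z = (b z - c) / (z + \<i>)" by (simp add: b'_def)
      thus ?thesis using that abs_Im_le_cmod[of z] by (simp only:) (intro quot Suc.prems(7), auto)
    qed
  qed
  then obtain q where q: "\<And>z. Im z < 0 \<Longrightarrow> b' z = poly q (z + \<i>)" by blast
  have "b z = poly (pCons c q) (z + \<i>)" if "Im z < 0" for z
  proof (cases "z = - \<i>")
    case False
    hence "z + \<i> \<noteq> 0" by (simp add: add_eq_0_iff2)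
    thus ?thesis using q[OF that] False by (auto simp: b'_def field_simps)
  qed (simp add: c_def)
  thus ?case by blast
qed

section \<open>Rigidity on the disc\<close>

text \<open>With w the disc image of z, a(z) - b(cnj z) is h(w) + l(cnj w), that is U minus the
  difference of potential and l; both tend to 0 off the point 1. Hence l is a polynomial in the
  half-plane coordinate, and the inversion of the transform gives F.\<close>

lemma disc_rigidity:
  fixes U F :: "complex \<Rightarrow> complex"
  assumes \<alpha>: "\<alpha> > -1" and F: "F holomorphic_on ball 0 1"
    and U: "\<And>w. norm w < 1 \<Longrightarrow> \<exists>P. (U has_derivative
         (\<lambda>h. P * h + (1 - w * cnj w) powr of_real \<alpha> * F (cnj w) * cnj h)) (at w)"
    and boundU: "\<And>w. norm w < 1 \<Longrightarrow> norm (U w) \<le> K * (1 / (1 - norm w)) ^ M"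
    and boundF: "\<And>\<omega>. norm \<omega> < 1 \<Longrightarrow> norm (F \<omega>) \<le> K * (1 / (1 - norm \<omega>)) ^ M"
    and limF: "\<And>w0. norm w0 = 1 \<Longrightarrow> w0 \<noteq> 1 \<Longrightarrow> (weighted_norm \<alpha> F \<longlongrightarrow> 0) (at w0 within ball 0 1)"
    and limU: "\<And>w0. norm w0 = 1 \<Longrightarrow> w0 \<noteq> 1 \<Longrightarrow> (U \<longlongrightarrow> 0) (at w0 within ball 0 1)"
  obtains p where "\<And>\<omega>. norm \<omega> < 1 \<Longrightarrow> F \<omega> = (1 - \<omega>) powr (- of_real \<alpha> - 2) * poly p (\<omega> / (1 - \<omega>))"
proof -
  define R where "R = radial_transform \<alpha> F"
  define A where "A = complex_of_real (\<alpha> + 1)"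
  have A: "A \<noteq> 0" "norm A = \<alpha> + 1" using \<alpha> unfolding A_def of_real_eq_0_iff norm_of_real by auto
  define h where "h w = U w - disc_potential \<alpha> F w" for w
  define a where "a z = h (cayley_inv z)" for z
  \<comment> \<open>The reflected map conjugating \<open>cayley_inv\<close> on both sides: it takes
    the lower half-plane to the disc and satisfies \<Omega>(cnj z) = cnj w when w is the image of
    z.\<close>
  define \<Omega> where "\<Omega> z = (z + \<i>) / (z - \<i>)" for z :: complex
  define b where "b z = - (\<Omega> z * R (\<Omega> z) / A)" for z
  have hol_h: "h holomorphic_on ball 0 1"
    unfolding h_def by (rule disc_decomposition[OF F U])
  have hol_R: "R holomorphic_on ball 0 1"
    unfolding R_def by (rule radial_transform_holomorphic[OF \<alpha> F])
  have \<Omega>cnj: "\<Omega> (cnj z) = cnj (cayley_inv z)" for z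
    by (simp add: \<Omega>_def cayley_inv_def)
  have \<Omega>: "norm (\<Omega> z) = norm (cayley_inv (cnj z))" for z
    using \<Omega>cnj[of "cnj z"] by simp
  have \<Omega>ball: "norm (\<Omega> z) < 1" if "Im z < 0" for z
    unfolding \<Omega> by (rule norm_cayley_inv_less) (use that in simp)
  have hol_a: "a holomorphic_on {z. Im z > 0}"
  proof -
    have "cayley_inv holomorphic_on {z. Im z > 0}"
      unfolding cayley_inv_def[abs_def] by (intro holomorphic_intros Im_ge_0_imp_nonzero) auto
    from holomorphic_on_compose_gen[OF this hol_h] show ?thesis
      using norm_cayley_inv_less by (force simp: o_def a_def[abs_def])
  qed
  have hol_b: "b holomorphic_on {z. Im z < 0}"
  proof -
    have \<Omega>hol: "\<Omega> holomorphic_on {z. Im z < 0}"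
      unfolding \<Omega>_def[abs_def] by (intro holomorphic_intros) auto
    from holomorphic_on_compose_gen[OF this hol_R] have "(\<lambda>z. R (\<Omega> z)) holomorphic_on {z. Im z < 0}"
      using \<Omega>ball by (force simp: o_def)
    thus ?thesis unfolding b_def using A by (intro holomorphic_intros \<Omega>hol) auto
  qed
  have jump: "((\<lambda>z. a z - b (cnj z)) \<longlongrightarrow> 0) (at (of_real x) within {z. Im z > 0})" for x
  proof -
    note w0 = cayley_inv_of_real[of x]
    have "((\<lambda>w. U w - (disc_potential \<alpha> F w - cnj w * R (cnj w) / A)) \<longlongrightarrow> 0 - 0)
        (at (cayley_inv (of_real x)) within ball 0 1)"
      unfolding R_def A_def by (intro tendsto_diff limU[OF w0] radial_boundary_limits(1)[OF F \<alpha> limF w0])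
    from filterlim_compose[OF this filterlim_cayley_inv]
    show ?thesis by (simp add: a_def b_def h_def \<Omega>cnj algebra_simps)
  qed
  have small: "((\<lambda>z. of_real (Im z) * b (cnj z)) \<longlongrightarrow> 0) (at (of_real x) within {z. Im z > 0})" for x
  proof -
    note w0 = cayley_inv_of_real[of x]
    have "((\<lambda>w. of_real (1 - norm w) * R (cnj w)) \<longlongrightarrow> 0) (at (cayley_inv (of_real x)) within ball 0 1)"
      unfolding R_def by (rule radial_boundary_limits(2)[OF F \<alpha> limF w0])
    from filterlim_compose[OF this filterlim_cayley_inv]
    have 1: "((\<lambda>z. of_real (1 - norm (cayley_inv z)) * R (cnj (cayley_inv z))) \<longlongrightarrow> 0) (at (of_real x) within {z. Im z > 0})" .
    \<comment> \<open>Im z equals (1 - |w|) times a factor with a finite limit at real points; this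
      transfers the slow growth of the transform to the half-plane.\<close>
    let ?c = "\<lambda>z. - (of_real ((1 + norm (cayley_inv z)) * (norm (z + \<i>))\<^sup>2 / 4) * cnj (cayley_inv z) / A)"
    have "((\<lambda>z. ?c z * (of_real (1 - norm (cayley_inv z)) * R (cnj (cayley_inv z)))) \<longlongrightarrow> ?c (of_real x) * 0)
       (at (of_real x) within {z. Im z > 0})"
      by (intro tendsto_mult[OF _ 1] tendsto_intros cayley_inv_tendsto A) auto
    moreover have "eventually (\<lambda>z. ?c z * (of_real (1 - norm (cayley_inv z)) * R (cnj (cayley_inv z))) =
        of_real (Im z) * b (cnj z)) (at (of_real x) within {z. Im z > 0})"
      unfolding eventually_at_filter
    proof (intro always_eventually allI impI)
      fix z :: complex assume "z \<in> {z. Im z > 0}"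
      hence z: "Im z > 0" by simp
      have "(norm (z + \<i>))\<^sup>2 \<noteq> 0" using Im_ge_0_imp_nonzero[of z] z by simp
      hence "Im z = (1 + norm (cayley_inv z)) * (norm (z + \<i>))\<^sup>2 / 4 * (1 - norm (cayley_inv z))"
        using one_minus_norm_cayley_inv[of z] z by (simp add: field_simps power2_eq_square)
      hence "complex_of_real (Im z) = of_real ((1 + norm (cayley_inv z)) * (norm (z + \<i>))\<^sup>2 / 4) * of_real (1 - norm (cayley_inv z))"
        by (metis of_real_mult)
      thus "?c z * (of_real (1 - norm (cayley_inv z)) * R (cnj (cayley_inv z))) = of_real (Im z) * b (cnj z)"
        by (simp only: b_def \<Omega>cnj) simp
    qed
    ultimately show ?thesis by (simp add: Lim_transform_eventually)
  qed
  have K: "K \<ge> 0" using order.trans[OF norm_ge_zero boundF[of 0]] by simp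
  define K2 where "K2 = 2 * K + K / (\<alpha> + 1)"
  have K2: "K2 \<ge> 0" "2 * K \<le> K2" "K / (\<alpha> + 1) \<le> K2" using K \<alpha> by (auto simp: K2_def)
  have s1: "1 / (1 - norm w) \<ge> 1" if "norm w < 1" for w :: complex using that by simp
  have bound_h: "norm (h w) \<le> K2 * (1 / (1 - norm w)) ^ Suc M" if w: "norm w < 1" for w
  proof -
    have "K * (1 / (1 - norm w)) ^ M \<le> K * (1 / (1 - norm w)) ^ Suc M"
      using K s1[OF w] by (intro mult_left_mono power_increasing) auto
    hence "norm (h w) \<le> 2 * K * (1 / (1 - norm w)) ^ Suc M"
      using norm_triangle_ineq4[of "U w" "disc_potential \<alpha> F w"] boundU[OF w] disc_potential_bound[OF \<alpha> F boundF w]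
      unfolding h_def by linarith
    also have "\<dots> \<le> K2 * (1 / (1 - norm w)) ^ Suc M"
      using K2 w by (intro mult_right_mono) auto
    finally show ?thesis .
  qed
  have bound_R: "norm (- (\<omega> * R \<omega> / A)) \<le> K2 * (1 / (1 - norm \<omega>)) ^ Suc M" if w: "norm \<omega> < 1" for \<omega>
  proof -
    have "norm (\<omega> * R \<omega>) \<le> 1 * (K * (1 / (1 - norm \<omega>)) ^ M)"
      unfolding norm_mult R_def using w by (intro mult_mono radial_transform_bound[OF \<alpha> F boundF]) auto
    also have "\<dots> \<le> K * (1 / (1 - norm \<omega>)) ^ Suc M"
      unfolding mult_1 using K s1[OF w] by (intro mult_left_mono power_increasing) auto
    finally have "norm (\<omega> * R \<omega>) / (\<alpha> + 1) \<le> K * (1 / (1 - norm \<omega>)) ^ Suc M / (\<alpha> + 1)"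
      using \<alpha> by (intro divide_right_mono) auto
    also have "\<dots> = K / (\<alpha> + 1) * (1 / (1 - norm \<omega>)) ^ Suc M" by simp
    also have "\<dots> \<le> K2 * (1 / (1 - norm \<omega>)) ^ Suc M" using K2 w by (intro mult_right_mono) auto
    finally show ?thesis by (simp only: norm_minus_cancel norm_divide A)
  qed
  define C where "C = K2 * 2 ^ Suc M"
  \<comment> \<open>The disc bound yields |z|^(M+1), which is |z|^n / |z| for n = M + 2 in the
    format of the polynomial criterion.\<close>
  have transfer: "K2 * (1 / (1 - norm (cayley_inv z))) ^ Suc M \<le> C * norm z ^ Suc (Suc M) / norm z * (norm z / Im z) ^ Suc M"
    if z: "Im z > 0" "norm z \<ge> 1" for z
  proof -
    have "K2 * (1 / (1 - norm (cayley_inv z))) ^ Suc M \<le> K2 * (2 * norm z * (norm z / Im z)) ^ Suc M"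
      using inverse_one_minus_cayley_inv_le[OF z] norm_cayley_inv_less[OF z(1)] K2 by (intro mult_left_mono power_mono) auto
    also have "\<dots> = C * norm z ^ Suc M * (norm z / Im z) ^ Suc M"
      by (simp only: C_def power_mult_distrib mult_ac)
    also have "C * norm z ^ Suc M = C * norm z ^ Suc (Suc M) / norm z" using z by auto
    finally show ?thesis .
  qed
  have "\<exists>q. \<forall>z. Im z < 0 \<longrightarrow> b z = poly q (z + \<i>)"
  proof (rule half_plane_pair_polynomial[OF hol_a hol_b jump small])
    show "C \<ge> 0" using K2 by (simp add: C_def)
    show "norm (a z) \<le> C * norm z ^ Suc (Suc M) / norm z * (norm z / Im z) ^ Suc M" if "Im z > 0" "norm z \<ge> 1" for z
      unfolding a_def by (rule order.trans[OF bound_h[OF norm_cayley_inv_less[OF that(1)]] transfer[OF that]])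
    show "norm (b z) \<le> C * norm z ^ Suc (Suc M) / norm z * (norm z / - Im z) ^ Suc M" if "Im z < 0" "norm z \<ge> 1" for z
      using order.trans[OF bound_R[OF \<Omega>ball[OF that(1)], unfolded \<Omega>] transfer[of "cnj z"]] that
      by (simp only: b_def complex_mod_cnj complex_cnj) simp
  qed
  then obtain q where q: "\<And>z. Im z < 0 \<Longrightarrow> b z = poly q (z + \<i>)" by blast
  \<comment> \<open>Accounts for z + \<i> = -2\<i> \<omega>/(1-\<omega>) and for the normalisation
    by -A in b.\<close>
  define Q where "Q = smult (- A) (pcompose q [:0, - 2 * \<i>:])"
  have "\<omega> * radial_transform \<alpha> F \<omega> = poly Q (\<omega> / (1 - \<omega>))" if \<omega>: "norm \<omega> < 1" for \<omega>
  proof -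
    define z where "z = cnj (cayley \<i> (cnj \<omega>))"
    have nz: "1 - \<omega> \<noteq> 0" using \<omega> by auto
    have z: "z = - \<i> * ((1 + \<omega>) / (1 - \<omega>))" by (simp add: z_def cnj_cayley)
    have "Im (cayley \<i> (cnj \<omega>)) > 0" by (rule Im_cayley_pos) (use \<omega> in auto)
    hence im: "Im z < 0" by (simp add: z_def)
    have zi: "z + \<i> = (- 2 * \<i>) * (\<omega> / (1 - \<omega>))" "z - \<i> = - 2 * \<i> / (1 - \<omega>)"
      unfolding z using nz by (simp_all add: field_simps)
    have "\<Omega> z = \<omega>" unfolding \<Omega>_def zi using nz by (simp add: field_simps)
    with q[OF im] have E: "- (\<omega> * R \<omega> / A) = poly q ((- 2 * \<i>) * (\<omega> / (1 - \<omega>)))"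
      by (simp only: b_def zi)
    have "\<omega> * R \<omega> = - A * poly q ((- 2 * \<i>) * (\<omega> / (1 - \<omega>)))"
      unfolding E[symmetric] using A by simp
    moreover have "(- 2 * \<i>) * (\<omega> / (1 - \<omega>)) = \<omega> / (1 - \<omega>) * (- 2 * \<i>)" by (rule mult.commute)
    ultimately show ?thesis by (simp only: R_def Q_def poly_smult poly_pcompose) simp
  qed
  from radial_transform_polynomial_imp[OF \<alpha> F this] show thesis using that by blast
qed

section \<open>Rigidity on the half-plane\<close>

text \<open>On the hyperbolic circle about z0 one has |z| \<le> 4 |z0| and Im z \<ge> Im z0 / 3, so
  the growth quantity changes by at most 16 * 3 = 48.\<close>

lemma half_plane_gradient_growth:
  assumes f: "f holomorphic_on {z. Im z < 0}"
    and u: "\<And>z. Im z > 0 \<Longrightarrow> \<exists>P. (u has_derivative (\<lambda>h. P * h + of_real (Im z powr \<alpha>) * f (cnj z) * cnj h)) (at z)"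
    and C: "C \<ge> 0" and growth: "\<And>z. Im z > 0 \<Longrightarrow> norm (u z) \<le> C * ((1 + (norm z)\<^sup>2) / Im z) ^ N"
  obtains K where "K \<ge> 0"
    "\<And>z. Im z > 0 \<Longrightarrow> Im z powr (\<alpha> + 1) * norm (f (cnj z)) \<le> K * ((1 + (norm z)\<^sup>2) / Im z) ^ N"
proof -
  obtain K where K: "K > 0"
    "\<And>u f z0 S. f holomorphic_on {z. Im z < 0} \<Longrightarrow>
       (\<And>z. Im z > 0 \<Longrightarrow> \<exists>P. (u has_derivative (\<lambda>h. P * h + of_real (Im z powr \<alpha>) * f (cnj z) * cnj h)) (at z)) \<Longrightarrow>
       Im z0 > 0 \<Longrightarrow>
       (\<And>z. Im z \<ge> Im z0 / 3 \<Longrightarrow> norm (z - of_real (Re z0)) \<le> 3 * Im z0 \<Longrightarrow> norm (u z) \<le> S) \<Longrightarrow>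
       Im z0 powr (\<alpha> + 1) * norm (f (cnj z0)) \<le> K * S"
    using half_plane_gradient_bound[of \<alpha>] by blast
  show thesis
  proof
    show "K * (C * 48 ^ N) \<ge> 0" using K C by simp
    fix z0 :: complex assume z0: "Im z0 > 0"
    have "Im z0 powr (\<alpha> + 1) * norm (f (cnj z0)) \<le> K * (C * (48 * ((1 + (norm z0)\<^sup>2) / Im z0)) ^ N)"
    proof (rule K(2)[OF f u z0])
      fix z assume z: "Im z \<ge> Im z0 / 3" "norm (z - of_real (Re z0)) \<le> 3 * Im z0"
      have imz: "Im z > 0" using z z0 by linarith
      have "norm z \<le> norm (z - of_real (Re z0)) + norm (complex_of_real (Re z0))"
        using norm_triangle_sub[of z "of_real (Re z0)"] by (simp add: add.commute)
      also have "\<dots> \<le> 4 * norm z0"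
        using z(2) abs_Im_le_cmod[of z0] abs_Re_le_cmod[of z0] unfolding norm_of_real by linarith
      finally have "(norm z)\<^sup>2 \<le> (4 * norm z0)\<^sup>2" by (intro power_mono) auto
      hence "1 + (norm z)\<^sup>2 \<le> 16 * (1 + (norm z0)\<^sup>2)" by (simp add: power_mult_distrib)
      hence "(1 + (norm z)\<^sup>2) / Im z \<le> (16 * (1 + (norm z0)\<^sup>2)) / (Im z0 / 3)"
        using z z0 by (intro frac_le) auto
      also have "\<dots> = 48 * ((1 + (norm z0)\<^sup>2) / Im z0)" by simp
      finally have "C * ((1 + (norm z)\<^sup>2) / Im z) ^ N \<le> C * (48 * ((1 + (norm z0)\<^sup>2) / Im z0)) ^ N"
        using C imz by (intro mult_left_mono power_mono) auto
      thus "norm (u z) \<le> C * (48 * ((1 + (norm z0)\<^sup>2) / Im z0)) ^ N"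
        using growth[OF imz] by linarith
    qed
    thus "Im z0 powr (\<alpha> + 1) * norm (f (cnj z0)) \<le> K * (C * 48 ^ N) * ((1 + (norm z0)\<^sup>2) / Im z0) ^ N"
      by (simp only: power_mult_distrib mult.assoc)
  qed
qed

text \<open>The circle about z0 shrinks to x with z0: its points are within 3 Im z0 + |Re z0 - x|
  \<le> 4 |z0 - x| of x, hence the radius d/4.\<close>

lemma half_plane_gradient_boundary:
  assumes f: "f holomorphic_on {z. Im z < 0}"
    and u: "\<And>z. Im z > 0 \<Longrightarrow> \<exists>P. (u has_derivative (\<lambda>h. P * h + of_real (Im z powr \<alpha>) * f (cnj z) * cnj h)) (at z)"
    and lim: "(u \<longlongrightarrow> 0) (at (of_real x) within {z. Im z > 0})"
  shows "((\<lambda>z. Im z powr (\<alpha> + 1) * norm (f (cnj z))) \<longlongrightarrow> 0) (at (of_real x) within {z. Im z > 0})"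
proof (rule tendstoI)
  fix e :: real assume e: "e > 0"
  obtain K where K: "K > 0"
    "\<And>u f z0 S. f holomorphic_on {z. Im z < 0} \<Longrightarrow>
       (\<And>z. Im z > 0 \<Longrightarrow> \<exists>P. (u has_derivative (\<lambda>h. P * h + of_real (Im z powr \<alpha>) * f (cnj z) * cnj h)) (at z)) \<Longrightarrow>
       Im z0 > 0 \<Longrightarrow>
       (\<And>z. Im z \<ge> Im z0 / 3 \<Longrightarrow> norm (z - of_real (Re z0)) \<le> 3 * Im z0 \<Longrightarrow> norm (u z) \<le> S) \<Longrightarrow>
       Im z0 powr (\<alpha> + 1) * norm (f (cnj z0)) \<le> K * S"
    using half_plane_gradient_bound[of \<alpha>] by blast
  have "e / (2 * K) > 0" using e K by simp
  from tendstoD[OF lim this] obtain d where d: "d > 0"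
    "\<And>z. Im z > 0 \<Longrightarrow> z \<noteq> of_real x \<Longrightarrow> dist z (of_real x) < d \<Longrightarrow> dist (u z) 0 < e / (2 * K)"
    unfolding eventually_at by auto
  have "Im z0 powr (\<alpha> + 1) * norm (f (cnj z0)) < e"
    if z0: "Im z0 > 0" "dist z0 (of_real x) < d / 4" for z0
  proof -
    have "Im z0 powr (\<alpha> + 1) * norm (f (cnj z0)) \<le> K * (e / (2 * K))"
    proof (rule K(2)[OF f u z0(1)])
      fix z assume z: "Im z \<ge> Im z0 / 3" "norm (z - of_real (Re z0)) \<le> 3 * Im z0"
      have imz: "Im z > 0" using z z0 by linarith
      have "norm (z - of_real x) \<le> norm (z - of_real (Re z0)) + norm (complex_of_real (Re z0) - of_real x)"
        using norm_triangle_ineq[of "z - of_real (Re z0)" "of_real (Re z0) - of_real x"] by simp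
      also have "norm (complex_of_real (Re z0) - of_real x) = \<bar>Re (z0 - of_real x)\<bar>"
        by (simp flip: of_real_diff)
      finally have "dist z (of_real x) < d"
        using z(2) abs_Im_le_cmod[of "z0 - of_real x"] abs_Re_le_cmod[of "z0 - of_real x"] z0
        by (simp add: dist_norm)
      moreover have "z \<noteq> of_real x" using imz by auto
      ultimately show "norm (u z) \<le> e / (2 * K)" using d(2)[OF imz] by simp
    qed
    also have "\<dots> < e" using K e by simp
    finally show ?thesis .
  qed
  thus "\<forall>\<^sub>F z in at (complex_of_real x) within {z. Im z > 0}. dist (Im z powr (\<alpha> + 1) * norm (f (cnj z))) 0 < e"
    unfolding eventually_at using d(1) by (intro exI[of _ "d / 4"]) auto
qed

lemma cayley_inv_cayley:
  assumes "w \<noteq> 1"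
  shows "cayley_inv (cayley \<i> w) = w"
proof -
  have nz: "1 - w \<noteq> 0" using assms by simp
  have "cayley \<i> w - \<i> = 2 * \<i> * w / (1 - w)" "cayley \<i> w + \<i> = 2 * \<i> / (1 - w)"
    using nz by (simp_all add: cayley_def field_simps)
  thus ?thesis unfolding cayley_inv_def using nz by simp
qed

lemma cayley_growth:
  assumes w: "norm w < 1"
  shows "(1 + (norm (cayley \<i> w))\<^sup>2) / Im (cayley \<i> w) \<le> 4 * (1 / (1 - norm w))"
proof -
  define z where "z = cayley \<i> w"
  have imz: "Im z > 0" unfolding z_def by (rule Im_cayley_pos) (use w in auto)
  have wz: "cayley_inv z = w" unfolding z_def by (rule cayley_inv_cayley) (use w in auto)
  have eq: "1 - (norm w)\<^sup>2 = 4 * Im z / (norm (z + \<i>))\<^sup>2"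
    using one_minus_norm_cayley_inv[of z] imz by (simp add: wz)
  have n: "norm (z + \<i>) > 0" using Im_ge_0_imp_nonzero[of z] imz by simp
  have "1 + (norm z)\<^sup>2 \<le> (norm (z + \<i>))\<^sup>2"
    unfolding cmod_power2 using imz by (simp add: power2_eq_square algebra_simps)
  hence "(1 + (norm z)\<^sup>2) / Im z \<le> (norm (z + \<i>))\<^sup>2 / Im z" using imz by (intro divide_right_mono) auto
  also have "\<dots> = 4 / (1 - (norm w)\<^sup>2)" unfolding eq using imz n by simp
  also have "\<dots> \<le> 4 / (1 - norm w)"
    using w by (intro divide_left_mono mult_pos_pos) (auto simp: power2_eq_square mult_left_le power_less_one_iff[of _ 2, simplified power2_eq_square])
  finally show ?thesis by (simp add: z_def)
qed

text \<open>Relates the disc weight to y^(\<alpha>+1) |f(cnj z)|. The conversion factor is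
  continuous away from 1, so limits 0 on the real line become limits 0 on the circle without
  1.\<close>

lemma weighted_norm_disc_density:
  assumes w: "norm w < 1"
  shows "weighted_norm \<alpha> (disc_density \<alpha> f \<i>) w =
    2 * norm (1 - w) powr \<alpha> * (Im (cayley \<i> w) powr (\<alpha> + 1) * norm (f (cnj (cayley \<i> w))))"
proof -
  have w1: "w \<noteq> 1" using w by auto
  have w2: "1 - (norm w)\<^sup>2 > 0" using w by (simp add: power_less_one_iff)
  define X where "X = norm (1 - w)"
  have X: "X > 0" using w1 by (simp add: X_def)
  have "norm (disc_density \<alpha> f \<i> (cnj w)) = 2 * norm ((1 - cnj w) powr (- of_real \<alpha> - 2)) * norm (f (cnj (cayley \<i> w)))"
    unfolding disc_density_def cnj_cayley by (simp add: norm_mult)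
  also have "norm ((1 - cnj w) powr (- of_real \<alpha> - 2)) = norm (1 - cnj w) powr (- \<alpha> - 2)"
    by (subst norm_powr_real_powr') auto
  also have "norm (1 - cnj w) = X"
    unfolding X_def by (metis complex_cnj_diff complex_cnj_one complex_mod_cnj)
  finally have 1: "norm (disc_density \<alpha> f \<i> (cnj w)) = 2 * X powr (- \<alpha> - 2) * norm (f (cnj (cayley \<i> w)))" .
  have "Im (cayley \<i> w) = (1 - (norm w)\<^sup>2) * X powr (-2)"
    unfolding Im_cayley[OF w1] X_def by (simp add: powr_minus field_simps)
  hence "Im (cayley \<i> w) powr (\<alpha> + 1) = (1 - (norm w)\<^sup>2) powr (\<alpha> + 1) * X powr (-2 * (\<alpha> + 1))"
    using w2 by (simp add: powr_mult powr_powr)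
  moreover have "X powr \<alpha> * X powr (-2 * (\<alpha> + 1)) = X powr (- \<alpha> - 2)"
    by (simp flip: powr_add)
  hence "2 * X powr \<alpha> * ((P * X powr (-2 * (\<alpha> + 1))) * Q) = P * (2 * X powr (- \<alpha> - 2) * Q)" for P Q
    by (simp add: mult_ac)
  ultimately show ?thesis
    unfolding weighted_norm_def 1 X_def[symmetric] by (simp only:)
qed

lemma norm_one_minus_powr_le:
  assumes \<alpha>: "\<alpha> > -1" and w: "norm (w::complex) < 1"
  shows "norm (1 - w) powr \<alpha> \<le> 2 powr \<bar>\<alpha>\<bar> * (1 / (1 - norm w))"
proof (cases "\<alpha> \<ge> 0")
  case True
  have "norm (1 - w) \<le> 2" using norm_triangle_ineq4[of 1 w] w by simp
  hence "norm (1 - w) powr \<alpha> \<le> 2 powr \<bar>\<alpha>\<bar> * 1" using True by (auto intro: powr_mono2)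
  also have "\<dots> \<le> 2 powr \<bar>\<alpha>\<bar> * (1 / (1 - norm w))" using w by (intro mult_left_mono) auto
  finally show ?thesis .
next
  case False
  have "norm (1 - w) \<ge> 1 - norm w" using norm_triangle_ineq2[of 1 w] by simp
  hence "norm (1 - w) powr \<alpha> \<le> (1 - norm w) powr \<alpha>" using False w by (intro powr_mono2') auto
  also have "\<dots> \<le> (1 - norm w) powr (-1)" using \<alpha> w by (intro powr_mono') auto
  also have "\<dots> = 1 * (1 / (1 - norm w))" using w by (simp add: powr_minus_divide)
  also have "\<dots> \<le> 2 powr \<bar>\<alpha>\<bar> * (1 / (1 - norm w))" using w by (intro mult_right_mono ge_one_powr_ge_zero) auto
  finally show ?thesis .
qed

lemma filterlim_cayley:
  assumes w0: "norm w0 = 1" "w0 \<noteq> 1"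
  obtains x where "filterlim (cayley \<i>) (at (of_real x) within {z. Im z > 0}) (at w0 within ball 0 1)"
proof
  have "Im (cayley \<i> w0) = 0" using Im_cayley[OF w0(2), of \<i>] w0 by simp
  hence eq: "cayley \<i> w0 = of_real (Re (cayley \<i> w0))" by (simp add: complex_eq_iff)
  have "(cayley \<i> \<longlongrightarrow> cayley \<i> w0) (at w0 within ball 0 1)"
    unfolding cayley_def[abs_def] using w0 by (intro tendsto_intros) auto
  moreover have "\<forall>\<^sub>F w in at w0 within ball 0 1. cayley \<i> w \<in> {z. Im z > 0} \<and> cayley \<i> w \<noteq> of_real (Re (cayley \<i> w0))"
    unfolding eventually_at_filter
  proof (intro always_eventually allI impI)
    fix w :: complex assume "w \<in> ball 0 1"
    hence "Im (cayley \<i> w) > 0" by (intro Im_cayley_pos) auto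
    thus "cayley \<i> w \<in> {z. Im z > 0} \<and> cayley \<i> w \<noteq> of_real (Re (cayley \<i> w0))" by auto
  qed
  ultimately show "filterlim (cayley \<i>) (at (of_real (Re (cayley \<i> w0))) within {z. Im z > 0}) (at w0 within ball 0 1)"
    unfolding filterlim_at using eq by simp
qed

lemma antiholomorphic_part_polynomial:
  assumes \<alpha>: "\<alpha> > -1" and f: "f holomorphic_on {z. Im z < 0}"
    and u: "\<And>z. Im z > 0 \<Longrightarrow> \<exists>P. (u has_derivative (\<lambda>h. P * h + of_real (Im z powr \<alpha>) * f (cnj z) * cnj h)) (at z)"
    and C: "C \<ge> 0" and growth: "\<And>z. Im z > 0 \<Longrightarrow> norm (u z) \<le> C * ((1 + (norm z)\<^sup>2) / Im z) ^ N"
    and lim: "\<And>x::real. (u \<longlongrightarrow> 0) (at (of_real x) within {z. Im z > 0})"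
  obtains q where "\<And>z. Im z < 0 \<Longrightarrow> f z = poly q z"
proof -
  define F where "F = disc_density \<alpha> f \<i>"
  define U where "U w = (1 - w) powr of_real \<alpha> * u (cayley \<i> w)" for w
  define g where "g z = Im z powr (\<alpha> + 1) * norm (f (cnj z))" for z
  obtain K where K: "K \<ge> 0" "\<And>z. Im z > 0 \<Longrightarrow> g z \<le> K * ((1 + (norm z)\<^sup>2) / Im z) ^ N"
    using half_plane_gradient_growth[OF f u C growth] unfolding g_def by blast
  have F: "F holomorphic_on ball 0 1"
    unfolding F_def by (rule disc_density_holomorphic[OF f]) simp
  have derU: "\<exists>P. (U has_derivative (\<lambda>h. P * h + (1 - w * cnj w) powr of_real \<alpha> * F (cnj w) * cnj h)) (at w)"
    if w: "norm w < 1" for w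
  proof -
    have "Im (cayley \<i> w) > 0" by (rule Im_cayley_pos) (use w in auto)
    from u[OF this] obtain P where
      D: "(u has_derivative (\<lambda>h. P * h + of_real (Im (cayley \<i> w) powr \<alpha>) * f (cnj (cayley \<i> w)) * cnj h)) (at (cayley \<i> w))"
      by blast
    show ?thesis
      unfolding U_def[abs_def] F_def
      by (rule cayley_pullback_has_derivative[where p = P and f = f, OF D refl _ w]) simp
  qed
  have imc: "Im (cayley \<i> w) > 0" if "norm w < 1" for w
    by (rule Im_cayley_pos) (use that in auto)
  define L where "L = 2 powr \<bar>\<alpha>\<bar>"
  have L: "L \<ge> 0" by (simp add: L_def)
  have pos: "((1 + (norm (cayley \<i> w))\<^sup>2) / Im (cayley \<i> w)) ^ N \<le> 4 ^ N * (1 / (1 - norm w)) ^ N"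
    if w: "norm w < 1" for w
  proof -
    have "((1 + (norm (cayley \<i> w))\<^sup>2) / Im (cayley \<i> w)) ^ N \<le> (4 * (1 / (1 - norm w))) ^ N"
      using cayley_growth[OF w] imc[OF w] by (intro power_mono divide_nonneg_nonneg) auto
    thus ?thesis by (simp only: power_mult_distrib)
  qed
  \<comment> \<open>An integer exponent to dominate (1 - |w|^2)^(-(\<alpha>+1)) when F is recovered
    from its weighted norm. In M below, N is the growth order of u and the additional 1 pays for |1
    - w|^\<alpha> when \<alpha> is negative.\<close>
  obtain P :: nat where P: "\<alpha> + 1 \<le> real P" using real_arch_simple by blast
  define M where "M = Suc (N + P)"
  define K' where "K' = L * (C * 4 ^ N) + 2 * L * (K * 4 ^ N)"
  have K': "L * (C * 4 ^ N) \<le> K'" "2 * L * (K * 4 ^ N) \<le> K'" "K' \<ge> 0"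
    using L C K by (auto simp: K'_def)
  have s1: "1 / (1 - norm w) \<ge> 1" if "norm w < 1" for w :: complex using that by simp
  have boundU: "norm (U w) \<le> K' * (1 / (1 - norm w)) ^ M" if w: "norm w < 1" for w
  proof -
    let ?s = "1 / (1 - norm w)"
    have "norm (u (cayley \<i> w)) \<le> C * (4 ^ N * ?s ^ N)"
      by (rule order.trans[OF growth[OF imc[OF w]] mult_left_mono[OF pos[OF w] C]])
    moreover have "norm ((1 - w) powr of_real \<alpha>) \<le> L * ?s"
      using norm_one_minus_powr_le[OF \<alpha> w] by (simp add: norm_powr_real_powr' L_def)
    ultimately have "norm (U w) \<le> (L * ?s) * (C * (4 ^ N * ?s ^ N))"
      unfolding U_def norm_mult using L w by (intro mult_mono) auto
    also have "\<dots> = L * (C * 4 ^ N) * ?s ^ Suc N" by (simp only: power_Suc mult_ac)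
    also have "\<dots> \<le> K' * ?s ^ M"
      using K' L C s1[OF w] w by (intro mult_mono power_increasing) (auto simp: M_def intro!: divide_nonneg_nonneg)
    finally show ?thesis .
  qed
  have wn: "weighted_norm \<alpha> F w = 2 * norm (1 - w) powr \<alpha> * g (cayley \<i> w)" if "norm w < 1" for w
    unfolding F_def g_def by (rule weighted_norm_disc_density[OF that])
  have boundF: "norm (F \<omega>) \<le> K' * (1 / (1 - norm \<omega>)) ^ M" if \<omega>: "norm \<omega> < 1" for \<omega>
  proof -
    define w where "w = cnj \<omega>"
    have w: "norm w < 1" "norm w = norm \<omega>" using \<omega> by (auto simp: w_def)
    define s where "s = 1 / (1 - norm w)"
    have s: "s \<ge> 1" unfolding s_def by (rule s1[OF w(1)])
    have "g (cayley \<i> w) \<le> K * (4 ^ N * s ^ N)"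
      unfolding s_def by (rule order.trans[OF K(2)[OF imc[OF w(1)]] mult_left_mono[OF pos[OF w(1)] K(1)]])
    moreover have "norm (1 - w) powr \<alpha> \<le> L * s"
      using norm_one_minus_powr_le[OF \<alpha> w(1)] by (simp add: s_def L_def)
    ultimately have W: "weighted_norm \<alpha> F w \<le> 2 * (L * s) * (K * (4 ^ N * s ^ N))"
      unfolding wn[OF w(1)] using L s by (intro mult_mono) (auto simp: g_def)
    have pos1: "1 - (norm w)\<^sup>2 \<ge> 1 - norm w"
      using w by (simp add: power2_eq_square mult_left_le)
    have "(1 - (norm w)\<^sup>2) powr (- (\<alpha> + 1)) \<le> (1 - norm w) powr (- (\<alpha> + 1))"
      using pos1 \<alpha> w by (intro powr_mono2') auto
    also have "\<dots> \<le> (1 - norm w) powr (- real P)" using P w by (intro powr_mono') auto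
    also have "\<dots> = s ^ P" using w by (simp add: s_def powr_minus powr_realpow inverse_eq_divide power_one_over)
    finally have S: "(1 - (norm w)\<^sup>2) powr (- (\<alpha> + 1)) \<le> s ^ P" .
    have "norm (F \<omega>) = (1 - (norm w)\<^sup>2) powr (- (\<alpha> + 1)) * weighted_norm \<alpha> F w"
      using pos1 w by (simp add: weighted_norm_def w_def flip: mult.assoc powr_add)
    also have "\<dots> \<le> s ^ P * (2 * (L * s) * (K * (4 ^ N * s ^ N)))"
      using W S s by (intro mult_mono weighted_norm_nonneg) auto
    also have "\<dots> = 2 * L * (K * 4 ^ N) * s ^ M"
      by (simp add: M_def power_add)
    also have "\<dots> \<le> K' * s ^ M" using K' s by (intro mult_right_mono) auto
    finally show ?thesis unfolding s_def w(2) .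
  qed
  have limg: "((\<lambda>w. g (cayley \<i> w)) \<longlongrightarrow> 0) (at w0 within ball 0 1)"
    and limu: "((\<lambda>w. u (cayley \<i> w)) \<longlongrightarrow> 0) (at w0 within ball 0 1)"
    if w0: "norm w0 = 1" "w0 \<noteq> 1" for w0
  proof -
    obtain x where x: "filterlim (cayley \<i>) (at (of_real x) within {z. Im z > 0}) (at w0 within ball 0 1)"
      using filterlim_cayley[OF w0] by blast
    show "((\<lambda>w. g (cayley \<i> w)) \<longlongrightarrow> 0) (at w0 within ball 0 1)"
      using filterlim_compose[OF half_plane_gradient_boundary[OF f u lim] x] by (simp add: g_def)
    show "((\<lambda>w. u (cayley \<i> w)) \<longlongrightarrow> 0) (at w0 within ball 0 1)"
      by (rule filterlim_compose[OF lim x])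
  qed
  have limF: "(weighted_norm \<alpha> F \<longlongrightarrow> 0) (at w0 within ball 0 1)" if w0: "norm w0 = 1" "w0 \<noteq> 1" for w0
  proof -
    have "((\<lambda>w. 2 * norm (1 - w) powr \<alpha> * g (cayley \<i> w)) \<longlongrightarrow> 2 * norm (1 - w0) powr \<alpha> * 0) (at w0 within ball 0 1)"
      using w0 by (intro tendsto_mult tendsto_powr tendsto_intros limg) auto
    hence "((\<lambda>w. 2 * norm (1 - w) powr \<alpha> * g (cayley \<i> w)) \<longlongrightarrow> 0) (at w0 within ball 0 1)"
      by simp
    thus ?thesis
      by (rule Lim_transform_eventually) (auto simp: eventually_at_filter wn)
  qed
  have limU: "(U \<longlongrightarrow> 0) (at w0 within ball 0 1)" if w0: "norm w0 = 1" "w0 \<noteq> 1" for w0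
  proof -
    have "((\<lambda>w. norm (1 - w) powr \<alpha> * norm (u (cayley \<i> w))) \<longlongrightarrow> norm (1 - w0) powr \<alpha> * 0) (at w0 within ball 0 1)"
      using w0 tendsto_norm[OF limu[OF w0]] by (intro tendsto_mult tendsto_powr tendsto_intros) auto
    hence "((\<lambda>w. norm (U w)) \<longlongrightarrow> 0) (at w0 within ball 0 1)"
      by (simp add: U_def norm_mult norm_powr_real_powr')
    thus ?thesis by (simp only: tendsto_norm_zero_iff)
  qed
  obtain p where p: "\<And>\<omega>. norm \<omega> < 1 \<Longrightarrow> F \<omega> = (1 - \<omega>) powr (- of_real \<alpha> - 2) * poly p (\<omega> / (1 - \<omega>))"
    using disc_rigidity[OF \<alpha> F derU boundU boundF limF limU] by blast
  \<comment> \<open>Comes from \<omega>/(1-\<omega>) = -1/2 + (\<i>/2) z; the outer factor \<i>/2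
    undoes the -2\<i> in the density.\<close>
  define q where "q = smult (\<i> / 2) (pcompose p [: -1/2, \<i> / 2 :])"
  have "f z = poly q z" if z: "Im z < 0" for z
  proof -
    define w where "w = cayley_inv (cnj z)"
    define \<omega> where "\<omega> = cnj w"
    have w: "norm w < 1" unfolding w_def by (rule norm_cayley_inv_less) (use z in simp)
    hence \<omega>: "norm \<omega> < 1" by (simp add: \<omega>_def)
    have cz: "cayley \<i> w = cnj z" unfolding w_def by (rule cayley_cayley_inv) (use z in simp)
    have zi: "z - \<i> \<noteq> 0" using z by auto
    have \<omega>z: "\<omega> = (z + \<i>) / (z - \<i>)" by (simp add: \<omega>_def w_def cayley_inv_def)
    have nz: "1 - \<omega> \<noteq> 0" using \<omega> by auto
    have "F \<omega> = - 2 * \<i> * (1 - \<omega>) powr (- of_real \<alpha> - 2) * f z"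
      using cz cnj_cayley[of \<i> w] unfolding F_def disc_density_def \<omega>_def by simp
    with p[OF \<omega>] have "(1 - \<omega>) powr (- of_real \<alpha> - 2) * (- 2 * \<i> * f z) = (1 - \<omega>) powr (- of_real \<alpha> - 2) * poly p (\<omega> / (1 - \<omega>))"
      by (simp add: mult_ac)
    moreover have "(1 - \<omega>) powr (- of_real \<alpha> - 2) \<noteq> 0" using nz by simp
    ultimately have E1: "- 2 * \<i> * f z = poly p (\<omega> / (1 - \<omega>))"
      by (rule mult_left_cancel[THEN iffD1, rotated])
    have E2: "\<omega> / (1 - \<omega>) = -1/2 + z * (\<i> / 2)"
    proof -
      have e: "1 - \<omega> = - 2 * \<i> / (z - \<i>)" unfolding \<omega>z using zi by (simp add: field_simps)
      have "\<omega> / (1 - \<omega>) = ((z + \<i>) / (z - \<i>)) / (- 2 * \<i> / (z - \<i>))"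
        unfolding e by (simp only: \<omega>z)
      also have "\<dots> = (z + \<i>) / (- 2 * \<i>)" using zi by simp
      also have "\<dots> = -1/2 + z * (\<i> / 2)" by (simp add: field_simps)
      finally show ?thesis .
    qed
    have "f z = \<i> / 2 * (- 2 * \<i> * f z)" by simp
    also have "\<dots> = \<i> / 2 * poly p (-1/2 + z * (\<i> / 2))" by (simp only: E1 E2)
    finally have "f z = \<i> / 2 * poly p (-1/2 + z * (\<i> / 2))" .
    thus ?thesis by (simp add: q_def poly_pcompose)
  qed
  thus thesis by (rule that)
qed

section \<open>Uniqueness, reduction of the hypotheses, and conclusion\<close>

lemma holomorphic_zero_boundary_imp_zero:
  assumes h: "h holomorphic_on {z. Im z > 0}"
    and lim: "\<And>x::real. (h \<longlongrightarrow> 0) (at (of_real x) within {z. Im z > 0})"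
    and z: "Im z > 0"
  shows "h z = 0"
proof -
  define H where "H z = (if Im z > 0 then h z else 0)" for z
  have cont: "continuous_on {z. Im z \<ge> 0} H"
    unfolding H_def[abs_def]
    by (rule continuous_on_zero_extension[OF holomorphic_on_imp_continuous_on[OF h] lim])
  have "continuous_on {z. Im z \<le> 0} H"
    by (rule continuous_on_eq[of _ "\<lambda>_. 0"]) (auto simp: H_def)
  with cont have "continuous_on ({z. Im z \<ge> 0} \<union> {z. Im z \<le> 0}) H"
    by (intro continuous_on_closed_Un closed_halfspace_Im_ge closed_halfspace_Im_le)
  moreover have "{z. Im z \<ge> 0} \<union> {z. Im z \<le> 0} = UNIV" by auto
  ultimately have contU: "continuous_on UNIV H" by simp
  have low: "H holomorphic_on {z. Im z < 0}"
    by (rule holomorphic_transform[of "\<lambda>_. 0"]) (auto simp: H_def)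
  have up: "H holomorphic_on {z. Im z > 0}"
    by (rule holomorphic_transform[OF h]) (auto simp: H_def)
  \<comment> \<open>Instead of reflecting h, it is extended by 0: the extension is continuous,
    holomorphic on both sides of the line, hence entire, and it vanishes on an open
    half-plane.\<close>
  have "H holomorphic_on UNIV"
    by (rule holomorphic_on_paste_across_line[where d = "\<i>" and k = 0])
       (use low up contU in \<open>auto simp: inner_complex_def\<close>)
  moreover have "{z. Im z < 0} \<noteq> {}"
    by (auto intro!: exI[of _ "- \<i>"])
  ultimately have "H z = 0"
    by (intro analytic_continuation_open[of "{z. Im z < 0}" UNIV H "\<lambda>_. 0" z])
       (auto simp: H_def open_halfspace_Im_lt convex_connected)
  thus ?thesis using z by (simp add: H_def)
qed

text \<open>Two derivatives of u make y^(-\<alpha>) times its antiholomorphic derivative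
  differentiable; \<alpha>-harmonicity leaves only a cnj h component, and composing with conjugation
  makes that complex linear.\<close>

lemma alpha_harmonic_antiholomorphic_part:
  assumes "alpha_harmonic \<alpha> u"
  obtains f where "f holomorphic_on {z. Im z < 0}"
    "\<And>z. Im z > 0 \<Longrightarrow> (u has_derivative (\<lambda>h. wirtinger u z * h + of_real (Im z powr \<alpha>) * f (cnj z) * cnj h)) (at z)"
proof -
  define G where "G w = of_real (Im w powr (- \<alpha>)) * wirtinger_bar u w" for w
  define f where "f \<zeta> = G (cnj \<zeta>)" for \<zeta>
  note op = open_upper_half_plane
  have C2: "Ck_on (Suc (Suc 0)) upper_half_plane u"
    using assms unfolding alpha_harmonic_def by (simp add: numeral_2_eq_2)
  have G0: "wirtinger G z = 0" if "Im z > 0" for z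
    using assms that unfolding alpha_harmonic_def G_def[abs_def] upper_half_plane_def by blast
  have "G = (\<lambda>w. of_real (Im w powr (- \<alpha>)) * (1/2 * partial_x u w + \<i>/2 * partial_y u w))"
    by (auto simp: G_def wirtinger_bar_def add_divide_distrib)
  moreover have "Ck_on (Suc 0) upper_half_plane (\<lambda>w. of_real (Im w powr (- \<alpha>)) * (1/2 * partial_x u w + \<i>/2 * partial_y u w))"
    using C2 unfolding Ck_on.simps(2)[of "Suc 0"]
    by (intro Ck_on_mult Ck_on_add Ck_on_const Ck_on_Im_powr op) auto
  ultimately have "Ck_on (Suc 0) upper_half_plane G" by simp
  hence Gd: "G differentiable (at z)" if "Im z > 0" for z
    using that op by (auto simp: differentiable_on_eq_differentiable_at upper_half_plane_def)
  have ud: "u differentiable (at z)" if "Im z > 0" for z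
    using C2 that op by (auto simp: differentiable_on_eq_differentiable_at upper_half_plane_def)
  show thesis
  proof
    have "\<exists>D. (f has_field_derivative D) (at \<zeta>)" if "\<zeta> \<in> {z. Im z < 0}" for \<zeta>
    proof -
      have im: "Im (cnj \<zeta>) > 0" using that by simp
      have cnj: "(cnj has_derivative cnj) (at \<zeta>)"
        by (simp add: bounded_linear_imp_has_derivative bounded_linear_cnj)
      from has_derivative_compose[OF this has_derivative_wirtinger[OF Gd[OF im]]]
      have "(f has_derivative (\<lambda>h. wirtinger_bar G (cnj \<zeta>) * h)) (at \<zeta>)"
        by (simp add: f_def[abs_def] G0[OF im])
      thus ?thesis by (auto simp: has_field_derivative_def)
    qed
    thus "f holomorphic_on {z. Im z < 0}"
      by (auto simp: holomorphic_on_open open_halfspace_Im_lt)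
    fix z assume z: "Im z > 0"
    have "complex_of_real (Im z powr \<alpha>) * of_real (Im z powr (- \<alpha>)) = 1"
      using z by (simp flip: of_real_mult powr_add)
    hence "of_real (Im z powr \<alpha>) * f (cnj z) = wirtinger_bar u z"
      by (simp add: f_def G_def flip: mult.assoc)
    thus "(u has_derivative (\<lambda>h. wirtinger u z * h + of_real (Im z powr \<alpha>) * f (cnj z) * cnj h)) (at z)"
      using has_derivative_wirtinger[OF ud[OF z]] by simp
  qed
qed

text \<open>The numerator 1 + |z|^2 makes the comparison quantity at least 1 everywhere, so one
  bound covers large z, where growth is assumed, and the half disc |z| \<le> R, where u extended by
  0 is bounded by compactness.\<close>

lemma temperate_growth_global:
  assumes cont: "continuous_on {z. Im z > 0} u"
    and lim: "\<And>x::real. (u \<longlongrightarrow> 0) (at (of_real x) within {z. Im z > 0})"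
    and growth: "temperate_growth_at_infinity u"
  obtains C N where "C \<ge> 0" "\<And>z. Im z > 0 \<Longrightarrow> norm (u z) \<le> C * ((1 + (norm z)\<^sup>2) / Im z) ^ N"
proof -
  obtain C R N where CRN: "C > 0" "R > 0" "N > 0"
    "\<And>z. Im z > 0 \<Longrightarrow> norm z > R \<Longrightarrow> norm (u z) \<le> C * ((norm z)\<^sup>2 / Im z) powr N"
    using growth unfolding temperate_growth_at_infinity_def upper_half_plane_def by blast
  have "continuous_on ({z. Im z \<ge> 0} \<inter> cball 0 R) (\<lambda>z. if Im z > 0 then u z else 0)"
    by (rule continuous_on_subset[OF continuous_on_zero_extension[OF cont lim]]) auto
  moreover have "compact ({z. Im z \<ge> 0} \<inter> cball 0 R)"
    by (intro closed_Int_compact closed_halfspace_Im_ge compact_cball)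
  ultimately have "bounded ((\<lambda>z. if Im z > 0 then u z else 0) ` ({z. Im z \<ge> 0} \<inter> cball 0 R))"
    by (intro compact_imp_bounded compact_continuous_image)
  then obtain B where B: "\<forall>x \<in> (\<lambda>z. if Im z > 0 then u z else 0) ` ({z. Im z \<ge> 0} \<inter> cball 0 R). norm x \<le> B"
    by (auto simp only: bounded_iff)
  obtain M :: nat where M: "N \<le> real M" using real_arch_simple by blast
  show thesis
  proof
    show "C + \<bar>B\<bar> \<ge> 0" using CRN by simp
    fix z assume z: "Im z > 0"
    let ?X = "(1 + (norm z)\<^sup>2) / Im z"
    have "0 \<le> (norm z - 1)\<^sup>2" by simp
    hence "2 * norm z \<le> 1 + (norm z)\<^sup>2" by (simp add: power2_eq_square algebra_simps)
    hence "Im z \<le> 1 + (norm z)\<^sup>2" using abs_Im_le_cmod[of z] norm_ge_zero[of z] by linarith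
    hence X: "?X \<ge> 1" using z by simp
    show "norm (u z) \<le> (C + \<bar>B\<bar>) * ?X ^ M"
    proof (cases "norm z > R")
      case True
      have "norm (u z) \<le> C * ((norm z)\<^sup>2 / Im z) powr N" by (rule CRN(4)[OF z True])
      also have "\<dots> \<le> C * ?X powr N"
        using CRN z by (intro mult_left_mono powr_mono2 divide_right_mono) auto
      also have "\<dots> \<le> C * ?X powr (real M)" using CRN X M by (intro mult_left_mono powr_mono) auto
      also have "?X powr (real M) = ?X ^ M" using X by (intro powr_realpow) linarith
      also have "C * ?X ^ M \<le> (C + \<bar>B\<bar>) * ?X ^ M" using X by (intro mult_right_mono zero_le_power) auto
      finally show ?thesis .
    next
      case False
      hence "u z \<in> (\<lambda>z. if Im z > 0 then u z else 0) ` ({z. Im z \<ge> 0} \<inter> cball 0 R)"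
        using z by (intro image_eqI[of _ _ z]) auto
      with B have "norm (u z) \<le> B" by blast
      hence "norm (u z) \<le> (C + \<bar>B\<bar>) * 1" using CRN(1) by simp
      also have "\<dots> \<le> (C + \<bar>B\<bar>) * ?X ^ M" using X CRN by (intro mult_left_mono one_le_power) auto
      finally show ?thesis .
    qed
  qed
qed

theorem corollary5p4:
  fixes \<alpha> :: real and u :: "complex \<Rightarrow> complex"
  assumes "\<alpha> > -1"
  shows "u \<in> V_class \<alpha> \<longleftrightarrow>
    alpha_harmonic \<alpha> u \<and>
    temperate_growth_at_infinity u \<and>
    (\<forall>x::real. (u \<longlongrightarrow> 0) (at (complex_of_real x) within upper_half_plane))"
proof (intro iffI conjI allI)
  assume "u \<in> V_class \<alpha>"
  then obtain n c where u: "\<And>z. z \<in> upper_half_plane \<Longrightarrow>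
      u z = (\<Sum>k\<le>n. c k * of_real (Im z powr (\<alpha> + 1)) * p_poly k \<alpha> z)"
    unfolding V_class_def by blast
  show "alpha_harmonic \<alpha> u"
    by (rule V_class_alpha_harmonic[OF u])
  show "temperate_growth_at_infinity u"
    by (rule V_class_temperate_growth[OF assms u])
  show "(u \<longlongrightarrow> 0) (at (complex_of_real x) within upper_half_plane)" for x
    by (rule V_class_boundary[OF assms u])
next
  assume *: "alpha_harmonic \<alpha> u \<and> temperate_growth_at_infinity u \<and>
    (\<forall>x::real. (u \<longlongrightarrow> 0) (at (complex_of_real x) within upper_half_plane))"
  obtain f where f: "f holomorphic_on {z. Im z < 0}"
    and du: "\<And>z. Im z > 0 \<Longrightarrow> (u has_derivative (\<lambda>h. wirtinger u z * h + of_real (Im z powr \<alpha>) * f (cnj z) * cnj h)) (at z)"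
    using alpha_harmonic_antiholomorphic_part * by blast
  have du': "\<exists>P. (u has_derivative (\<lambda>h. P * h + of_real (Im z powr \<alpha>) * f (cnj z) * cnj h)) (at z)"
    if "Im z > 0" for z
    using du[OF that] by blast
  have lim: "(u \<longlongrightarrow> 0) (at (complex_of_real x) within {z. Im z > 0})" for x
    using * by (simp add: upper_half_plane_def)
  have "continuous_on {z. Im z > 0} u"
    using du has_derivative_continuous by (intro continuous_at_imp_continuous_on) blast
  then obtain C N where C: "C \<ge> 0" and growth: "\<And>z. Im z > 0 \<Longrightarrow> norm (u z) \<le> C * ((1 + (norm z)\<^sup>2) / Im z) ^ N"
    using temperate_growth_global lim * by blast
  obtain q where q: "\<And>z. Im z < 0 \<Longrightarrow> f z = poly q z"
    using antiholomorphic_part_polynomial[OF assms f du' C growth lim] by blast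
  \<comment> \<open>Makes v have the same cnj h component in its derivative as u, so that u - v is
    holomorphic.\<close>
  define c where "c k = coeff q k / V_coeff \<alpha> k" for k
  define v where "v z = (\<Sum>k\<le>degree q. c k * of_real (Im z powr (\<alpha> + 1)) * p_poly k \<alpha> z)" for z
  have sum: "(\<Sum>k\<le>degree q. c k * V_coeff \<alpha> k * cnj z ^ k) = f (cnj z)" if "Im z > 0" for z
  proof -
    have "f (cnj z) = poly q (cnj z)" using q that by simp
    thus ?thesis using V_coeff_nonzero[OF assms] by (simp add: c_def poly_altdef)
  qed
  have "\<exists>D. ((\<lambda>z. u z - v z) has_field_derivative D) (at z)" if z: "z \<in> {z. Im z > 0}" for z
  proof -
    have z: "Im z > 0" using z by simp
    obtain P where P: "(v has_derivative (\<lambda>h. P * h + of_real (Im z powr \<alpha>) * f (cnj z) * cnj h)) (at z)"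
      using V_sum_has_derivative[OF z, of c \<alpha> "degree q"] unfolding sum[OF z] v_def[abs_def] by blast
    have "((\<lambda>z. u z - v z) has_derivative (\<lambda>h. (wirtinger u z - P) * h)) (at z)"
      by (rule has_derivative_eq_rhs[OF has_derivative_diff[OF du[OF z] P]]) (auto simp: algebra_simps)
    thus ?thesis by (auto simp: has_field_derivative_def)
  qed
  hence "(\<lambda>z. u z - v z) holomorphic_on {z. Im z > 0}"
    by (auto simp: holomorphic_on_open open_halfspace_Im_gt)
  moreover have "((\<lambda>z. u z - v z) \<longlongrightarrow> 0) (at (complex_of_real x) within {z. Im z > 0})" for x
    using tendsto_diff[OF lim V_class_boundary[OF assms v_def, unfolded upper_half_plane_def]] by simp
  ultimately have "u z = v z" if "Im z > 0" for z
    using holomorphic_zero_boundary_imp_zero[of "\<lambda>z. u z - v z" z] that by simp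
  thus "u \<in> V_class \<alpha>"
    unfolding V_class_def upper_half_plane_def v_def by blast
qed

end
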